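(* Let $T$ be an $m$-linear operator acting on $m$-tuples of functions on $\mathbb{R}^n$. Fix $1<p_j<\infty$, $1\le j\le m$, put $\mathbf{P}=(p_1,\dots,p_m)$, and let $1<p<\infty$ be such that $\frac1p=\sum_{j=1}^m\frac1{p_j}$. Suppose that there exists an increasing function $\phi:[1,\infty)\to[0,\infty)$ such that for all $\mathbf{w}=(w_1,\dots,w_m)\in A_{\mathbf{P}}$, we have $$\|T\mathbf{f}\|_{L^p(\nu_{\mathbf{w}})}\lesssim\phi\big([\mathbf{w}]_{A_{\mathbf{P}}}\big)\prod_{j=1}^m\|f_j\|_{L^{p_j}(w_j)}.$$ Then, for all $\mathbf{b}=(b_1,\dots,b_m)\in\mathcal{BMO}^m$, for each multi-index $\alpha$, and for all $\mathbf{w}\in A_{\mathbf{P}}$, we have $$\|[T,\mathbf{b}]_\alpha\mathbf{f}\|_{L^p(\nu_{\mathbf{w}})}\lesssim\alpha!\,\phi\big(c_{\mathbf{P}}[\mathbf{w}]_{A_{\mathbf{P}}}\big)\,[\mathbf{w}]_{A_{\mathbf{P}}}^{|\alpha|\max\{p,p_1',\dots,p_m'\}}\prod_{j=1}^m\|b_j\|_{\mathcal{BMO}}^{\alpha_j}\,\|f_j\|_{L^{p_j}(w_j)},$$ where $c_{\mathbf{P}}=4^{1+\sum_{j=1}^m\min\{1/p_j,1/p_j'\}}$.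
   Context: A weight is a non-negative locally integrable function on $\mathbb{R}^n$; $\|f\|_{L^p(w)}=(\int_{\mathbb{R}^n}|f|^pw\,dx)^{1/p}$; $p_j'$ is the conjugate exponent of $p_j$. $Q$ denotes cubes in $\mathbb{R}^n$ with sides parallel to the axes, $f_Q=\frac1{|Q|}\int_Qf\,dx$. For a vector of weights $\mathbf{w}=(w_1,\dots,w_m)$ set $\nu_{\mathbf{w}}=\prod_{j=1}^mw_j^{p/p_j}$; $\mathbf{w}\in A_{\mathbf{P}}$ means $$[\mathbf{w}]_{A_{\mathbf{P}}}:=\sup_Q\Big(\frac1{|Q|}\int_Q\nu_{\mathbf{w}}\,dx\Big)^{1/p}\prod_{j=1}^m\Big(\frac1{|Q|}\int_Qw_j^{1-p_j'}\,dx\Big)^{1/p_j'}<\infty.$$ $\|f\|_{\exp L,Q}:=\inf\{\lambda>0:\ \frac1{|Q|}\int_Qe^{|f|/\lambda}\,dx\le2\}$, and $\mathcal{BMO}$ is the space of locally integrable $b$ with $\|b\|_{\mathcal{BMO}}:=\sup_Q\|b-b_Q\|_{\exp L,Q}<\infty$. For $\mathbf{f}=(f_1,\dots,f_m)$ and $\mathbf{b}=(b_1,\dots,b_m)$ measurable, commutators are defined (whenever they make sense) by $$[T,\mathbf{b}]_{e_j}(\mathbf{f})=b_jT(f_1,\dots,f_j,\dots,f_m)-T(f_1,\dots,b_jf_j,\dots,f_m),$$ $[T,\mathbf{b}]_{ke_j}=[\cdots[[T,\mathbf{b}]_{e_j},\mathbf{b}]_{e_j}\cdots,\mathbf{b}]_{e_j}$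 ($k$ times), and for a multi-index $\alpha=(\alpha_1,\dots,\alpha_m)\in(\mathbb{N}\cup\{0\})^m$, $[T,\mathbf{b}]_\alpha=[\cdots[[T,\mathbf{b}]_{\alpha_1e_1},\mathbf{b}]_{\alpha_2e_2}\cdots,\mathbf{b}]_{\alpha_me_m}$. As usual $|\alpha|=\sum_j\alpha_j$ and $\alpha!=\prod_j\alpha_j!$. $X\lesssim Y$ means $X\le CY$ with $C$ independent of $\mathbf{f}$, $\mathbf{b}$ and $\mathbf{w}$ ($C$ may depend on $n,m,\mathbf{P},\alpha$ and, in the conclusion, on the implicit constant in the hypothesis). *)

theory Defs
  imports "HOL-Analysis.Analysis"
begin

text \<open>
  Conventions. The index type \<open>'m\<close> plays the role of \<open>{1,\<dots>,m}\<close> (its linear order is the order in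
  which the commutators are iterated), so an \<open>m\<close>-tuple is a function on \<open>'m\<close>. Functions are
  complex-valued on \<open>real ^ 'n\<close>, measurability is Lebesgue measurability, and norms and
  characteristics take values in \<open>ennreal\<close>, so that a supremum or an integral may be infinite.
\<close>

text \<open>Powers on \<open>[0,\<infinity>]\<close>; only used with a positive exponent, hence \<open>\<infinity>\<^sup>a = \<infinity>\<close>.\<close>

definition ennpow :: "ennreal \<Rightarrow> real \<Rightarrow> ennreal" where
  "ennpow x a = (if x = top then top else ennreal (enn2real x powr a))"

definition conj_exp :: "real \<Rightarrow> real" where
  "conj_exp q = q / (q - 1)"

definition cubes :: "(real ^ 'n) set set" where
  "cubes = {cbox a (a + (\<chi> i. l)) | a l. 0 < l}"

definition avg :: "(real ^ 'n) set \<Rightarrow> (real ^ 'n \<Rightarrow> complex) \<Rightarrow> complex" where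
  "avg Q f = (LINT x:Q|lebesgue. f x) /\<^sub>R measure lebesgue Q"

definition nn_avg :: "(real ^ 'n) set \<Rightarrow> (real ^ 'n \<Rightarrow> real) \<Rightarrow> ennreal" where
  "nn_avg Q g = (\<integral>\<^sup>+x\<in>Q. ennreal (g x) \<partial>lebesgue) / emeasure lebesgue Q"

definition locally_integrable :: "(real ^ 'n \<Rightarrow> 'b::{banach, second_countable_topology}) \<Rightarrow> bool" where
  "locally_integrable f \<longleftrightarrow> (\<forall>K. compact K \<longrightarrow> set_integrable lebesgue K f)"

definition weight :: "(real ^ 'n \<Rightarrow> real) \<Rightarrow> bool" where
  "weight w \<longleftrightarrow> (\<forall>x. 0 \<le> w x) \<and> locally_integrable w"

definition Lp_norm :: "real \<Rightarrow> (real ^ 'n \<Rightarrow> real) \<Rightarrow> (real ^ 'n \<Rightarrow> complex) \<Rightarrow> ennreal" where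
  "Lp_norm q w f = ennpow (\<integral>\<^sup>+x. ennreal (norm (f x) powr q * w x) \<partial>lebesgue) (1 / q)"

definition Lp :: "real \<Rightarrow> (real ^ 'n \<Rightarrow> real) \<Rightarrow> (real ^ 'n \<Rightarrow> complex) set" where
  "Lp q w = {f \<in> borel_measurable lebesgue. Lp_norm q w f < top}"

definition nu :: "('m::finite \<Rightarrow> real) \<Rightarrow> real \<Rightarrow> ('m \<Rightarrow> real ^ 'n \<Rightarrow> real) \<Rightarrow> real ^ 'n \<Rightarrow> real" where
  "nu P p w = (\<lambda>x. \<Prod>j\<in>UNIV. w j x powr (p / P j))"

definition AP_char :: "('m::finite \<Rightarrow> real) \<Rightarrow> real \<Rightarrow> ('m \<Rightarrow> real ^ 'n \<Rightarrow> real) \<Rightarrow> ennreal" where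
  "AP_char P p w =
     (SUP Q\<in>cubes. ennpow (nn_avg Q (nu P p w)) (1 / p) *
        (\<Prod>j\<in>UNIV. ennpow (nn_avg Q (\<lambda>x. w j x powr (1 - conj_exp (P j)))) (1 / conj_exp (P j))))"

text \<open>
  Positivity almost everywhere is what makes the negative power \<open>w\<^sub>j\<^bsup>1-p\<^sub>j'\<^esup>\<close> meaningful (in
  Isabelle \<open>0 powr a = 0\<close> also for \<open>a < 0\<close>) and gives \<open>AP_char P p w \<ge> 1\<close>. If some \<open>w\<^sub>j\<close> vanishes on a
  set of positive measure, reading \<open>0\<^bsup>1-p\<^sub>j'\<^esup>\<close> as \<open>\<infinity>\<close> makes the characteristic infinite anyway, except
  in the degenerate case \<open>\<nu> = 0\<close> a.e., where it would depend on a convention for \<open>0 * \<infinity>\<close>.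
\<close>

definition AP :: "('m::finite \<Rightarrow> real) \<Rightarrow> real \<Rightarrow> ('m \<Rightarrow> real ^ 'n \<Rightarrow> real) set" where
  "AP P p = {w. (\<forall>j. weight (w j) \<and> (AE x in lebesgue. 0 < w j x)) \<and> AP_char P p w < top}"

text \<open>The infimum over an empty set of \<open>\<lambda>\<close> is \<open>\<infinity>\<close>.\<close>

definition expL_norm :: "(real ^ 'n) set \<Rightarrow> (real ^ 'n \<Rightarrow> complex) \<Rightarrow> ennreal" where
  "expL_norm Q f = Inf {ennreal l | l. 0 < l \<and> nn_avg Q (\<lambda>x. exp (norm (f x) / l)) \<le> 2}"

definition BMO_norm :: "(real ^ 'n \<Rightarrow> complex) \<Rightarrow> ennreal" where
  "BMO_norm b = (SUP Q\<in>cubes. expL_norm Q (\<lambda>x. b x - avg Q b))"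

definition BMO :: "(real ^ 'n \<Rightarrow> complex) set" where
  "BMO = {b. locally_integrable b \<and> BMO_norm b < top}"

text \<open>
  An operator is a total function on tuples, but only its values on the tuples belonging to
  \<open>L\<^bsup>p\<^sub>1\<^esup>(w\<^sub>1) \<times> \<dots> \<times> L\<^bsup>p\<^sub>m\<^esup>(w\<^sub>m)\<close> for some \<open>w \<in> AP P p\<close> matter. It is \<open>m\<close>-linear if it is linear in each
  slot on each of these product spaces; as the values are elements of Lebesgue spaces, the identity
  is required almost everywhere.
\<close>

definition multilinear_op ::
  "('m::finite \<Rightarrow> real) \<Rightarrow> real \<Rightarrow> (('m \<Rightarrow> real ^ 'n \<Rightarrow> complex) \<Rightarrow> real ^ 'n \<Rightarrow> complex) \<Rightarrow> bool" where
  "multilinear_op P p T \<longleftrightarrow>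
     (\<forall>w\<in>AP P p. \<forall>f j g c d. (\<forall>i. f i \<in> Lp (P i) (w i)) \<longrightarrow> g \<in> Lp (P j) (w j) \<longrightarrow>
        (AE x in lebesgue.
           T (f(j := \<lambda>y. c * f j y + d * g y)) x = c * T f x + d * T (f(j := g)) x))"

definition comm1 ::
  "('m \<Rightarrow> real ^ 'n \<Rightarrow> complex) \<Rightarrow> 'm \<Rightarrow>
   (('m \<Rightarrow> real ^ 'n \<Rightarrow> complex) \<Rightarrow> real ^ 'n \<Rightarrow> complex) \<Rightarrow>
   (('m \<Rightarrow> real ^ 'n \<Rightarrow> complex) \<Rightarrow> real ^ 'n \<Rightarrow> complex)" where
  "comm1 b j T = (\<lambda>f x. b j x * T f x - T (f(j := \<lambda>y. b j y * f j y)) x)"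

text \<open>Here \<open>fold\<close> applies the commutators in the least index first, i.e. innermost.\<close>

definition comm ::
  "('m::{finite, linorder} \<Rightarrow> real ^ 'n \<Rightarrow> complex) \<Rightarrow> ('m \<Rightarrow> nat) \<Rightarrow>
   (('m \<Rightarrow> real ^ 'n \<Rightarrow> complex) \<Rightarrow> real ^ 'n \<Rightarrow> complex) \<Rightarrow>
   (('m \<Rightarrow> real ^ 'n \<Rightarrow> complex) \<Rightarrow> real ^ 'n \<Rightarrow> complex)" where
  "comm b \<alpha> T = fold (\<lambda>j. comm1 b j ^^ \<alpha> j) (sorted_list_of_set UNIV) T"

definition c_const :: "('m::finite \<Rightarrow> real) \<Rightarrow> real" where
  "c_const P = 4 powr (1 + (\<Sum>j\<in>UNIV. min (1 / P j) (1 / conj_exp (P j))))"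

end

theory Submission
  imports Defs
begin

text \<open>
  For a single commutator put \<open>\<Phi>(z) = e\<^bsup>zb\<^esup> T(\<dots>, e\<^bsup>-zb\<^esup> f\<^sub>j, \<dots>)\<close>, so that \<open>[T,b]\<^sub>e\<^sub>j f = \<Phi>'(0)\<close>. By
  Cauchy's formula its norm is at most \<open>\<delta>\<^bsup>-1\<^esup>\<close> times the supremum over \<open>\<bar>z\<bar> = \<delta>\<close> of \<open>\<parallel>\<Phi>(z)\<parallel>\<close>, which is
  the norm of \<open>T\<close> for the weights with \<open>w\<^sub>j\<close> replaced by \<open>w\<^sub>j exp (p\<^sub>j Re (z b))\<close>. A sharp reverse
  Hoelder inequality for \<open>\<nu>\<^sub>w\<close> and the dual weights shows that these weights have characteristic at
  most \<open>c [w]\<close> as soon as \<open>\<delta>\<close> is a small multiple of \<open>[w]\<^bsup>-max{p, p\<^sub>j'}\<^esup> \<parallel>b\<parallel>\<^bsup>-1\<^esup>\<close>. Here \<open>c > 1\<close> can be taken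
  arbitrarily close to 1, so the estimate may be iterated \<open>\<bar>\<alpha>\<bar>\<close> times at total cost \<open>c\<^bsup>\<bar>\<alpha>\<bar>\<^esup> \<le> 4\<close>.
  The values of \<open>T\<close> are only defined almost everywhere, so Cauchy's formula is used in the form of
  averages over roots of unity, followed by Fatou's lemma.
\<close>

section \<open>Hoelder inequalities\<close>

text \<open>Since \<open>T\<close> is an arbitrary function, \<Phi> is not known to be holomorphic,
  or even continuous, at a given point x. Its power series is therefore proved by hand. All b^k f_j,
  and e^(-zb) f_j for small z, lie in L^(p_j) of one smaller weight w_j exp(-p_j \<kappa> |b|),
  which stays in the class. Finite linearity peels off one term at a time, and the remainders decay
  geometrically in norm. Each step costs a null set, so only countably many z may occur.

  The power of the characteristic A arises as follows. The averages of \<nu> and of the dual weights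
  enter with exponents \<theta> equal to 1/p and 1/p_j', and the product of these weights, raised to
  the powers \<theta>, is 1. Hoelder then shows that on at least half of every cube each weight
  exceeds its average times a multiple of A^(-1/\<theta>). The reverse Hoelder gain, and with it the
  admissible \<delta>, is linear in this factor, and 1/\<theta> runs through p, p_1', ..., p_m'.

  That c can be close to 1 comes from interpolating, with a small parameter \<tau>, between a weight
  and its reverse Hoelder estimate: the constants 2 enter only as 2^\<tau>.\<close>

lemma weighted_am_gm:
  fixes x t :: "'a \<Rightarrow> real"
  assumes "finite S" and x: "\<And>i. i \<in> S \<Longrightarrow> 0 \<le> x i" and t: "\<And>i. i \<in> S \<Longrightarrow> 0 \<le> t i"
    and sum_t: "(\<Sum>i\<in>S. t i) = 1"
  shows "(\<Prod>i\<in>S. x i powr t i) \<le> (\<Sum>i\<in>S. t i * x i)"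
proof (cases "\<exists>i\<in>S. x i = 0")
  case True
  \<comment> \<open>\<open>0 powr 0 = 0\<close>, so a zero factor kills the product whatever its
    exponent.\<close>
  then have "(\<Prod>i\<in>S. x i powr t i) = 0"
    using \<open>finite S\<close> by (intro prod_zero) auto
  then show ?thesis
    using x t by (auto intro!: sum_nonneg mult_nonneg_nonneg)
next
  case False
  then have pos: "0 < x i" if "i \<in> S" for i
    using x[OF that] that by fastforce
  have "S \<noteq> {}"
    using sum_t by auto
  then have "exp (\<Sum>i\<in>S. t i *\<^sub>R ln (x i)) \<le> (\<Sum>i\<in>S. t i * exp (ln (x i)))"
    using assms by (intro convex_on_sum[OF _ _ exp_convex]) auto
  moreover have "exp (\<Sum>i\<in>S. t i *\<^sub>R ln (x i)) = (\<Prod>i\<in>S. x i powr t i)"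
    unfolding exp_sum[OF \<open>finite S\<close>] using pos by (intro prod.cong) (fastforce simp: powr_def)+
  moreover have "(\<Sum>i\<in>S. t i * exp (ln (x i))) = (\<Sum>i\<in>S. t i * x i)"
    using pos by (intro sum.cong) auto
  ultimately show ?thesis
    by simp
qed

text \<open>Hoelder for finitely many factors: after division of \<open>f i\<close> by
  \<open>c i\<close>, AM-GM holds pointwise and its right side integrates to at most \<Sum> t i = 1.
  Bounds \<open>c i\<close> in place of the integrals keep the constants real and nonzero.\<close>

lemma nn_integral_prod_powr_le:
  fixes f :: "'a \<Rightarrow> 'b \<Rightarrow> real"
  assumes "finite S" and meas: "\<And>i. i \<in> S \<Longrightarrow> f i \<in> borel_measurable M"
    and f: "\<And>i x. i \<in> S \<Longrightarrow> 0 \<le> f i x" and t: "\<And>i. i \<in> S \<Longrightarrow> 0 \<le> t i"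
    and sum_t: "(\<Sum>i\<in>S. t i) = 1" and c: "\<And>i. i \<in> S \<Longrightarrow> 0 < c i"
    and le: "\<And>i. i \<in> S \<Longrightarrow> (\<integral>\<^sup>+x. ennreal (f i x) \<partial>M) \<le> ennreal (c i)"
  shows "(\<integral>\<^sup>+x. ennreal (\<Prod>i\<in>S. f i x powr t i) \<partial>M) \<le> ennreal (\<Prod>i\<in>S. c i powr t i)"
proof -
  let ?C = "\<Prod>i\<in>S. c i powr t i"
  have c': "0 \<le> c i" if "i \<in> S" for i
    using c[OF that] by simp
  have pt: "(\<Prod>i\<in>S. f i x powr t i) \<le> (\<Sum>i\<in>S. ?C * t i / c i * f i x)" for x
  proof -
    have "(\<Prod>i\<in>S. f i x powr t i) = ?C * (\<Prod>i\<in>S. (f i x / c i) powr t i)"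
      unfolding prod.distrib[symmetric]
      by (intro prod.cong refl) (use f c in \<open>auto simp: powr_divide less_imp_le dest!: c\<close>)
    also have "\<dots> \<le> ?C * (\<Sum>i\<in>S. t i * (f i x / c i))"
      using assms by (intro mult_left_mono weighted_am_gm prod_nonneg) (auto simp: less_imp_le)
    finally show ?thesis
      by (simp add: sum_distrib_left mult.assoc)
  qed
  have "(\<integral>\<^sup>+x. ennreal (\<Prod>i\<in>S. f i x powr t i) \<partial>M)
      \<le> (\<integral>\<^sup>+x. (\<Sum>i\<in>S. ennreal (?C * t i / c i) * ennreal (f i x)) \<partial>M)"
  proof (rule nn_integral_mono)
    fix x
    have "ennreal (\<Prod>i\<in>S. f i x powr t i) \<le> ennreal (\<Sum>i\<in>S. ?C * t i / c i * f i x)"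
      using pt by (rule ennreal_leI)
    also have "\<dots> = (\<Sum>i\<in>S. ennreal (?C * t i / c i * f i x))"
      by (rule sum_ennreal[symmetric]) (use t f c' in \<open>auto intro!: mult_nonneg_nonneg divide_nonneg_nonneg prod_nonneg\<close>)
    also have "\<dots> = (\<Sum>i\<in>S. ennreal (?C * t i / c i) * ennreal (f i x))"
      by (intro sum.cong refl ennreal_mult) (use t f c' in \<open>auto intro!: mult_nonneg_nonneg divide_nonneg_nonneg prod_nonneg\<close>)
    finally show "ennreal (\<Prod>i\<in>S. f i x powr t i) \<le> \<dots>" .
  qed
  also have "\<dots> = (\<Sum>i\<in>S. ennreal (?C * t i / c i) * (\<integral>\<^sup>+x. ennreal (f i x) \<partial>M))"
    using meas by (simp add: nn_integral_sum nn_integral_cmult)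
  also have "\<dots> \<le> (\<Sum>i\<in>S. ennreal (?C * t i / c i) * ennreal (c i))"
    by (intro sum_mono mult_left_mono le) auto
  also have "\<dots> = (\<Sum>i\<in>S. ennreal (?C * t i))"
    using c t by (intro sum.cong refl) (auto simp flip: ennreal_mult'' simp: less_imp_le dest!: c)
  also have "\<dots> = ennreal (\<Sum>i\<in>S. ?C * t i)"
    by (rule sum_ennreal) (use t in \<open>auto intro!: mult_nonneg_nonneg prod_nonneg\<close>)
  also have "(\<Sum>i\<in>S. ?C * t i) = ?C"
    by (simp flip: sum_distrib_left add: sum_t)
  finally show ?thesis .
qed

text \<open>Young's inequality a m^(p-1) \<le> a^p / p + (1 - 1/p) m^p at the mean m, summed over
  \<open>S\<close>; the left sides add up to N m^p, where N = \<open>card S\<close>. It later bounds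
  circle averages pointwise.\<close>

lemma powr_mean_le:
  fixes a :: "'a \<Rightarrow> real"
  assumes "finite S" "S \<noteq> {}" and a: "\<And>i. i \<in> S \<Longrightarrow> 0 \<le> a i" and p: "1 < p"
  shows "((\<Sum>i\<in>S. a i) / card S) powr p \<le> (\<Sum>i\<in>S. a i powr p) / card S"
proof -
  define m where "m = (\<Sum>i\<in>S. a i) / card S"
  have N: "0 < real (card S)"
    using assms by (simp add: card_gt_0_iff)
  have "0 \<le> m"
    unfolding m_def using a by (auto intro!: sum_nonneg divide_nonneg_nonneg)
  have "a i * m powr (p - 1) \<le> a i powr p / p + m powr p * (1 - 1 / p)" if "i \<in> S" for i
    using weighted_am_gm[of "{True, False}" "\<lambda>b. if b then a i powr p else m powr p"
        "\<lambda>b. if b then 1 / p else 1 - 1 / p"] a[OF that] p \<open>0 \<le> m\<close>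
    by (simp add: powr_powr right_diff_distrib mult.commute)
  then have "(\<Sum>i\<in>S. a i * m powr (p - 1)) \<le> (\<Sum>i\<in>S. a i powr p / p + m powr p * (1 - 1 / p))"
    by (rule sum_mono)
  then have "(\<Sum>i\<in>S. a i) * m powr (p - 1)
      \<le> (\<Sum>i\<in>S. a i powr p) / p + card S * m powr p * (1 - 1 / p)"
    by (simp add: sum.distrib sum_distrib_right sum_divide_distrib mult.assoc)
  moreover have "(\<Sum>i\<in>S. a i) = card S * m"
    using N by (simp add: m_def)
  moreover have "m * m powr (p - 1) = m powr p"
    using \<open>0 \<le> m\<close> p by (cases "m = 0") (auto simp: powr_diff)
  ultimately have "card S * m powr p
      \<le> (\<Sum>i\<in>S. a i powr p) / p + card S * m powr p * (1 - 1 / p)"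
    by (simp add: mult.assoc)
  then have "card S * m powr p \<le> (\<Sum>i\<in>S. a i powr p)"
    using p by (simp add: field_simps)
  then show ?thesis
    using N by (simp add: m_def[symmetric] field_simps)
qed

section \<open>Cubes and the reverse Hoelder inequality\<close>

text \<open>As a simp rule it would rewrite \<open>emeasure lebesgue S\<close> into the
  \<open>lborel\<close> measure of a main part of S.\<close>

declare emeasure_completion [simp del]

section \<open>Axis-parallel cubes and their dilates\<close>

definition cube :: "real ^ 'n \<Rightarrow> real \<Rightarrow> (real ^ 'n) set" where
  "cube a l = cbox a (a + (\<chi> i. l))"

lemma cubes_eq: "cubes = {cube a l | a l. 0 < l}"
  by (simp add: cubes_def cube_def)

lemma mem_cube: "x \<in> cube a l \<longleftrightarrow> (\<forall>i. a $ i \<le> x $ i \<and> x $ i \<le> a $ i + l)"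
  by (simp add: cube_def mem_box_cart)

lemma cube_subsetD:
  assumes "cube a l \<subseteq> cube b L" "0 \<le> l"
  shows "b $ i \<le> a $ i" "a $ i + l \<le> b $ i + L"
proof -
  have "a \<in> cube a l" "a + (\<chi> i. l) \<in> cube a l"
    using assms by (auto simp: mem_cube)
  then have "a \<in> cube b L" "a + (\<chi> i. l) \<in> cube b L"
    using assms by auto
  then show "b $ i \<le> a $ i" "a $ i + l \<le> b $ i + L"
    by (simp_all add: mem_cube)
qed

lemma cube_subset_side_le:
  assumes "cube a l \<subseteq> cube b L" "0 \<le> l"
  shows "l \<le> L"
  using cube_subsetD[OF assms, of undefined] by linarith

lemma cube_sets [measurable]: "cube a l \<in> sets lebesgue"
  by (simp add: cube_def)

lemma vec_const_eq_scaleR_One: "(\<chi> i. l) = l *\<^sub>R (One :: real ^ 'n)"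
proof -
  have "One \<bullet> axis i (1::real) = 1" for i :: 'n
    by (simp add: axis_in_Basis_iff)
  then show ?thesis
    by (simp add: vec_eq_iff inner_axis)
qed

lemma cube_eq_cbox_One: "cube a l = cbox a (a + l *\<^sub>R One)"
  by (simp add: cube_def vec_const_eq_scaleR_One)

lemma emeasure_cube:
  fixes a :: "real ^ 'n"
  assumes "0 \<le> l"
  shows "emeasure lebesgue (cube a l) = ennreal (l ^ CARD('n))"
proof -
  have "measure lebesgue (cube a l) = l ^ CARD('n)"
    using assms by (simp add: cube_eq_cbox_One content_cbox inner_simps DIM_cart)
  moreover have "emeasure lebesgue (cube a l) = ennreal (measure lebesgue (cube a l))"
    unfolding cube_def by (intro emeasure_eq_ennreal_measure) (simp add: emeasure_completion emeasure_lborel_cbox_eq)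
  ultimately show ?thesis
    by simp
qed

lemma cube_emeasure_props:
  assumes "Q \<in> cubes"
  shows "Q \<in> sets lebesgue" "0 < emeasure lebesgue Q" "emeasure lebesgue Q < \<infinity>"
    "0 < measure lebesgue Q" "emeasure lebesgue Q = ennreal (measure lebesgue Q)"
proof -
  obtain a :: "real ^ 'a" and l where Q: "Q = cube a l" "0 < l"
    using assms by (auto simp: cubes_eq)
  have e: "emeasure lebesgue Q = ennreal (l ^ CARD('a))"
    unfolding Q(1) by (rule emeasure_cube) (use Q in simp)
  then have m: "measure lebesgue Q = l ^ CARD('a)"
    using Q by (simp add: measure_def)
  show "Q \<in> sets lebesgue" "0 < emeasure lebesgue Q" "emeasure lebesgue Q < \<infinity>"
    "0 < measure lebesgue Q" "emeasure lebesgue Q = ennreal (measure lebesgue Q)"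
    using Q e m by auto
qed

text \<open>The Vitali covering lemma is about balls, so every cube is enclosed in a ball around its
  centre. The radius is the crude one given by the l1 norm; it determines
  \<open>dil_const\<close>.\<close>

lemma cube_subset_cball:
  fixes a :: "real ^ 'n"
  assumes "0 \<le> l"
  shows "cube a l \<subseteq> cball (a + (\<chi> i. l / 2)) (real CARD('n) * l)"
proof
  fix x assume x: "x \<in> cube a l"
  have "norm (x - (a + (\<chi> i. l / 2))) \<le> (\<Sum>i\<in>UNIV. \<bar>(x - (a + (\<chi> i. l / 2))) $ i\<bar>)"
    by (rule norm_le_l1_cart)
  also have "\<dots> \<le> (\<Sum>i\<in>(UNIV :: 'n set). l)"
  proof (rule sum_mono)
    fix i
    have "a $ i \<le> x $ i \<and> x $ i \<le> a $ i + l"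
      using x by (simp add: mem_cube)
    then show "\<bar>(x - (a + (\<chi> i. l / 2))) $ i\<bar> \<le> l"
      using assms by (simp add: abs_le_iff)
  qed
  finally show "x \<in> cball (a + (\<chi> i. l / 2)) (real CARD('n) * l)"
    by (simp add: dist_norm norm_minus_commute)
qed

text \<open>Written as an integral over \<open>count_space\<close>, so that in
  \<open>good_lambda\<close> it can be compared with additivity over a disjoint family on the same
  countable index set.\<close>

lemma emeasure_UN_countable_le:
  assumes "countable I" and meas: "\<And>i. i \<in> I \<Longrightarrow> A i \<in> sets M"
  shows "emeasure M (\<Union>i\<in>I. A i) \<le> (\<integral>\<^sup>+i. emeasure M (A i) \<partial>count_space I)"
proof -
  have "emeasure M (\<Union>i\<in>I. A i) = (\<integral>\<^sup>+x. indicator (\<Union>i\<in>I. A i) x \<partial>M)"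
    using assms by (intro nn_integral_indicator[symmetric] sets.countable_UN') auto
  also have "\<dots> \<le> (\<integral>\<^sup>+x. \<integral>\<^sup>+i. indicator (A i) x \<partial>count_space I \<partial>M)"
  proof (rule nn_integral_mono)
    fix x
    show "indicator (\<Union>i\<in>I. A i) x \<le> (\<integral>\<^sup>+i. (indicator (A i) x :: ennreal) \<partial>count_space I)"
    proof (cases "x \<in> (\<Union>i\<in>I. A i)")
      case True
      then obtain i where "i \<in> I" "x \<in> A i" by auto
      then show ?thesis
        using nn_integral_ge_point[of i I "\<lambda>i. indicator (A i) x"] True by (auto simp: indicator_def)
    qed auto
  qed
  also have "\<dots> = (\<integral>\<^sup>+i. \<integral>\<^sup>+x. indicator (A i) x \<partial>M \<partial>count_space I)"
    using assms by (intro nn_integral_count_space_nn_integral) auto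
  also have "\<dots> = (\<integral>\<^sup>+i. emeasure M (A i) \<partial>count_space I)"
    using meas by (intro nn_integral_cong) auto
  finally show ?thesis .
qed

text \<open>A cube of side l, enlarged on both sides by 5 times the radius n l of its ball, has side
  (1 + 10 n) l; the 5 is Vitali's factor.\<close>

definition dil_const :: "'n itself \<Rightarrow> real" where
  "dil_const _ = 1 + 10 * real CARD('n)"

text \<open>The dilate of a subcube of \<open>cube a0 L\<close>, shifted and clipped so that it stays in \<open>cube a0 L\<close>.\<close>

lemma clipped_dilate:
  fixes a a0 :: "real ^ 'n"
  assumes sub: "cube a l \<subseteq> cube a0 L" and l: "0 < l"
  obtains a' where
    "cube a' (min (dil_const TYPE('n) * l) L) \<subseteq> cube a0 L"
    "cube a0 L \<inter> cball (a + (\<chi> i. l / 2)) (5 * (real CARD('n) * l))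
       \<subseteq> cube a' (min (dil_const TYPE('n) * l) L)"
proof -
  define s where "s = 5 * (real CARD('n) * l)"
  define l' where "l' = min (dil_const TYPE('n) * l) L"
  have dil: "dil_const TYPE('n) * l = l + 2 * s"
    by (simp add: dil_const_def s_def algebra_simps)
  have "0 \<le> s"
    using l by (simp add: s_def)
  have aa: "a0 $ i \<le> a $ i" "a $ i + l \<le> a0 $ i + L" for i
    using cube_subsetD[OF sub] l by auto
  define a' where "a' = (\<chi> i. max (a0 $ i) (min (a $ i - s) (a0 $ i + L - l')))"
  have l'L: "l' \<le> L" "l' \<le> l + 2 * s"
    by (simp_all add: l'_def dil)
  show thesis
  proof
    show "cube a' (min (dil_const TYPE('n) * l) L) \<subseteq> cube a0 L"
      unfolding l'_def[symmetric]
    proof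
      fix x assume x: "x \<in> cube a' l'"
      show "x \<in> cube a0 L"
        unfolding mem_cube
      proof
        fix i
        have "a' $ i \<le> x $ i \<and> x $ i \<le> a' $ i + l'"
          using x by (simp add: mem_cube)
        then show "a0 $ i \<le> x $ i \<and> x $ i \<le> a0 $ i + L"
          using l'L by (auto simp: a'_def)
      qed
    qed
    show "cube a0 L \<inter> cball (a + (\<chi> i. l / 2)) (5 * (real CARD('n) * l))
       \<subseteq> cube a' (min (dil_const TYPE('n) * l) L)"
      unfolding l'_def[symmetric] s_def[symmetric]
    proof
      fix x assume x: "x \<in> cube a0 L \<inter> cball (a + (\<chi> i. l / 2)) s"
      show "x \<in> cube a' l'"
        unfolding mem_cube
      proof
        fix i
        have 1: "a0 $ i \<le> x $ i \<and> x $ i \<le> a0 $ i + L"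
          using x by (simp add: mem_cube)
        have "\<bar>(x - (a + (\<chi> i. l / 2))) $ i\<bar> \<le> norm (x - (a + (\<chi> i. l / 2)))"
          by (rule component_le_norm_cart)
        also have "\<dots> \<le> s"
          using x by (simp add: dist_norm norm_minus_commute)
        finally have 2: "\<bar>x $ i - a $ i - l / 2\<bar> \<le> s"
          by (simp add: diff_diff_eq)
        show "a' $ i \<le> x $ i \<and> x $ i \<le> a' $ i + l'"
          using 1 2 aa[of i] l \<open>0 \<le> s\<close> unfolding a'_def l'_def dil
          by (auto simp: min_def max_def abs_if split: if_splits)
      qed
    qed
  qed
qed

section \<open>Selection of cubes of large average\<close>

text \<open>Lebesgue differentiation along cubes with lower corner x: the averages of v restricted
  to Q tend to \<open>v x > t\<close>. Frontier points of Q form a null set and are discarded, so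
  that small cubes at x stay inside Q.\<close>

lemma AE_small_cube_avg_gt:
  fixes v :: "real ^ 'n \<Rightarrow> real"
  assumes Q: "Q = cube a0 L" and v: "v \<in> borel_measurable lebesgue" "\<And>x. 0 \<le> v x"
    and fin: "(\<integral>\<^sup>+x\<in>Q. ennreal (v x) \<partial>lebesgue) < \<infinity>" and "0 < t"
  shows "AE x in lebesgue. x \<in> Q \<longrightarrow> t < v x \<longrightarrow>
    (\<exists>h>0. cube x h \<subseteq> Q \<and> ennreal t * emeasure lebesgue (cube x h) < (\<integral>\<^sup>+y\<in>cube x h. ennreal (v y) \<partial>lebesgue))"
proof -
  have Qs: "Q \<in> sets lebesgue"
    by (simp add: Q)
  define f where "f x = v x * indicator Q x" for x
  have f0: "0 \<le> f x" for x
    using v by (simp add: f_def)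
  have fm: "f \<in> borel_measurable lebesgue"
    unfolding f_def using v Qs by measurable
  have fe: "ennreal (f x) = ennreal (v x) * indicator Q x" for x
    by (simp add: f_def indicator_def)
  have int: "integrable lebesgue f"
    using fm fin f0 by (intro integrableI_bounded) (auto simp: fe)
  then have "f integrable_on cbox a b" for a b
    by (meson integrable_on_lebesgue integrable_on_subcbox subset_UNIV)
  then obtain N where N: "negligible N" and
    d: "\<And>x e. \<lbrakk>x \<notin> N; 0 < e\<rbrakk> \<Longrightarrow> \<exists>d>0. \<forall>h. 0 < h \<and> h < d \<longrightarrow>
          norm (integral (cbox x (x + h *\<^sub>R One)) f /\<^sub>R h ^ DIM(real ^ 'n) - f x) < e"
    using integrable_ccontinuous_explicit by metis
  define Z where "Z = N \<union> frontier Q"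
  have "negligible Z"
    unfolding Z_def Q cube_def using N by (simp add: negligible_convex_frontier)
  then have "AE x in lebesgue. x \<notin> Z"
    by (simp add: AE_not_in negligible_iff_null_sets)
  then show ?thesis
  proof eventually_elim
    case (elim x)
    show ?case
    proof (intro impI)
      assume x: "x \<in> Q" "t < v x"
      have "x \<in> interior Q"
        using x elim closure_subset[of Q] by (auto simp: Z_def frontier_def)
      then obtain r where r: "0 < r" "cball x r \<subseteq> Q"
        by (meson interior_subset mem_interior_cball order_trans)
      have "x \<notin> N"
        using elim by (simp add: Z_def)
      then obtain d where d: "0 < d" "\<And>h. 0 < h \<Longrightarrow> h < d \<Longrightarrow>
          norm (integral (cbox x (x + h *\<^sub>R One)) f /\<^sub>R h ^ DIM(real ^ 'n) - f x) < v x - t"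
        using d[of x "v x - t"] x by auto
      define h where "h = min (d / 2) (r / real CARD('n))"
      have h: "0 < h" "h < d" "real CARD('n) * h \<le> r"
        using d r by (auto simp: h_def min_def field_simps)
      have "cube x h \<subseteq> cball x r"
      proof
        fix y assume y: "y \<in> cube x h"
        have "norm (y - x) \<le> (\<Sum>i\<in>UNIV. \<bar>(y - x) $ i\<bar>)"
          by (rule norm_le_l1_cart)
        also have "\<dots> \<le> (\<Sum>i\<in>(UNIV :: 'n set). h)"
        proof (rule sum_mono)
          fix i
          have "x $ i \<le> y $ i \<and> y $ i \<le> x $ i + h"
            using y by (simp add: mem_cube)
          then show "\<bar>(y - x) $ i\<bar> \<le> h"
            by simp
        qed
        finally show "y \<in> cball x r"
          using h by (simp add: dist_norm norm_minus_commute)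
      qed
      then have sub: "cube x h \<subseteq> Q"
        using r by auto
      have "set_integrable lebesgue (cube x h) f"
        unfolding set_integrable_def using int by (intro integrable_mult_indicator) auto
      then have I: "(LINT y:cube x h|lebesgue. f y) = integral (cube x h) f"
        by (rule set_lebesgue_integral_eq_integral)
      have "integral (cube x h) f / h ^ CARD('n) > t"
        using d(2)[OF h(1,2)] x by (simp add: cube_eq_cbox_One f_def DIM_cart divide_inverse_commute)
      then have "t * h ^ CARD('n) < (LINT y:cube x h|lebesgue. f y)"
        using h unfolding I by (simp add: field_simps)
      then have "ennreal (t * h ^ CARD('n)) < ennreal (LINT y:cube x h|lebesgue. f y)"
        using h \<open>0 < t\<close> by (intro ennreal_lessI) (auto intro: le_less_trans[rotated])
      also have "ennreal (LINT y:cube x h|lebesgue. f y) = (\<integral>\<^sup>+y. ennreal (indicator (cube x h) y * f y) \<partial>lebesgue)"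
        unfolding set_lebesgue_integral_def
        using integrable_mult_indicator[OF cube_sets int, of x h] f0
        by (subst nn_integral_eq_integral) (auto)
      also have "\<dots> = (\<integral>\<^sup>+y\<in>cube x h. ennreal (v y) \<partial>lebesgue)"
        using sub by (intro nn_integral_cong) (auto simp: f_def indicator_def)
      finally show "\<exists>h>0. cube x h \<subseteq> Q \<and> ennreal t * emeasure lebesgue (cube x h) < (\<integral>\<^sup>+y\<in>cube x h. ennreal (v y) \<partial>lebesgue)"
        using h sub \<open>0 < t\<close> by (auto simp: emeasure_cube ennreal_mult intro!: exI[of _ h])
    qed
  qed
qed

text \<open>Among the cubes through x of average above t, one is taken whose side exceeds half the
  supremum of the sides. Its clipped dilate R still contains x. If R has side less than L, this side
  is at least twice the chosen one, hence above the supremum, so R has average at most t. If R has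
  side L, it has the measure of Q and \<open>avg_le\<close> applies.\<close>

lemma density_cubes:
  fixes v :: "real ^ 'n \<Rightarrow> real"
  assumes Q: "Q = cube a0 L" and v: "v \<in> borel_measurable lebesgue" "\<And>x. 0 \<le> v x"
    and fin: "(\<integral>\<^sup>+x\<in>Q. ennreal (v x) \<partial>lebesgue) < \<infinity>" and t: "0 < t" and L: "0 < L"
    and avg_le: "(\<integral>\<^sup>+x\<in>Q. ennreal (v x) \<partial>lebesgue) \<le> ennreal t * emeasure lebesgue Q"
  shows "AE x in lebesgue. x \<in> Q \<longrightarrow> t < v x \<longrightarrow>
    (\<exists>a l R. 0 < l \<and> x \<in> cube a l \<and> cube a l \<subseteq> Q \<and>
       ennreal t * emeasure lebesgue (cube a l) < (\<integral>\<^sup>+y\<in>cube a l. ennreal (v y) \<partial>lebesgue) \<and>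
       R \<in> cubes \<and> R \<subseteq> Q \<and> Q \<inter> cball (a + (\<chi> i. l / 2)) (5 * (real CARD('n) * l)) \<subseteq> R \<and>
       emeasure lebesgue R \<le> ennreal (dil_const TYPE('n) ^ CARD('n)) * emeasure lebesgue (cube a l) \<and>
       (\<integral>\<^sup>+y\<in>R. ennreal (v y) \<partial>lebesgue) \<le> ennreal t * emeasure lebesgue R)"
  using AE_small_cube_avg_gt[OF Q v fin t]
proof eventually_elim
  case (elim x)
  let ?N = "dil_const TYPE('n)"
  let ?V = "\<lambda>S. \<integral>\<^sup>+y\<in>S. ennreal (v y) \<partial>lebesgue"
  show ?case
  proof (intro impI)
    assume x: "x \<in> Q" "t < v x"
    define S where "S = {l. 0 < l \<and> (\<exists>a. x \<in> cube a l \<and> cube a l \<subseteq> Q \<and>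
      ennreal t * emeasure lebesgue (cube a l) < ?V (cube a l))}"
    obtain h where "h \<in> S"
    proof -
      obtain h where "h > 0" "cube x h \<subseteq> Q"
        "ennreal t * emeasure lebesgue (cube x h) < ?V (cube x h)"
        using elim x by blast
      moreover from this have "x \<in> cube x h"
        by (simp add: mem_cube)
      ultimately show ?thesis
        using that unfolding S_def by blast
    qed
    have N2: "2 \<le> ?N"
    proof -
      have "1 \<le> real CARD('n)"
        by (metis One_nat_def Suc_leI of_nat_1 of_nat_mono zero_less_card_finite)
      then show ?thesis
        unfolding dil_const_def by linarith
    qed
    have S_L: "l \<le> L" if l: "l \<in> S" for l
    proof -
      obtain a where "0 < l" "cube a l \<subseteq> cube a0 L"
        using l unfolding S_def Q by blast
      then show ?thesis
        using cube_subset_side_le[of a l a0 L] by simp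
    qed
    then have bdd: "bdd_above S"
      by (auto simp: bdd_above_def)
    have "0 < Sup S"
      using \<open>h \<in> S\<close> bdd by (auto simp: S_def intro: less_le_trans cSup_upper)
    then obtain l where l: "l \<in> S" "Sup S / 2 < l"
      using less_cSupE[of "Sup S / 2" S] \<open>h \<in> S\<close> by auto
    then obtain a where a: "0 < l" "x \<in> cube a l" "cube a l \<subseteq> Q"
      "ennreal t * emeasure lebesgue (cube a l) < ?V (cube a l)"
      by (auto simp: S_def)
    define l' where "l' = min (?N * l) L"
    obtain a' where a': "cube a' l' \<subseteq> Q"
      "Q \<inter> cball (a + (\<chi> i. l / 2)) (5 * (real CARD('n) * l)) \<subseteq> cube a' l'"
      using clipped_dilate[of a l a0 L] a unfolding Q l'_def by blast
    have l': "0 < l'" "l' \<le> ?N * l" "l' \<le> L"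
      using N2 a(1) L by (auto simp: l'_def)
    have "cube a l \<subseteq> cball (a + (\<chi> i. l / 2)) (5 * (real CARD('n) * l))"
    proof -
      have "real CARD('n) * l \<le> 5 * (real CARD('n) * l)"
        using a(1) by simp
      then show ?thesis
        using cube_subset_cball[of l a] a(1) subset_cball by (meson less_imp_le order_trans)
    qed
    then have "x \<in> cube a' l'"
      using a a' x by auto
    have "?V (cube a' l') \<le> ennreal t * emeasure lebesgue (cube a' l')"
    proof (cases "l' = L")
      case True
      have "?V (cube a' l') \<le> ?V Q"
        using a'(1) by (intro nn_integral_mono) (auto simp: indicator_def)
      also have "\<dots> \<le> ennreal t * emeasure lebesgue Q"
        by fact
      also have "emeasure lebesgue Q = emeasure lebesgue (cube a' l')"
        using L by (simp add: Q True emeasure_cube)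
      finally show ?thesis .
    next
      case False
      then have "l' = ?N * l"
        by (auto simp: l'_def)
      moreover have "2 * l \<le> ?N * l"
        using N2 a(1) by simp
      ultimately have "Sup S < l'"
        using l by linarith
      then have "l' \<notin> S"
        using cSup_upper[OF _ bdd, of l'] by linarith
      then show ?thesis
        using l' a' \<open>x \<in> cube a' l'\<close> by (auto simp: S_def not_less)
    qed
    moreover have "emeasure lebesgue (cube a' l') \<le> ennreal (?N ^ CARD('n)) * emeasure lebesgue (cube a l)"
    proof -
      have "l' ^ CARD('n) \<le> (?N * l) ^ CARD('n)"
        using l' by (intro power_mono) auto
      then show ?thesis
        using l' a N2 by (simp add: emeasure_cube power_mult_distrib flip: ennreal_mult)
    qed
    moreover have "cube a' l' \<in> cubes"
      using l' by (auto simp: cubes_eq)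
    ultimately show "\<exists>a l R. 0 < l \<and> x \<in> cube a l \<and> cube a l \<subseteq> Q \<and>
       ennreal t * emeasure lebesgue (cube a l) < ?V (cube a l) \<and>
       R \<in> cubes \<and> R \<subseteq> Q \<and> Q \<inter> cball (a + (\<chi> i. l / 2)) (5 * (real CARD('n) * l)) \<subseteq> R \<and>
       emeasure lebesgue R \<le> ennreal (?N ^ CARD('n)) * emeasure lebesgue (cube a l) \<and>
       ?V R \<le> ennreal t * emeasure lebesgue R"
      using a a' by blast
  qed
qed

text \<open>
  The Calderon--Zygmund estimate behind the reverse Hoelder inequality. Instead of a dyadic
  stopping time, almost maximal cubes of large average are selected with the Vitali covering lemma.
\<close>

lemma good_lambda:
  fixes v :: "real ^ 'n \<Rightarrow> real"
  assumes Q: "Q \<in> cubes" and v: "v \<in> borel_measurable lebesgue" "\<And>x. 0 \<le> v x"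
    and fin: "(\<integral>\<^sup>+x\<in>Q. ennreal (v x) \<partial>lebesgue) < \<infinity>" and t: "0 < t"
    and avg_le: "(\<integral>\<^sup>+x\<in>Q. ennreal (v x) \<partial>lebesgue) \<le> ennreal t * emeasure lebesgue Q"
    and half: "\<And>R. R \<in> cubes \<Longrightarrow>
      ennreal t * emeasure lebesgue R \<le> (\<integral>\<^sup>+x\<in>R. ennreal (v x) \<partial>lebesgue) \<Longrightarrow>
      emeasure lebesgue R \<le> 2 * emeasure lebesgue {x \<in> R. \<beta> * t < v x}"
  shows "(\<integral>\<^sup>+x\<in>{x \<in> Q. t < v x}. ennreal (v x) \<partial>lebesgue)
    \<le> ennreal (2 * dil_const TYPE('n) ^ CARD('n) * t) * emeasure lebesgue {x \<in> Q. \<beta> * t < v x}"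
proof -
  obtain a0 L where QL: "Q = cube a0 L" "0 < L"
    using Q by (auto simp: cubes_eq)
  let ?V = "\<lambda>S. \<integral>\<^sup>+y\<in>S. ennreal (v y) \<partial>lebesgue"
  let ?c = "\<lambda>(a, l). a + (\<chi> i. l / 2) :: real ^ 'n"
  let ?r = "\<lambda>(a :: real ^ 'n, l). real CARD('n) * l"
  let ?N = "dil_const TYPE('n) ^ CARD('n)"
  define V where "V = density lebesgue (\<lambda>x. ennreal (v x))"
  have V: "emeasure V S = ?V S" if "S \<in> sets lebesgue" for S
    unfolding V_def using v that by (subst emeasure_density) auto
  have N0: "0 \<le> ?N"
    by (simp add: dil_const_def)
  define good where "good = (\<lambda>(a, l) R. 0 < l \<and> cube a l \<subseteq> Q \<and>
       ennreal t * emeasure lebesgue (cube a l) < ?V (cube a l) \<and>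
       R \<in> cubes \<and> R \<subseteq> Q \<and> Q \<inter> cball (?c (a, l)) (5 * ?r (a, l)) \<subseteq> R \<and>
       emeasure lebesgue R \<le> ennreal ?N * emeasure lebesgue (cube a l) \<and>
       ?V R \<le> ennreal t * emeasure lebesgue R)"
  define K where "K = {k. \<exists>R. good k R}"
  then have "\<forall>k\<in>K. \<exists>R. good k R"
    by blast
  then obtain star where star: "good k (star k)" if "k \<in> K" for k
    using bchoice by metis
  have AE: "AE x in lebesgue. x \<in> Q \<longrightarrow> t < v x \<longrightarrow> (\<exists>(a, l)\<in>K. x \<in> cube a l)"
    using density_cubes[OF QL(1) v fin t QL(2) avg_le]
  proof eventually_elim
    case (elim x)
    show ?case
    proof (intro impI)
      assume "x \<in> Q" "t < v x"
      then obtain a l R where "x \<in> cube a l" "good (a, l) R"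
        using elim unfolding good_def prod.case by blast
      then show "\<exists>(a, l)\<in>K. x \<in> cube a l"
        unfolding K_def by blast
    qed
  qed
  have K: "0 < l" "cube a l \<subseteq> Q" if "(a, l) \<in> K" for a l
    using star[OF that] by (simp_all add: good_def)
  have L_bound: "l \<le> L" if "(a, l) \<in> K" for a l
    using cube_subset_side_le[of a l a0 L] K[OF that] QL by simp
  have rad: "0 < ?r k \<and> ?r k \<le> real CARD('n) * L" if "k \<in> K" for k
    using that L_bound K by (cases k) auto
  obtain C where C: "countable C" "C \<subseteq> K"
    and disj: "pairwise (\<lambda>i j. disjnt (cball (?c i) (?r i)) (cball (?c j) (?r j))) C"
    and cov: "(\<Union>k\<in>K. cball (?c k) (?r k)) \<subseteq> (\<Union>k\<in>C. cball (?c k) (5 * ?r k))"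
    by (rule Vitali_covering_lemma_cballs[of "\<Union>k\<in>K. cball (?c k) (?r k)" ?c ?r K, OF order_refl rad])
  \<comment> \<open>\<open>half\<close> puts at least half of each selected cube into
    \<open>E k\<close>. The sets \<open>E k\<close> are disjoint, because the selected balls are,
    and they lie in one superlevel set of height \<beta> t. So that set controls the total measure
    of the dilates \<open>star k\<close>.\<close>
  define E where "E k = {x \<in> case_prod cube k. \<beta> * t < v x}" for k
  have E_sets: "E k \<in> sets lebesgue" for k
    unfolding E_def using v by (cases k) simp
  have star_sets: "star k \<in> sets lebesgue" if "k \<in> C" for k
    using star[of k] that C by (cases k) (auto simp: good_def intro: cube_emeasure_props)
  have "?V {x \<in> Q. t < v x} \<le> ?V (\<Union>k\<in>C. star k)"
  proof (rule nn_integral_mono_AE, use AE in eventually_elim)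
    case (elim x)
    show ?case
    proof (cases "x \<in> Q \<and> t < v x")
      case True
      then obtain a l where k: "(a, l) \<in> K" "x \<in> cube a l"
        using elim by auto
      then have "x \<in> cball (?c (a, l)) (?r (a, l))"
        using cube_subset_cball[of l a] K[OF k(1)] by auto
      then obtain k where "k \<in> C" "x \<in> cball (?c k) (5 * ?r k)"
        using cov k by blast
      moreover have "Q \<inter> cball (?c k) (5 * ?r k) \<subseteq> star k"
        using star[of k] C(2) \<open>k \<in> C\<close> by (cases k) (auto simp: good_def)
      ultimately have "x \<in> star k"
        using True by blast
      then show ?thesis
        using \<open>k \<in> C\<close> by (auto simp: indicator_def)
    qed auto
  qed
  also have "\<dots> = emeasure V (\<Union>k\<in>C. star k)"
    using C star_sets by (intro V[symmetric] sets.countable_UN') auto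
  also have "\<dots> \<le> (\<integral>\<^sup>+k. emeasure V (star k) \<partial>count_space C)"
    using C star_sets by (intro emeasure_UN_countable_le) (auto simp: V_def)
  also have "\<dots> \<le> (\<integral>\<^sup>+k. ennreal (2 * ?N * t) * emeasure lebesgue (E k) \<partial>count_space C)"
  proof (rule nn_integral_mono)
    fix k assume "k \<in> space (count_space C)"
    then have k: "k \<in> C" by simp
    obtain a l where al: "k = (a, l)" by (cases k)
    have g: "good (a, l) (star k)"
      using star[of k] k C al by auto
    have "emeasure V (star k) = ?V (star k)"
      using V star_sets k by auto
    also have "\<dots> \<le> ennreal t * emeasure lebesgue (star k)"
      using g by (simp add: good_def)
    also have "\<dots> \<le> ennreal t * (ennreal ?N * emeasure lebesgue (cube a l))"
      using g by (intro mult_left_mono) (auto simp: good_def)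
    also have "\<dots> \<le> ennreal t * (ennreal ?N * (2 * emeasure lebesgue (E k)))"
      unfolding E_def al prod.case using g
      by (intro mult_left_mono half) (auto simp: good_def cubes_eq)
    also have "\<dots> = ennreal (2 * ?N * t) * emeasure lebesgue (E k)"
      using t N0 by (simp add: ennreal_mult ac_simps)
    finally show "emeasure V (star k) \<le> ennreal (2 * ?N * t) * emeasure lebesgue (E k)" .
  qed
  also have "\<dots> = ennreal (2 * ?N * t) * (\<integral>\<^sup>+k. emeasure lebesgue (E k) \<partial>count_space C)"
    by (rule nn_integral_cmult) simp
  also have "(\<integral>\<^sup>+k. emeasure lebesgue (E k) \<partial>count_space C) = emeasure lebesgue (\<Union>k\<in>C. E k)"
  proof (rule emeasure_UN_countable[symmetric])
    have "E k \<subseteq> cball (?c k) (?r k)" if "k \<in> C" for k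
    proof -
      obtain a l where al: "k = (a, l)" by (cases k)
      have "E k \<subseteq> cube a l"
        by (auto simp: E_def al)
      also have "\<dots> \<subseteq> cball (?c k) (?r k)"
        using cube_subset_cball[of l a] K(1)[of a l] that C(2) unfolding al prod.case
        by (meson less_imp_le subsetD)
      finally show ?thesis .
    qed
    then show "disjoint_family_on E C"
      using disj unfolding disjoint_family_on_def pairwise_def disjnt_def by blast
  qed (use C E_sets in auto)
  also have "\<dots> \<le> emeasure lebesgue {x \<in> Q. \<beta> * t < v x}"
  proof (rule emeasure_mono)
    have "case_prod cube k \<subseteq> Q" if "k \<in> C" for k
      using star[of k] that C(2) by (cases k) (auto simp: good_def)
    then show "(\<Union>k\<in>C. E k) \<subseteq> {x \<in> Q. \<beta> * t < v x}"
      unfolding E_def by blast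
    show "{x \<in> Q. \<beta> * t < v x} \<in> sets lebesgue"
      unfolding QL using v by simp
  qed
  finally show ?thesis
    by (simp add: mult_left_mono)
qed

section \<open>Dyadic layers and higher integrability\<close>

lemma nn_integral_le_of_tendsto:
  fixes f :: "nat \<Rightarrow> 'a \<Rightarrow> ennreal"
  assumes "\<And>n. f n \<in> borel_measurable M" and "AE x in M. (\<lambda>n. f n x) \<longlonglongrightarrow> g x"
    and le: "\<And>n. (\<integral>\<^sup>+x. f n x \<partial>M) \<le> C"
  shows "(\<integral>\<^sup>+x. g x \<partial>M) \<le> C"
proof -
  have "(\<integral>\<^sup>+x. g x \<partial>M) = (\<integral>\<^sup>+x. liminf (\<lambda>n. f n x) \<partial>M)"
    using assms(2) by (intro nn_integral_cong_AE) (auto elim!: eventually_mono simp: lim_imp_Liminf)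
  also have "\<dots> \<le> liminf (\<lambda>n. \<integral>\<^sup>+x. f n x \<partial>M)"
    using assms(1) by (rule nn_integral_liminf)
  also have "\<dots> \<le> C"
    using le by (intro Liminf_le) auto
  finally show ?thesis .
qed

text \<open>A doubling sequence is dominated by its last term: the multiples below y add up to at
  most twice the largest of them.\<close>

lemma sum_dyadic_below_le:
  fixes y a :: real
  assumes "0 \<le> a" "0 \<le> y"
  shows "(\<Sum>i<n. 2 ^ i * a * indicat_real {..<y} (2 ^ i * a)) \<le> 2 * y"
proof (induction n)
  case (Suc n)
  show ?case
  proof (cases "2 ^ n * a < y")
    case True
    have "(\<Sum>i<Suc n. 2 ^ i * a * indicat_real {..<y} (2 ^ i * a)) \<le> (\<Sum>i<Suc n. 2 ^ i * a)"
      using assms by (intro sum_mono) (auto simp: indicator_def)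
    also have "\<dots> = (2 ^ Suc n - 1) * a"
    proof -
      have "(\<Sum>i<m. (2 :: real) ^ i) = 2 ^ m - 1" for m
        by (induction m) auto
      then show ?thesis
        by (simp only: sum_distrib_right[symmetric])
    qed
    also have "\<dots> \<le> 2 * y"
      using True assms by (simp add: algebra_simps)
    finally show ?thesis .
  qed (use Suc in simp)
qed (use assms in simp)

text \<open>A discrete layer-cake formula: each doubling of the truncation level that v still
  exceeds multiplies the power by at most 2^\<epsilon> \<le> 1 + \<epsilon>. The factor \<epsilon>
  in front of each layer is what later makes the layers small enough to absorb.\<close>

lemma powr_min_layer:
  fixes v a \<epsilon> :: real
  assumes "0 \<le> v" "0 < a" "0 < \<epsilon>" "\<epsilon> \<le> 1"
  shows "min v (2 ^ n * a) powr \<epsilon>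
    \<le> a powr \<epsilon> + (\<Sum>i<n. \<epsilon> * (2 ^ i * a) powr \<epsilon> * indicat_real {2 ^ i * a<..} v)"
proof (induction n)
  case 0
  show ?case
    using assms by (auto intro!: powr_mono2)
next
  case (Suc n)
  show ?case
  proof (cases "2 ^ n * a < v")
    case True
    \<comment> \<open>AM-GM for the numbers 2 and 1 with weights \<epsilon> and 1 -
      \<epsilon>.\<close>
    have "2 powr \<epsilon> \<le> 1 + \<epsilon>"
    proof -
      have "(\<Prod>b\<in>{True, False}. (if b then 2 else 1) powr (if b then \<epsilon> else 1 - \<epsilon>))
        \<le> (\<Sum>b\<in>{True, False}. (if b then \<epsilon> else 1 - \<epsilon>) * (if b then 2 else 1))"
        using assms by (intro weighted_am_gm) auto
      then show ?thesis
        by simp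
    qed
    have "min v (2 ^ Suc n * a) powr \<epsilon> \<le> (2 * (2 ^ n * a)) powr \<epsilon>"
      using assms by (intro powr_mono2) auto
    also have "\<dots> = 2 powr \<epsilon> * (2 ^ n * a) powr \<epsilon>"
      using assms by (simp add: powr_mult)
    also have "\<dots> \<le> (1 + \<epsilon>) * (2 ^ n * a) powr \<epsilon>"
      using \<open>2 powr \<epsilon> \<le> 1 + \<epsilon>\<close> by (intro mult_right_mono) auto
    also have "\<dots> = min v (2 ^ n * a) powr \<epsilon> + \<epsilon> * (2 ^ n * a) powr \<epsilon>"
      using True by (simp add: min_def algebra_simps)
    finally show ?thesis
      using Suc.IH True by simp
  next
    case False
    then have "v \<le> 2 ^ Suc n * a"
      using assms by auto
    then show ?thesis
      using Suc.IH False by (simp add: min_def)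
  qed
qed

text \<open>The price of comparing a level t with \<beta> t in the power \<epsilon>. As \<epsilon>
  ln (1/\<beta>) \<le> \<epsilon>/\<beta> \<le> 1, it is at most e.\<close>

lemma powr_neg_small_le:
  fixes \<beta> \<epsilon> :: real
  assumes "0 < \<beta>" "\<beta> \<le> 1" "0 \<le> \<epsilon>" "\<epsilon> \<le> \<beta>"
  shows "(1 / \<beta>) powr \<epsilon> \<le> 3"
proof -
  have "ln (1 / \<beta>) \<le> 1 / \<beta>"
    using assms ln_le_minus_one[of "1 / \<beta>"] by simp
  then have "\<epsilon> * ln (1 / \<beta>) \<le> \<epsilon> * (1 / \<beta>)"
    using assms by (intro mult_left_mono)
  also have "\<dots> \<le> 1"
    using assms by simp
  finally have "exp (\<epsilon> * ln (1 / \<beta>)) \<le> exp 1"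
    by simp
  also have "\<dots> \<le> (3 :: real)"
    by (rule exp_le)
  finally show ?thesis
    using assms by (simp add: powr_def)
qed

text \<open>With D = 2 \<open>dil_const\<close>^n from \<open>good_lambda\<close>, the term to be
  absorbed carries \<epsilon> D / \<beta>, a 3 from \<open>powr_neg_small_le\<close> and a 2 from
  \<open>sum_dyadic_below_le\<close>. The 24 makes the total at most 1/2.\<close>

definition rh_const :: "'n::finite itself \<Rightarrow> real" where
  "rh_const _ = 1 / (24 * dil_const TYPE('n) ^ CARD('n))"

text \<open>
  The exponent gain is linear in \<open>\<beta>\<close>; this linearity is what produces the power of the
  characteristic in the main theorem. The truncation \<open>min (v x) (2 ^ n * a)\<close> makes the absorbed
  term finite.
\<close>

lemma reverse_hoelder:
  fixes v :: "real ^ 'n \<Rightarrow> real"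
  assumes Q: "Q \<in> cubes" and v: "v \<in> borel_measurable lebesgue" "\<And>x. 0 \<le> v x"
    and a: "0 < a" "(\<integral>\<^sup>+x\<in>Q. ennreal (v x) \<partial>lebesgue) = ennreal a * emeasure lebesgue Q"
    and \<beta>: "0 < \<beta>" "\<beta> \<le> 1" and \<epsilon>: "0 < \<epsilon>" "\<epsilon> \<le> rh_const TYPE('n) * \<beta>"
    and half: "\<And>R t. R \<in> cubes \<Longrightarrow> 0 < t \<Longrightarrow>
      ennreal t * emeasure lebesgue R \<le> (\<integral>\<^sup>+x\<in>R. ennreal (v x) \<partial>lebesgue) \<Longrightarrow>
      emeasure lebesgue R \<le> 2 * emeasure lebesgue {x \<in> R. \<beta> * t < v x}"
  shows "(\<integral>\<^sup>+x\<in>Q. ennreal (v x powr (1 + \<epsilon>)) \<partial>lebesgue)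
    \<le> ennreal (2 * a powr (1 + \<epsilon>)) * emeasure lebesgue Q"
proof -
  note Qp = cube_emeasure_props[OF Q]
  note [measurable] = v(1) Qp(1)
  define D where "D = 2 * dil_const TYPE('n) ^ CARD('n)"
  have D: "2 \<le> D"
    by (simp add: D_def dil_const_def one_le_power)
  have \<epsilon>D: "\<epsilon> * (12 * D) \<le> \<beta>"
    using \<epsilon> D by (simp add: rh_const_def D_def field_simps)
  have \<epsilon>\<beta>: "\<epsilon> \<le> \<beta>"
  proof -
    have "\<epsilon> * 1 \<le> \<epsilon> * (12 * D)"
      using D \<epsilon>(1) by (intro mult_left_mono) auto
    then show ?thesis
      using \<epsilon>D by simp
  qed
  define M where "M n x = min (v x) (2 ^ n * a)" for n x
  have M: "0 \<le> M n x" "M n \<in> borel_measurable lebesgue" for n x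
    using v a unfolding M_def by (auto)
  note [measurable] = M(2)
  have VQ: "(\<integral>\<^sup>+x\<in>Q. ennreal (v x) \<partial>lebesgue) < \<infinity>"
    using a Qp by (simp add: ennreal_mult_less_top)
  have bound: "(\<integral>\<^sup>+x\<in>Q. ennreal (v x * M n x powr \<epsilon>) \<partial>lebesgue)
      \<le> ennreal (2 * a powr (1 + \<epsilon>)) * emeasure lebesgue Q" for n
  proof -
    define X where "X = (\<integral>\<^sup>+x\<in>Q. ennreal (v x * M n x powr \<epsilon>) \<partial>lebesgue)"
    define V where "V t = (\<integral>\<^sup>+x\<in>{x \<in> Q. t < v x}. ennreal (v x) \<partial>lebesgue)" for t
    define Y where "Y = ennreal (a powr (1 + \<epsilon>)) * emeasure lebesgue Q"
    have sets: "{x \<in> Q. t < v x} \<in> sets lebesgue" for t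
    proof -
      have "{x \<in> space lebesgue. x \<in> Q \<and> t < v x} \<in> sets lebesgue"
        using Qp(1) v by measurable
      then show ?thesis
        by simp
    qed
    have t: "0 < 2 ^ i * a" for i
      using a by simp
    have "X \<le> (\<integral>\<^sup>+x. ennreal ((2 ^ n * a) powr \<epsilon>) * (ennreal (v x) * indicator Q x) \<partial>lebesgue)"
      unfolding X_def
    proof (rule nn_integral_mono)
      fix x
      have "v x * M n x powr \<epsilon> \<le> (2 ^ n * a) powr \<epsilon> * v x"
        using v(2)[of x] M(1)[of n x] \<epsilon> by (subst mult.commute, intro mult_right_mono powr_mono2) (auto simp: M_def)
      then show "ennreal (v x * M n x powr \<epsilon>) * indicator Q x
          \<le> ennreal ((2 ^ n * a) powr \<epsilon>) * (ennreal (v x) * indicator Q x)"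
        using v(2)[of x] by (auto simp: indicator_def ennreal_mult[symmetric] intro: ennreal_leI)
    qed
    also have "\<dots> = ennreal ((2 ^ n * a) powr \<epsilon>) * (\<integral>\<^sup>+x\<in>Q. ennreal (v x) \<partial>lebesgue)"
      using v Qp by (intro nn_integral_cmult) measurable
    also have "\<dots> < \<infinity>"
      using VQ by (simp add: ennreal_mult_less_top)
    finally have X_fin: "X < \<infinity>" .

    have "X \<le> (\<integral>\<^sup>+x. ennreal (a powr \<epsilon>) * (ennreal (v x) * indicator Q x) +
        (\<Sum>i<n. ennreal (\<epsilon> * (2 ^ i * a) powr \<epsilon>) * (ennreal (v x) * indicator {x \<in> Q. 2 ^ i * a < v x} x)) \<partial>lebesgue)"
      unfolding X_def
    proof (rule nn_integral_mono)
      fix x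
      let ?S = "\<Sum>i<n. \<epsilon> * (2 ^ i * a) powr \<epsilon> * indicat_real {2 ^ i * a<..} (v x)"
      have "v x * M n x powr \<epsilon> \<le> v x * (a powr \<epsilon> + ?S)"
        unfolding M_def using v(2)[of x] a(1) \<epsilon>(1) \<epsilon>\<beta> \<beta> by (intro mult_left_mono powr_min_layer) auto
      also have "\<dots> = a powr \<epsilon> * v x +
          (\<Sum>i<n. \<epsilon> * (2 ^ i * a) powr \<epsilon> * (v x * indicat_real {2 ^ i * a<..} (v x)))"
        by (simp add: algebra_simps sum_distrib_left)
      finally have "ennreal (v x * M n x powr \<epsilon>) \<le> ennreal (a powr \<epsilon> * v x +
          (\<Sum>i<n. \<epsilon> * (2 ^ i * a) powr \<epsilon> * (v x * indicat_real {2 ^ i * a<..} (v x))))"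
        by (rule ennreal_leI)
      also have "\<dots> = ennreal (a powr \<epsilon>) * ennreal (v x) +
          (\<Sum>i<n. ennreal (\<epsilon> * (2 ^ i * a) powr \<epsilon>) * ennreal (v x * indicat_real {2 ^ i * a<..} (v x)))"
      proof -
        have nn: "0 \<le> \<epsilon> * (2 ^ i * a) powr \<epsilon> * (v x * indicat_real {2 ^ i * a<..} (v x))" for i
          using v(2)[of x] \<epsilon>(1) by simp
        have "ennreal (\<Sum>i<n. \<epsilon> * (2 ^ i * a) powr \<epsilon> * (v x * indicat_real {2 ^ i * a<..} (v x)))
          = (\<Sum>i<n. ennreal (\<epsilon> * (2 ^ i * a) powr \<epsilon> * (v x * indicat_real {2 ^ i * a<..} (v x))))"
          using nn by (intro sum_ennreal[symmetric]) auto
        also have "\<dots> = (\<Sum>i<n. ennreal (\<epsilon> * (2 ^ i * a) powr \<epsilon>) * ennreal (v x * indicat_real {2 ^ i * a<..} (v x)))"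
          using v(2)[of x] \<epsilon>(1) by (intro sum.cong refl ennreal_mult) auto
        finally show ?thesis
          using v(2)[of x] nn by (subst ennreal_plus) (auto intro!: sum_nonneg simp: ennreal_mult)
      qed
      finally show "ennreal (v x * M n x powr \<epsilon>) * indicator Q x
        \<le> ennreal (a powr \<epsilon>) * (ennreal (v x) * indicator Q x) +
        (\<Sum>i<n. ennreal (\<epsilon> * (2 ^ i * a) powr \<epsilon>) * (ennreal (v x) * indicator {x \<in> Q. 2 ^ i * a < v x} x))"
        by (cases "x \<in> Q") (auto simp: indicator_def of_bool_def if_distrib[of ennreal]
            if_distrib[of "\<lambda>z. _ * z"] cong: if_cong)
    qed
    also have "\<dots> = ennreal (a powr \<epsilon>) * (\<integral>\<^sup>+x\<in>Q. ennreal (v x) \<partial>lebesgue) +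
        (\<Sum>i<n. ennreal (\<epsilon> * (2 ^ i * a) powr \<epsilon>) * V (2 ^ i * a))"
      unfolding V_def using v Qp sets
      by (subst nn_integral_add) (auto simp: nn_integral_sum nn_integral_cmult intro!: borel_measurable_sum)
    also have "ennreal (a powr \<epsilon>) * (\<integral>\<^sup>+x\<in>Q. ennreal (v x) \<partial>lebesgue) = Y"
      using a(1) by (simp add: a(2) Y_def powr_add mult.assoc[symmetric] ennreal_mult[symmetric] mult.commute)
    also have "(\<Sum>i<n. ennreal (\<epsilon> * (2 ^ i * a) powr \<epsilon>) * V (2 ^ i * a))
      \<le> (\<Sum>i<n. ennreal (\<epsilon> * (2 ^ i * a) powr \<epsilon>) *
           (ennreal (D * (2 ^ i * a)) * emeasure lebesgue {x \<in> Q. \<beta> * (2 ^ i * a) < v x}))"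
    proof (intro sum_mono mult_left_mono)
      fix i
      have "1 \<le> (2 :: real) ^ i"
        by simp
      then have "a \<le> 2 ^ i * a"
        using a(1) by simp
      then show "V (2 ^ i * a) \<le> ennreal (D * (2 ^ i * a)) * emeasure lebesgue {x \<in> Q. \<beta> * (2 ^ i * a) < v x}"
        unfolding V_def D_def using Q v VQ t half by (intro good_lambda) (auto simp: a(2) intro!: mult_right_mono ennreal_leI)
    qed auto
    also have "\<dots> = (\<integral>\<^sup>+x. (\<Sum>i<n. ennreal (\<epsilon> * (2 ^ i * a) powr \<epsilon> * (D * (2 ^ i * a))) *
           indicator {x \<in> Q. \<beta> * (2 ^ i * a) < v x} x) \<partial>lebesgue)"
    proof -
      have "ennreal (\<epsilon> * (2 ^ i * a) powr \<epsilon> * (D * (2 ^ i * a)))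
          = ennreal (\<epsilon> * (2 ^ i * a) powr \<epsilon>) * ennreal (D * (2 ^ i * a))" for i
        using t[of i] \<epsilon>(1) D by (intro ennreal_mult) auto
      then show ?thesis
        using sets by (subst nn_integral_sum) (auto simp: nn_integral_cmult mult.assoc)
    qed
    also have "\<dots> \<le> (\<integral>\<^sup>+x. ennreal (1 / 2) * (ennreal (v x * M n x powr \<epsilon>) * indicator Q x) \<partial>lebesgue)"
    proof (rule nn_integral_mono)
      fix x
      \<comment> \<open>The order of summation is exchanged: at a fixed x, only levels below
        \<open>v x / \<beta>\<close> count. Such a level with i < n is at most
        \<open>M n x / \<beta>\<close>, so its \<epsilon>-th power is at most
        \<open>3 * M n x powr \<epsilon>\<close>, and the remaining first powers form a geometric
        sum.\<close>
      have term_le: "(2 ^ i * a) powr \<epsilon> * (2 ^ i * a) * indicat_real {..<v x / \<beta>} (2 ^ i * a)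
        \<le> 3 * M n x powr \<epsilon> * ((2 ^ i * a) * indicat_real {..<v x / \<beta>} (2 ^ i * a))" if "i < n" for i
      proof (cases "2 ^ i * a < v x / \<beta>")
        case True
        have "2 ^ i * a \<le> 2 ^ n * a"
          using that a(1) by (intro mult_right_mono power_increasing) auto
        moreover have "2 ^ n * a \<le> 2 ^ n * a / \<beta>"
          using a(1) \<beta> by (simp add: field_simps)
        ultimately have "2 ^ i * a \<le> M n x * (1 / \<beta>)"
          using True by (auto simp: M_def min_def)
        then have "(2 ^ i * a) powr \<epsilon> \<le> (M n x * (1 / \<beta>)) powr \<epsilon>"
          using t[of i] \<epsilon>(1) by (intro powr_mono2) auto
        also have "\<dots> = M n x powr \<epsilon> * (1 / \<beta>) powr \<epsilon>"
          using M(1)[of n x] \<beta> by (subst powr_mult) auto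
        also have "\<dots> \<le> M n x powr \<epsilon> * 3"
          using \<beta> \<epsilon>(1) \<epsilon>\<beta> by (intro mult_left_mono powr_neg_small_le) auto
        finally show ?thesis
          using t[of i] True mult_right_mono[of "(2 ^ i * a) powr \<epsilon>" "M n x powr \<epsilon> * 3" "2 ^ i * a"]
          by (simp add: mult_ac)
      qed simp
      have "(\<Sum>i<n. \<epsilon> * (2 ^ i * a) powr \<epsilon> * (D * (2 ^ i * a)) * indicat_real {..<v x / \<beta>} (2 ^ i * a))
        = (\<epsilon> * D) * (\<Sum>i<n. (2 ^ i * a) powr \<epsilon> * (2 ^ i * a) * indicat_real {..<v x / \<beta>} (2 ^ i * a))"
        by (simp add: sum_distrib_left algebra_simps)
      also have "\<dots> \<le> (\<epsilon> * D) * (\<Sum>i<n. 3 * M n x powr \<epsilon> * ((2 ^ i * a) * indicat_real {..<v x / \<beta>} (2 ^ i * a)))"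
        using \<epsilon>(1) D term_le by (intro mult_left_mono sum_mono) auto
      also have "\<dots> = (\<epsilon> * D) * (3 * M n x powr \<epsilon>) * (\<Sum>i<n. (2 ^ i * a) * indicat_real {..<v x / \<beta>} (2 ^ i * a))"
        by (simp only: sum_distrib_left mult.assoc)
      also have "\<dots> \<le> (\<epsilon> * D) * (3 * M n x powr \<epsilon>) * (2 * (v x / \<beta>))"
        using \<epsilon>(1) D a(1) \<beta> v(2)[of x] by (intro mult_left_mono sum_dyadic_below_le) auto
      also have "\<dots> = (\<epsilon> * (12 * D)) * (v x * M n x powr \<epsilon>) / (2 * \<beta>)"
        by simp
      also have "\<dots> \<le> \<beta> * (v x * M n x powr \<epsilon>) / (2 * \<beta>)"
        using \<epsilon>D v(2)[of x] \<beta> by (intro divide_right_mono mult_right_mono) auto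
      also have "\<dots> = 1 / 2 * (v x * M n x powr \<epsilon>)"
        using \<beta> by simp
      finally have le: "(\<Sum>i<n. \<epsilon> * (2 ^ i * a) powr \<epsilon> * (D * (2 ^ i * a)) * indicat_real {..<v x / \<beta>} (2 ^ i * a))
        \<le> 1 / 2 * (v x * M n x powr \<epsilon>)" .
      show "(\<Sum>i<n. ennreal (\<epsilon> * (2 ^ i * a) powr \<epsilon> * (D * (2 ^ i * a))) *
           indicator {x \<in> Q. \<beta> * (2 ^ i * a) < v x} x)
         \<le> ennreal (1 / 2) * (ennreal (v x * M n x powr \<epsilon>) * indicator Q x)"
      proof (cases "x \<in> Q")
        case True
        have "(\<Sum>i<n. ennreal (\<epsilon> * (2 ^ i * a) powr \<epsilon> * (D * (2 ^ i * a))) *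
             indicator {x \<in> Q. \<beta> * (2 ^ i * a) < v x} x)
           = (\<Sum>i<n. ennreal (\<epsilon> * (2 ^ i * a) powr \<epsilon> * (D * (2 ^ i * a)) * indicat_real {..<v x / \<beta>} (2 ^ i * a)))"
          using True \<beta> by (intro sum.cong refl) (auto simp: indicator_def field_simps)
        also have "\<dots> = ennreal (\<Sum>i<n. \<epsilon> * (2 ^ i * a) powr \<epsilon> * (D * (2 ^ i * a)) * indicat_real {..<v x / \<beta>} (2 ^ i * a))"
          using \<epsilon>(1) D a(1) by (intro sum_ennreal) auto
        also have "\<dots> \<le> ennreal (1 / 2 * (v x * M n x powr \<epsilon>))"
          using le by (rule ennreal_leI)
        also have "\<dots> = ennreal (1 / 2) * ennreal (v x * M n x powr \<epsilon>)"
          using v(2)[of x] by (intro ennreal_mult) auto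
        finally show ?thesis
          using True by simp
      qed simp
    qed
    also have "\<dots> = ennreal (1 / 2) * X"
      unfolding X_def using v M Qp by (intro nn_integral_cmult) measurable
    finally have "X \<le> Y + ennreal (1 / 2) * X"
      by (simp add: add_left_mono)
    moreover have "Y = ennreal (a powr (1 + \<epsilon>) * measure lebesgue Q)"
      unfolding Y_def Qp(5)[THEN arg_cong, of "\<lambda>z. _ * z"] by (simp add: ennreal_mult)
    moreover obtain x where x: "0 \<le> x" "X = ennreal x"
      using X_fin by (cases X) auto
    ultimately have "ennreal x \<le> ennreal (a powr (1 + \<epsilon>) * measure lebesgue Q + 1 / 2 * x)"
      by (simp only: ennreal_mult'[symmetric] ennreal_plus[symmetric] zero_le_divide_1_iff zero_le_numeral
        mult_nonneg_nonneg measure_nonneg powr_ge_zero)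
    then have "x \<le> a powr (1 + \<epsilon>) * measure lebesgue Q + 1 / 2 * x"
      using x by (subst (asm) ennreal_le_iff) auto
    then have "x \<le> 2 * a powr (1 + \<epsilon>) * measure lebesgue Q"
      by simp
    then have "X \<le> ennreal (2 * a powr (1 + \<epsilon>) * measure lebesgue Q)"
      using x by (simp add: ennreal_leI)
    also have "\<dots> = ennreal (2 * a powr (1 + \<epsilon>)) * emeasure lebesgue Q"
      unfolding Qp(5)[THEN arg_cong, of "\<lambda>z. _ * z"] by (simp add: ennreal_mult)
    finally show ?thesis
      unfolding X_def .
  qed
  show ?thesis
  proof (rule nn_integral_le_of_tendsto[OF _ _ bound])
    show "(\<lambda>x. ennreal (v x * M n x powr \<epsilon>) * indicator Q x) \<in> borel_measurable lebesgue" for n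
      using v M Qp by measurable
    have "(\<lambda>n. v x * M n x powr \<epsilon>) \<longlonglongrightarrow> v x powr (1 + \<epsilon>)" for x
    proof (rule tendsto_eventually)
      have "filterlim (\<lambda>n. 2 ^ n * a) at_top sequentially"
        using a(1) by (intro filterlim_at_top_mult_tendsto_pos[OF tendsto_const]
            filterlim_at_infinity_imp_filterlim_at_top filterlim_realpow_sequentially_gt1) auto
      then have "eventually (\<lambda>n. v x \<le> 2 ^ n * a) sequentially"
        by (simp add: filterlim_at_top)
      then show "\<forall>\<^sub>F n in sequentially. v x * M n x powr \<epsilon> = v x powr (1 + \<epsilon>)"
        by eventually_elim (use v(2)[of x] in \<open>auto simp: M_def powr_add min_absorb1\<close>)
    qed
    then show "AE x in lebesgue. (\<lambda>n. ennreal (v x * M n x powr \<epsilon>) * indicator Q x)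
        \<longlonglongrightarrow> ennreal (v x powr (1 + \<epsilon>)) * indicator Q x"
      by (intro AE_I2 tendsto_mult_ennreal tendsto_ennrealI tendsto_const) (auto simp: indicator_def)
  qed
qed

section \<open>Perturbation of multilinear weights\<close>

lemma nn_avg_uniform_measure:
  assumes "Q \<in> cubes" "g \<in> borel_measurable lebesgue"
  shows "nn_avg Q g = (\<integral>\<^sup>+x. ennreal (g x) \<partial>uniform_measure lebesgue Q)"
  unfolding nn_avg_def using assms cube_emeasure_props[OF assms(1)]
  by (subst nn_integral_uniform_measure) auto

lemma nn_avg_mono_AE:
  assumes "AE x in lebesgue. x \<in> Q \<longrightarrow> g x \<le> h x"
  shows "nn_avg Q g \<le> nn_avg Q h"
  unfolding nn_avg_def
  by (intro divide_right_mono_ennreal nn_integral_mono_AE, use assms in eventually_elim)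
    (auto simp: indicator_def ennreal_leI)

lemma nn_avg_cmult:
  assumes "Q \<in> cubes" "g \<in> borel_measurable lebesgue" "0 \<le> c"
  shows "nn_avg Q (\<lambda>x. c * g x) = ennreal c * nn_avg Q g"
  using assms by (simp add: nn_avg_uniform_measure ennreal_mult' nn_integral_cmult)

lemma nn_avg_eq_iff:
  assumes "Q \<in> cubes" "0 \<le> c"
  shows "nn_avg Q g = ennreal c \<longleftrightarrow> (\<integral>\<^sup>+x\<in>Q. ennreal (g x) \<partial>lebesgue) = ennreal c * emeasure lebesgue Q"
proof -
  have "X / ennreal q = ennreal c \<longleftrightarrow> X = ennreal c * ennreal q" if "0 < q" for X q
    using that assms(2)
    by (cases X) (auto simp: divide_ennreal ennreal_mult'[symmetric] ennreal_top_divide field_simps)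
  then show ?thesis
    unfolding nn_avg_def cube_emeasure_props(5)[OF assms(1)]
    using cube_emeasure_props(4)[OF assms(1)] by blast
qed

lemma nn_avg_le_iff:
  assumes "Q \<in> cubes" "0 \<le> c"
  shows "nn_avg Q g \<le> ennreal c \<longleftrightarrow> (\<integral>\<^sup>+x\<in>Q. ennreal (g x) \<partial>lebesgue) \<le> ennreal c * emeasure lebesgue Q"
proof -
  have "X / ennreal q \<le> ennreal c \<longleftrightarrow> X \<le> ennreal c * ennreal q" if "0 < q" for X q
    using that assms(2)
    by (cases X) (auto simp: divide_ennreal ennreal_mult'[symmetric] ennreal_top_divide top_unique field_simps)
  then show ?thesis
    unfolding nn_avg_def cube_emeasure_props(5)[OF assms(1)]
    using cube_emeasure_props(4)[OF assms(1)] by blast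
qed

lemma nn_avg_const:
  assumes "Q \<in> cubes"
  shows "nn_avg Q (\<lambda>x. 1) = 1"
  using cube_emeasure_props[OF assms] by (simp add: nn_avg_def)

lemma nn_avg_prod_powr_le:
  assumes Q: "Q \<in> cubes" and "finite S" "\<And>i. i \<in> S \<Longrightarrow> f i \<in> borel_measurable lebesgue"
    "\<And>i x. i \<in> S \<Longrightarrow> 0 \<le> f i x" "\<And>i. i \<in> S \<Longrightarrow> 0 \<le> t i" "(\<Sum>i\<in>S. t i) = 1"
    "\<And>i. i \<in> S \<Longrightarrow> 0 < c i" "\<And>i. i \<in> S \<Longrightarrow> nn_avg Q (f i) \<le> ennreal (c i)"
  shows "nn_avg Q (\<lambda>x. \<Prod>i\<in>S. f i x powr t i) \<le> ennreal (\<Prod>i\<in>S. c i powr t i)"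
proof -
  have "nn_avg Q (\<lambda>x. \<Prod>i\<in>S. f i x powr t i)
    = (\<integral>\<^sup>+x. ennreal (\<Prod>i\<in>S. f i x powr t i) \<partial>uniform_measure lebesgue Q)"
    using assms by (intro nn_avg_uniform_measure) auto
  also have "\<dots> \<le> ennreal (\<Prod>i\<in>S. c i powr t i)"
    using assms by (intro nn_integral_prod_powr_le) (auto simp: nn_avg_uniform_measure[symmetric])
  finally show ?thesis .
qed

lemma rh_const_pos: "0 < rh_const TYPE('n::finite)"
  by (simp add: rh_const_def dil_const_def)

lemma rh_const_le_1: "rh_const TYPE('n::finite) \<le> 1"
proof -
  have "1 \<le> dil_const TYPE('n) ^ CARD('n)"
    by (simp add: dil_const_def one_le_power)
  then show ?thesis
    by (simp add: rh_const_def field_simps)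
qed

text \<open>The strict inequality yields an admissible l \<le> B in the infimum on every cube, so
  its attainment need not be discussed. Hence later estimates carry a number B strictly above the
  norm, which is removed by a limit at the very end.\<close>

lemma BMO_exp_avg_le:
  assumes "BMO_norm b < ennreal B" "Q \<in> cubes" "0 < B"
  shows "nn_avg Q (\<lambda>x. exp (norm (b x - avg Q b) / B)) \<le> 2"
proof -
  have "expL_norm Q (\<lambda>x. b x - avg Q b) \<le> BMO_norm b"
    unfolding BMO_norm_def using assms(2) by (rule SUP_upper)
  then have "expL_norm Q (\<lambda>x. b x - avg Q b) < ennreal B"
    using assms(1) by (rule le_less_trans)
  then obtain l where l: "ennreal l < ennreal B" "0 < l" "nn_avg Q (\<lambda>x. exp (norm (b x - avg Q b) / l)) \<le> 2"
    unfolding expL_norm_def Inf_less_iff by blast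
  then have "l \<le> B"
    by (simp add: ennreal_less_iff)
  then have "nn_avg Q (\<lambda>x. exp (norm (b x - avg Q b) / B)) \<le> nn_avg Q (\<lambda>x. exp (norm (b x - avg Q b) / l))"
    using l assms(3) by (intro nn_avg_mono_AE) (auto intro!: divide_left_mono)
  then show ?thesis
    using l(3) by (rule order_trans)
qed

lemma ennpow_ennreal: "0 \<le> x \<Longrightarrow> ennpow (ennreal x) a = ennreal (x powr a)"
  by (simp add: ennpow_def)

lemma ennpow_mono:
  assumes "x \<le> y" "0 \<le> a"
  shows "ennpow x a \<le> ennpow y a"
proof (cases "y = top")
  case False
  then have "x \<noteq> top"
    using assms by (auto simp: top_unique)
  then show ?thesis
    using False assms by (auto simp: ennpow_def less_top intro!: ennreal_leI powr_mono2 enn2real_mono)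
qed (auto simp: ennpow_def)

text \<open>
  The weights \<open>\<nu>\<close> and \<open>w\<^sub>j\<^bsup>1-p\<^sub>j'\<^esup>\<close>, with exponents \<open>1/p\<close> and \<open>1/p\<^sub>j'\<close>, enter the
  multilinear condition symmetrically; \<open>u\<close> is this family.
\<close>

locale dual_weights =
  fixes u :: "'k::finite \<Rightarrow> real ^ 'n \<Rightarrow> real" and \<theta> :: "'k \<Rightarrow> real" and m A :: real
  assumes \<theta>_pos: "0 < \<theta> k" and \<theta>_less: "\<theta> k < m" and \<theta>_sum: "(\<Sum>k\<in>UNIV. \<theta> k) = m"
    and u_meas [measurable]: "u k \<in> borel_measurable lebesgue" and u_nonneg: "0 \<le> u k x"
    and u_pos: "AE x in lebesgue. 0 < u k x"
    and u_prod: "AE x in lebesgue. (\<Prod>k\<in>UNIV. u k x powr \<theta> k) = 1"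
    and A_nonneg: "0 \<le> A"
    and char_le: "Q \<in> cubes \<Longrightarrow> (\<Prod>k\<in>UNIV. ennpow (nn_avg Q (u k)) (\<theta> k)) \<le> ennreal A"
begin

lemma m_pos: "0 < m"
  using \<theta>_pos \<theta>_less by (rule less_trans)

definition a :: "(real ^ 'n) set \<Rightarrow> 'k \<Rightarrow> real" where
  "a Q k = enn2real (nn_avg Q (u k))"

text \<open>Because \<open>0 * top = 0\<close> in \<open>ennreal\<close>, nonvanishing comes first:
  each weight is positive almost everywhere, so no average is 0. Then a single infinite average
  would make the whole product infinite, against \<open>char_le\<close>.\<close>

lemma
  assumes Q: "Q \<in> cubes"
  shows a_pos: "0 < a Q k" and nn_avg_u: "nn_avg Q (u k) = ennreal (a Q k)"
    and a_prod_le: "(\<Prod>k\<in>UNIV. a Q k powr \<theta> k) \<le> A"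
proof -
  note Qp = cube_emeasure_props[OF Q]
  note [measurable] = Qp(1)
  have nz: "nn_avg Q (u k) \<noteq> 0" for k
  proof
    assume "nn_avg Q (u k) = 0"
    then have "(\<integral>\<^sup>+x. ennreal (u k x) * indicator Q x \<partial>lebesgue) = 0"
      using nn_avg_eq_iff[OF Q, of 0 "u k"] by simp
    then have "AE x in lebesgue. ennreal (u k x) * indicator Q x = 0"
      using nn_integral_0_iff_AE[of "\<lambda>x. ennreal (u k x) * indicator Q x" lebesgue] by simp
    then have "AE x in lebesgue. x \<notin> Q"
      using u_pos[of k]
    proof eventually_elim
      case (elim x)
      then show ?case
        by (cases "x \<in> Q") auto
    qed
    then have "Q \<in> null_sets lebesgue"
      using AE_iff_null_sets[OF Qp(1)] by blast
    then show False
      using Qp(2) by (auto dest: null_setsD1)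
  qed
  have pow_nz: "ennpow (nn_avg Q (u k)) (\<theta> k) \<noteq> 0" for k
    using nz[of k] by (auto simp: ennpow_def enn2real_eq_0_iff)
  have fin: "nn_avg Q (u k) \<noteq> top" for k
  proof
    assume "nn_avg Q (u k) = top"
    then have "(\<Prod>k\<in>UNIV. ennpow (nn_avg Q (u k)) (\<theta> k)) = top"
      using pow_nz by (subst ennreal_prod_eq_top) (auto simp: ennpow_def intro!: exI[of _ k])
    then show False
      using char_le[OF Q] by (simp add: top_unique)
  qed
  show 1: "nn_avg Q (u k) = ennreal (a Q k)" for k
    using fin[of k] by (simp add: a_def less_top)
  show 2: "0 < a Q k" for k
    using nz[of k] unfolding 1 by (simp add: ennreal_eq_0_iff not_le)
  have "(\<Prod>k\<in>UNIV. ennpow (nn_avg Q (u k)) (\<theta> k)) = ennreal (\<Prod>k\<in>UNIV. a Q k powr \<theta> k)"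
    using 2 by (simp add: 1 ennpow_ennreal less_imp_le prod_ennreal)
  then show "(\<Prod>k\<in>UNIV. a Q k powr \<theta> k) \<le> A"
    using char_le[OF Q] A_nonneg by simp
qed

text \<open>Hoelder with exponents \<theta> k / m, whose sum is 1, applied on a unit cube to the
  identity 1 = \<Prod> (u k)^(\<theta> k / m).\<close>

lemma one_le_A: "1 \<le> A"
proof -
  define Q :: "(real ^ 'n) set" where "Q = cube 0 1"
  have Q: "Q \<in> cubes"
    by (auto simp: Q_def cubes_eq intro!: exI[of _ "1::real"])
  have "AE x in lebesgue. (\<Prod>k\<in>UNIV. u k x powr (\<theta> k / m)) = 1"
    using u_prod
  proof eventually_elim
    case (elim x)
    have "(\<Prod>k\<in>UNIV. u k x powr (\<theta> k / m)) = (\<Prod>k\<in>UNIV. (u k x powr \<theta> k) powr (1 / m))"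
      by (simp add: powr_powr)
    also have "\<dots> = 1"
      using elim by (simp add: prod_powr_distrib[symmetric])
    finally show ?case .
  qed
  then have "nn_avg Q (\<lambda>x. 1) \<le> nn_avg Q (\<lambda>x. \<Prod>k\<in>UNIV. u k x powr (\<theta> k / m))"
    by (intro nn_avg_mono_AE) (auto elim: eventually_mono)
  also have "\<dots> \<le> ennreal (\<Prod>k\<in>UNIV. a Q k powr (\<theta> k / m))"
    using Q u_nonneg \<theta>_pos m_pos a_pos nn_avg_u \<theta>_sum
    by (intro nn_avg_prod_powr_le) (auto simp: less_imp_le sum_divide_distrib[symmetric])
  also have "(\<Prod>k\<in>UNIV. a Q k powr (\<theta> k / m)) = (\<Prod>k\<in>UNIV. (a Q k powr \<theta> k) powr (1 / m))"
    by (simp add: powr_powr)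
  also have "\<dots> = (\<Prod>k\<in>UNIV. a Q k powr \<theta> k) powr (1 / m)"
    by (simp add: prod_powr_distrib[symmetric])
  also have "ennreal \<dots> \<le> ennreal (A powr (1 / m))"
    using m_pos a_prod_le[OF Q] by (intro ennreal_leI powr_mono2 prod_nonneg) auto
  finally have "1 \<le> A powr (1 / m)"
    unfolding nn_avg_const[OF Q] by simp
  then show ?thesis
    using m_pos A_nonneg powr_less_mono2[of "1 / m" A 1] by (cases "A < 1") auto
qed

text \<open>The solution of (\<beta> t)^(-s) / 2 = (A t^(-\<theta> k))^(1 / (m - \<theta> k)) with s
  = \<theta> k / (m - \<theta> k); t cancels. Its size in A is A^(-1 / \<theta> k), the source of
  the exponents p and p_j'.\<close>

definition \<beta> :: "'k \<Rightarrow> real" where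
  "\<beta> k = 2 powr (- (m - \<theta> k) / \<theta> k) * A powr (- 1 / \<theta> k)"

lemma \<beta>: "0 < \<beta> k" "\<beta> k \<le> 1"
proof -
  show "0 < \<beta> k"
    using one_le_A by (simp add: \<beta>_def)
  have "2 powr (- (m - \<theta> k) / \<theta> k) \<le> 2 powr 0"
    using \<theta>_less[of k] \<theta>_pos[of k] by (intro powr_mono divide_nonpos_pos) auto
  moreover have "A powr (- 1 / \<theta> k) \<le> A powr 0"
    using one_le_A \<theta>_pos[of k] by (intro powr_mono) auto
  ultimately show "\<beta> k \<le> 1"
    using one_le_A unfolding \<beta>_def by (intro mult_le_one) auto
qed

text \<open>By \<open>u_prod\<close>, the other weights multiply to (u k)^(-s) after taking the
  power 1 / (m - \<theta> k), which is large where u k \<le> \<beta> t. Hoelder with exponents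
  \<theta> i / (m - \<theta> k), together with \<open>char_le\<close> and t \<le>
  \<open>a Q k\<close>, bounds the average of that product. Chebyshev then limits the exceptional
  set to half of Q.\<close>

lemma emeasure_le_half:
  assumes Q: "Q \<in> cubes" and t: "0 < t"
    and le: "ennreal t * emeasure lebesgue Q \<le> (\<integral>\<^sup>+x\<in>Q. ennreal (u k x) \<partial>lebesgue)"
  shows "emeasure lebesgue Q \<le> 2 * emeasure lebesgue {x \<in> Q. \<beta> k * t < u k x}"
proof -
  note Qp = cube_emeasure_props[OF Q]
  define s where "s = \<theta> k / (m - \<theta> k)"
  define E where "E = {x \<in> Q. u k x \<le> \<beta> k * t}"
  have s: "0 < s"
    using \<theta>_pos[of k] \<theta>_less[of k] by (simp add: s_def)
  have ta: "t \<le> a Q k"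
  proof -
    have "ennreal t * emeasure lebesgue Q \<le> ennreal (a Q k) * emeasure lebesgue Q"
      using le nn_avg_eq_iff[OF Q, of "a Q k" "u k"] nn_avg_u[OF Q, of k] a_pos[OF Q, of k] by simp
    then show ?thesis
      unfolding Qp(5)[THEN arg_cong, of "\<lambda>z. _ * z"] using Qp(4) t a_pos[OF Q, of k]
      by (simp flip: ennreal_mult')
  qed
  define g where "g x = (\<Prod>i\<in>UNIV - {k}. u i x powr (\<theta> i / (m - \<theta> k)))" for x
  have sum1: "(\<Sum>i\<in>UNIV - {k}. \<theta> i / (m - \<theta> k)) = 1"
    using \<theta>_less[of k] \<theta>_sum by (simp add: sum_divide_distrib[symmetric] sum_diff1)
  have "AE x in lebesgue. x \<in> Q \<longrightarrow> (\<beta> k * t) powr (- s) * indicat_real E x \<le> g x"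
    using u_prod u_pos[of k]
  proof eventually_elim
    case (elim x)
    show ?case
    proof (cases "x \<in> E")
      case True
      have "(\<Prod>i\<in>UNIV - {k}. u i x powr \<theta> i) = u k x powr (- \<theta> k)"
        using elim by (subst (asm) prod.remove[of _ k]) (auto simp: powr_minus field_simps)
      moreover have "g x = (\<Prod>i\<in>UNIV - {k}. u i x powr \<theta> i) powr (1 / (m - \<theta> k))"
        unfolding g_def by (subst prod_powr_distrib) (auto simp: powr_powr)
      ultimately have "g x = u k x powr (- s)"
        by (simp add: powr_powr s_def)
      moreover have "(\<beta> k * t) powr (- s) \<le> u k x powr (- s)"
        using True elim s by (intro powr_mono2') (auto simp: E_def)
      ultimately show ?thesis
        using True by simp
    qed (auto simp: g_def intro!: prod_nonneg)
  qed
  then have "nn_avg Q (\<lambda>x. (\<beta> k * t) powr (- s) * indicat_real E x) \<le> nn_avg Q g"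
    by (rule nn_avg_mono_AE)
  also have "nn_avg Q g \<le> ennreal (\<Prod>i\<in>UNIV - {k}. a Q i powr (\<theta> i / (m - \<theta> k)))"
    unfolding g_def using Q u_nonneg \<theta>_pos \<theta>_less[of k] a_pos nn_avg_u sum1
    by (intro nn_avg_prod_powr_le) (auto simp: less_imp_le)
  also have "(\<Prod>i\<in>UNIV - {k}. a Q i powr (\<theta> i / (m - \<theta> k)))
      = (\<Prod>i\<in>UNIV - {k}. a Q i powr \<theta> i) powr (1 / (m - \<theta> k))"
    by (subst prod_powr_distrib) (auto simp: powr_powr)
  also have "ennreal \<dots> \<le> ennreal ((A * t powr (- \<theta> k)) powr (1 / (m - \<theta> k)))"
  proof (intro ennreal_leI powr_mono2)
    have "(\<Prod>i\<in>UNIV - {k}. a Q i powr \<theta> i) * a Q k powr \<theta> k \<le> A"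
      using a_prod_le[OF Q] by (subst (asm) prod.remove[of _ k]) (auto simp: mult.commute)
    then have "(\<Prod>i\<in>UNIV - {k}. a Q i powr \<theta> i) \<le> A * a Q k powr (- \<theta> k)"
      using a_pos[OF Q, of k] by (simp add: powr_minus field_simps)
    also have "\<dots> \<le> A * t powr (- \<theta> k)"
      using ta t A_nonneg \<theta>_pos[of k] by (intro mult_left_mono powr_mono2') auto
    finally show "(\<Prod>i\<in>UNIV - {k}. a Q i powr \<theta> i) \<le> A * t powr (- \<theta> k)" .
  qed (use \<theta>_less[of k] in \<open>auto intro!: prod_nonneg\<close>)
  also have "(A * t powr (- \<theta> k)) powr (1 / (m - \<theta> k)) = (\<beta> k * t) powr (- s) * (1 / 2)"
  proof -
    have "(\<beta> k) powr (- s) = 2 * A powr (1 / (m - \<theta> k))"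
    proof -
      have "(- (m - \<theta> k) / \<theta> k) * (- s) = 1" "(- 1 / \<theta> k) * (- s) = 1 / (m - \<theta> k)"
        using \<theta>_pos[of k] \<theta>_less[of k] unfolding s_def by (auto simp: field_simps)
      then show ?thesis
        using A_nonneg unfolding \<beta>_def by (subst powr_mult) (auto simp: powr_powr)
    qed
    then have "(\<beta> k * t) powr (- s) = 2 * A powr (1 / (m - \<theta> k)) * t powr (- s)"
      using \<beta>[of k] t by (simp add: powr_mult)
    then show ?thesis
      using A_nonneg t by (simp add: powr_mult powr_powr s_def)
  qed
  finally have 1: "nn_avg Q (\<lambda>x. (\<beta> k * t) powr (- s) * indicat_real E x)
    \<le> ennreal ((\<beta> k * t) powr (- s) * (1 / 2))" .
  have Es: "E \<in> sets lebesgue"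
  proof -
    have "{x \<in> space lebesgue. x \<in> Q \<and> u k x \<le> \<beta> k * t} \<in> sets lebesgue"
      using Qp(1) by measurable
    then show ?thesis by (simp add: E_def)
  qed
  have 2: "{x \<in> Q. \<beta> k * t < u k x} = Q - E"
    by (auto simp: E_def)
  have "ennreal ((\<beta> k * t) powr (- s)) * nn_avg Q (indicat_real E)
      \<le> ennreal ((\<beta> k * t) powr (- s)) * ennreal (1 / 2)"
  proof -
    have "ennreal ((\<beta> k * t) powr (- s) * (1 / 2)) = ennreal ((\<beta> k * t) powr (- s)) * ennreal (1 / 2)"
      by (rule ennreal_mult) auto
    then show ?thesis
      using 1 nn_avg_cmult[OF Q, of "indicat_real E" "(\<beta> k * t) powr (- s)"] Es by simp
  qed
  then have "nn_avg Q (indicat_real E) \<le> ennreal (1 / 2)"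
    using \<beta>[of k] t by (subst (asm) ennreal_mult_le_mult_iff) (auto simp: ennreal_eq_0_iff not_le)
  then have "(\<integral>\<^sup>+x\<in>Q. ennreal (indicat_real E x) \<partial>lebesgue) \<le> ennreal (1 / 2) * emeasure lebesgue Q"
    using nn_avg_le_iff[OF Q, of "1 / 2"] by simp
  also have "(\<integral>\<^sup>+x\<in>Q. ennreal (indicat_real E x) \<partial>lebesgue) = (\<integral>\<^sup>+x. indicator E x \<partial>lebesgue)"
    by (intro nn_integral_cong) (auto simp: E_def indicator_def)
  also have "\<dots> = emeasure lebesgue E"
    using Es by simp
  finally have 3: "emeasure lebesgue E \<le> ennreal (1 / 2) * emeasure lebesgue Q" .
  have 4: "emeasure lebesgue E = ennreal (measure lebesgue E)"
  proof (rule emeasure_eq_ennreal_measure)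
    have "ennreal (1 / 2) * emeasure lebesgue Q < top"
      unfolding ennreal_mult_less_top using Qp(3) ennreal_less_top[of "1 / 2"] by simp
    then show "emeasure lebesgue E \<noteq> top"
      using 3 by (auto simp: top_unique)
  qed
  have "measure lebesgue E \<le> 1 / 2 * measure lebesgue Q"
  proof -
    have "ennreal (measure lebesgue E) \<le> ennreal (1 / 2 * measure lebesgue Q)"
      using 3 unfolding 4 Qp(5) by (subst ennreal_mult) auto
    then show ?thesis
      by (subst (asm) ennreal_le_iff) auto
  qed
  moreover have "measure lebesgue (Q - E) = measure lebesgue Q - measure lebesgue E"
    using Qp Es 4 by (intro measure_Diff) (auto simp: E_def fmeasurable_def)
  moreover have "emeasure lebesgue (Q - E) = ennreal (measure lebesgue (Q - E))"
  proof (rule emeasure_eq_ennreal_measure)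
    have "emeasure lebesgue (Q - E) \<le> emeasure lebesgue Q"
      using Qp(1) by (intro emeasure_mono) auto
    then show "emeasure lebesgue (Q - E) \<noteq> top"
      using Qp(3) by (auto simp: top_unique)
  qed
  ultimately show ?thesis
    unfolding 2 Qp(5) by (simp add: ennreal_mult'[symmetric] ennreal_leI flip: ennreal_numeral)
qed

lemma nn_avg_reverse_hoelder:
  assumes Q: "Q \<in> cubes"
  shows "nn_avg Q (\<lambda>x. u k x powr (1 + rh_const TYPE('n) * \<beta> k))
    \<le> ennreal (2 * a Q k powr (1 + rh_const TYPE('n) * \<beta> k))"
proof -
  have "(\<integral>\<^sup>+x\<in>Q. ennreal (u k x) \<partial>lebesgue) = ennreal (a Q k) * emeasure lebesgue Q"
    using nn_avg_u[OF Q, of k] a_pos[OF Q, of k] by (simp add: nn_avg_eq_iff[OF Q])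
  then have "(\<integral>\<^sup>+x\<in>Q. ennreal (u k x powr (1 + rh_const TYPE('n) * \<beta> k)) \<partial>lebesgue)
      \<le> ennreal (2 * a Q k powr (1 + rh_const TYPE('n) * \<beta> k)) * emeasure lebesgue Q"
    using \<beta>[of k] a_pos[OF Q, of k] Q u_nonneg emeasure_le_half rh_const_pos[where 'n='n]
    by (intro reverse_hoelder[where \<beta> = "\<beta> k"]) auto
  then show ?thesis
    by (simp add: nn_avg_le_iff[OF Q])
qed

text \<open>Hoelder for u, u^(1+\<epsilon>) and exp(|b - b_Q| / B) with weights 1 - \<tau>,
  \<tau>/(1+\<epsilon>) and \<tau> \<epsilon>/(1+\<epsilon>): the powers of u add up to 1. The three
  averages are at most a, 2 a^(1+\<epsilon>) and 2, so the loss is only 2^\<tau>. The 2 in the bound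
  on \<kappa> comes from 1 + \<epsilon> \<le> 2.\<close>

lemma nn_avg_exp_le:
  assumes Q: "Q \<in> cubes" and b: "b \<in> borel_measurable lebesgue" "BMO_norm b < ennreal B" and B: "0 < B"
    and \<tau>: "0 < \<tau>" "\<tau> \<le> 1" and \<kappa>: "\<kappa> \<le> \<tau> * (rh_const TYPE('n) * \<beta> k) / (2 * B)"
  shows "nn_avg Q (\<lambda>x. u k x * exp (\<kappa> * norm (b x - avg Q b))) \<le> ennreal (2 powr \<tau> * a Q k)"
proof -
  define \<epsilon> where "\<epsilon> = rh_const TYPE('n) * \<beta> k"
  define h where "h x = exp (norm (b x - avg Q b) / B)" for x
  note [measurable] = b(1)
  have \<epsilon>: "0 < \<epsilon>" "\<epsilon> \<le> 1"
    using rh_const_pos[where 'n='n] rh_const_le_1[where 'n='n] \<beta>[of k]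
    by (auto simp: \<epsilon>_def intro!: mult_le_one)
  define t where "t i = (if i = 0 then 1 - \<tau> else if i = 1 then \<tau> / (1 + \<epsilon>) else \<tau> * \<epsilon> / (1 + \<epsilon>))" for i :: nat
  define f where "f i x = (if i = 0 then u k x else if i = 1 then u k x powr (1 + \<epsilon>) else h x)" for i :: nat and x
  define c where "c i = (if i = 0 then a Q k else if i = 1 then 2 * a Q k powr (1 + \<epsilon>) else 2)" for i :: nat
  have t: "t i \<ge> 0" "(\<Sum>i\<in>{0, 1, 2}. t i) = 1" for i
    using \<tau> \<epsilon> by (auto simp: t_def add_divide_distrib[symmetric] field_simps)
  have "\<kappa> \<le> \<tau> * \<epsilon> / ((1 + \<epsilon>) * B)"
  proof -
    have "\<tau> * \<epsilon> / (2 * B) \<le> \<tau> * \<epsilon> / ((1 + \<epsilon>) * B)"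
      using \<tau> \<epsilon> B by (intro divide_left_mono) auto
    then show ?thesis
      using \<kappa> by (simp add: \<epsilon>_def)
  qed
  then have "u k x * exp (\<kappa> * norm (b x - avg Q b)) \<le> (\<Prod>i\<in>{0, 1, 2}. f i x powr t i)" for x
  proof -
    assume le: "\<kappa> \<le> \<tau> * \<epsilon> / ((1 + \<epsilon>) * B)"
    have "\<kappa> * norm (b x - avg Q b) \<le> \<tau> * \<epsilon> / ((1 + \<epsilon>) * B) * norm (b x - avg Q b)"
      using le by (rule mult_right_mono) auto
    then have "exp (\<kappa> * norm (b x - avg Q b)) \<le> exp (\<tau> * \<epsilon> / ((1 + \<epsilon>) * B) * norm (b x - avg Q b))"
      by simp
    also have "\<dots> = h x powr (\<tau> * \<epsilon> / (1 + \<epsilon>))"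
      by (simp add: h_def powr_def)
    finally have "u k x * exp (\<kappa> * norm (b x - avg Q b)) \<le> u k x * h x powr (\<tau> * \<epsilon> / (1 + \<epsilon>))"
      using u_nonneg by (intro mult_left_mono) auto
    also have "u k x * h x powr (\<tau> * \<epsilon> / (1 + \<epsilon>)) = (\<Prod>i\<in>{0, 1, 2}. f i x powr t i)"
    proof -
      have "u k x powr (1 - \<tau>) * (u k x powr (1 + \<epsilon>)) powr (\<tau> / (1 + \<epsilon>)) = u k x"
        using u_nonneg[of k x] \<epsilon> by (cases "u k x = 0") (auto simp: powr_powr powr_add[symmetric])
      then show ?thesis
        by (simp add: f_def t_def mult.assoc[symmetric])
    qed
    finally show ?thesis .
  qed
  then have "nn_avg Q (\<lambda>x. u k x * exp (\<kappa> * norm (b x - avg Q b)))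
      \<le> nn_avg Q (\<lambda>x. \<Prod>i\<in>{0, 1, 2}. f i x powr t i)"
    by (intro nn_avg_mono_AE) auto
  also have "\<dots> \<le> ennreal (\<Prod>i\<in>{0, 1, 2}. c i powr t i)"
  proof (rule nn_avg_prod_powr_le[OF Q _ _ _ t])
    fix i :: nat
    show "f i \<in> borel_measurable lebesgue"
      unfolding f_def h_def by measurable
    show "nn_avg Q (f i) \<le> ennreal (c i)"
    proof -
      have "nn_avg Q h \<le> 2"
        unfolding h_def using b(2) Q B by (rule BMO_exp_avg_le)
      moreover have "nn_avg Q (\<lambda>x. u k x powr (1 + \<epsilon>)) \<le> ennreal (2 * a Q k powr (1 + \<epsilon>))"
        unfolding \<epsilon>_def by (rule nn_avg_reverse_hoelder[OF Q])
      ultimately show ?thesis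
        using nn_avg_u[OF Q, of k] by (auto simp: f_def[abs_def] c_def)
    qed
  qed (use u_nonneg a_pos[OF Q, of k] in \<open>auto simp: f_def h_def c_def\<close>)
  also have "(\<Prod>i\<in>{0, 1, 2}. c i powr t i) = 2 powr \<tau> * a Q k"
  proof -
    have a: "0 < a Q k"
      by (rule a_pos[OF Q])
    have "(\<Prod>i\<in>{0, 1, 2}. c i powr t i)
        = (a Q k powr (1 - \<tau>) * (a Q k powr (1 + \<epsilon>)) powr (\<tau> / (1 + \<epsilon>))) *
          (2 powr (\<tau> / (1 + \<epsilon>)) * 2 powr (\<tau> * \<epsilon> / (1 + \<epsilon>)))"
      using a by (simp add: c_def t_def powr_mult)
    also have "a Q k powr (1 - \<tau>) * (a Q k powr (1 + \<epsilon>)) powr (\<tau> / (1 + \<epsilon>)) = a Q k"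
      using a \<epsilon> by (simp add: powr_powr powr_add[symmetric])
    also have "2 powr (\<tau> / (1 + \<epsilon>)) * 2 powr (\<tau> * \<epsilon> / (1 + \<epsilon>)) = 2 powr (\<tau> / (1 + \<epsilon>) + \<tau> * \<epsilon> / (1 + \<epsilon>))"
      by (simp add: powr_add)
    also have "\<tau> / (1 + \<epsilon>) + \<tau> * \<epsilon> / (1 + \<epsilon>) = \<tau>"
      using \<epsilon> by (simp add: add_divide_distrib[symmetric] field_simps)
    finally show ?thesis
      by (simp add: mult.commute)
  qed
  finally show ?thesis .
qed

text \<open>After subtraction of g0, the function g is controlled by the oscillation of b on Q. The
  constants exp(\<eta> k g0) taken out of the factors cancel because the signs \<eta> k sum to 0; in
  the application \<eta> is 1 for \<nu>, -1 for the dual weight of slot j and 0 otherwise.\<close>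

lemma perturbed_char_le:
  assumes Q: "Q \<in> cubes" and b: "b \<in> borel_measurable lebesgue" "BMO_norm b < ennreal B" and B: "0 < B"
    and \<tau>: "0 < \<tau>" "\<tau> \<le> 1" and \<kappa>: "0 \<le> \<kappa>" "\<And>k. \<kappa> / \<theta> k \<le> \<tau> * (rh_const TYPE('n) * \<beta> k) / (2 * B)"
    and g: "g \<in> borel_measurable lebesgue" "\<And>x. \<bar>g x - g0\<bar> \<le> \<kappa> * norm (b x - avg Q b)"
    and \<eta>: "\<And>k. \<bar>\<eta> k\<bar> \<le> 1" "(\<Sum>k\<in>UNIV. \<eta> k) = 0"
  shows "(\<Prod>k\<in>UNIV. ennpow (nn_avg Q (\<lambda>x. u k x * exp (\<eta> k * g x / \<theta> k))) (\<theta> k)) \<le> ennreal (2 powr (\<tau> * m) * A)"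
proof -
  note [measurable] = b(1) g(1)
  let ?c = "\<lambda>k. exp (\<eta> k * g0 / \<theta> k) * (2 powr \<tau> * a Q k)"
  have c: "0 \<le> ?c k" for k
    using a_pos[OF Q, of k] by simp
  have 1: "nn_avg Q (\<lambda>x. u k x * exp (\<eta> k * g x / \<theta> k)) \<le> ennreal (?c k)" for k
  proof -
    have "u k x * exp (\<eta> k * g x / \<theta> k)
        \<le> exp (\<eta> k * g0 / \<theta> k) * (u k x * exp (\<kappa> / \<theta> k * norm (b x - avg Q b)))" for x
    proof -
      have "\<eta> k * (g x - g0) \<le> \<bar>\<eta> k\<bar> * \<bar>g x - g0\<bar>"
        by (metis abs_ge_self abs_mult)
      also have "\<dots> \<le> 1 * (\<kappa> * norm (b x - avg Q b))"
        using \<eta> g \<kappa> by (intro mult_mono) auto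
      finally have "\<eta> k * (g x - g0) / \<theta> k \<le> \<kappa> * norm (b x - avg Q b) / \<theta> k"
        using \<theta>_pos[of k] by (simp add: divide_right_mono)
      then have "\<eta> k * g x / \<theta> k \<le> \<eta> k * g0 / \<theta> k + \<kappa> / \<theta> k * norm (b x - avg Q b)"
        by (simp add: diff_divide_distrib right_diff_distrib)
      then have "u k x * exp (\<eta> k * g x / \<theta> k) \<le> u k x * exp (\<eta> k * g0 / \<theta> k + \<kappa> / \<theta> k * norm (b x - avg Q b))"
        using u_nonneg by (intro mult_left_mono) auto
      then show ?thesis
        by (simp add: exp_add mult_ac)
    qed
    then have "nn_avg Q (\<lambda>x. u k x * exp (\<eta> k * g x / \<theta> k))
        \<le> nn_avg Q (\<lambda>x. exp (\<eta> k * g0 / \<theta> k) * (u k x * exp (\<kappa> / \<theta> k * norm (b x - avg Q b))))"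
      by (intro nn_avg_mono_AE) auto
    also have "\<dots> = ennreal (exp (\<eta> k * g0 / \<theta> k)) * nn_avg Q (\<lambda>x. u k x * exp (\<kappa> / \<theta> k * norm (b x - avg Q b)))"
      using Q by (intro nn_avg_cmult) auto
    also have "\<dots> \<le> ennreal (exp (\<eta> k * g0 / \<theta> k)) * ennreal (2 powr \<tau> * a Q k)"
      by (intro mult_left_mono nn_avg_exp_le[OF Q b B \<tau> \<kappa>(2)]) auto
    also have "\<dots> = ennreal (?c k)"
      by (simp add: ennreal_mult')
    finally show ?thesis .
  qed
  have "(\<Prod>k\<in>UNIV. ennpow (nn_avg Q (\<lambda>x. u k x * exp (\<eta> k * g x / \<theta> k))) (\<theta> k))
      \<le> (\<Prod>k\<in>UNIV. ennpow (ennreal (?c k)) (\<theta> k))"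
    using 1 \<theta>_pos by (intro prod_mono_ennreal ennpow_mono) (auto simp: less_imp_le)
  also have "\<dots> = ennreal (\<Prod>k\<in>UNIV. ?c k powr \<theta> k)"
    using c by (simp add: ennpow_ennreal prod_ennreal)
  also have "(\<Prod>k\<in>UNIV. ?c k powr \<theta> k) = (\<Prod>k\<in>UNIV. exp (\<eta> k * g0) * (2 powr (\<tau> * \<theta> k) * a Q k powr \<theta> k))"
  proof (rule prod.cong[OF refl])
    fix k
    have "exp (\<eta> k * g0 / \<theta> k) powr \<theta> k = exp (\<eta> k * g0)"
      using \<theta>_pos[of k] by (simp add: powr_def)
    then show "?c k powr \<theta> k = exp (\<eta> k * g0) * (2 powr (\<tau> * \<theta> k) * a Q k powr \<theta> k)"
      using a_pos[OF Q, of k] by (simp add: powr_mult powr_powr)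
  qed
  also have "\<dots> = exp (\<Sum>k\<in>UNIV. \<eta> k * g0) * (2 powr (\<Sum>k\<in>UNIV. \<tau> * \<theta> k) * (\<Prod>k\<in>UNIV. a Q k powr \<theta> k))"
    by (simp add: prod.distrib exp_sum powr_sum)
  also have "\<dots> = 2 powr (\<tau> * m) * (\<Prod>k\<in>UNIV. a Q k powr \<theta> k)"
    by (simp add: sum_distrib_right[symmetric] sum_distrib_left[symmetric] \<eta> \<theta>_sum)
  also have "ennreal \<dots> \<le> ennreal (2 powr (\<tau> * m) * A)"
    using a_prod_le[OF Q] by (intro ennreal_leI mult_left_mono) auto
  finally show ?thesis .
qed

end

section \<open>Multiple weights as a symmetric family and their perturbation\<close>

lemma locally_integrable_measurable:
  fixes f :: "real ^ 'n \<Rightarrow> 'b::{banach, second_countable_topology}"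
  assumes "locally_integrable f"
  shows "f \<in> borel_measurable lebesgue"
proof (rule borel_measurable_LIMSEQ_metric)
  show "(\<lambda>x. indicator (cball 0 (real n)) x *\<^sub>R f x) \<in> borel_measurable lebesgue" for n
    using assms by (auto simp: locally_integrable_def set_integrable_def intro: borel_measurable_integrable)
  fix x :: "real ^ 'n"
  obtain N where N: "norm x \<le> real N"
    using real_arch_simple by blast
  have "eventually (\<lambda>n. indicator (cball 0 (real n)) x *\<^sub>R f x = f x) sequentially"
    using eventually_ge_at_top[of N] by eventually_elim (use N in \<open>auto simp: indicator_def\<close>)
  then show "(\<lambda>n. indicator (cball 0 (real n)) x *\<^sub>R f x) \<longlonglongrightarrow> f x"
    by (rule tendsto_eventually)
qed

lemma conj_exp_props:
  assumes "1 < q"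
  shows "1 < conj_exp q" "1 / conj_exp q = 1 - 1 / q" "q * (1 - conj_exp q) = - conj_exp q"
    "(1 - conj_exp q) * (1 / conj_exp q) = - 1 / q"
  using assms by (auto simp: conj_exp_def field_simps)

definition dual_family ::
  "('m::finite \<Rightarrow> real) \<Rightarrow> real \<Rightarrow> ('m \<Rightarrow> real ^ 'n \<Rightarrow> real) \<Rightarrow> 'm option \<Rightarrow> real ^ 'n \<Rightarrow> real" where
  "dual_family P p w k =
     (case k of None \<Rightarrow> nu P p w | Some j \<Rightarrow> (\<lambda>x. w j x powr (1 - conj_exp (P j))))"

definition dual_exp :: "('m::finite \<Rightarrow> real) \<Rightarrow> real \<Rightarrow> 'm option \<Rightarrow> real" where
  "dual_exp P p k = (case k of None \<Rightarrow> 1 / p | Some j \<Rightarrow> 1 / conj_exp (P j))"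

lemma prod_UNIV_option:
  "(\<Prod>k\<in>UNIV. f k) = f None * (\<Prod>j\<in>(UNIV :: 'm::finite set). f (Some j) :: 'a::comm_monoid_mult)"
  by (simp add: UNIV_option_conv prod.reindex)

lemma sum_UNIV_option:
  "(\<Sum>k\<in>UNIV. f k) = f None + (\<Sum>j\<in>(UNIV :: 'm::finite set). f (Some j) :: 'a::comm_monoid_add)"
  by (simp add: UNIV_option_conv sum.reindex)

lemma AP_char_eq_dual_family:
  "AP_char P p w = (SUP Q\<in>cubes. \<Prod>k\<in>UNIV. ennpow (nn_avg Q (dual_family P p w k)) (dual_exp P p k))"
  by (simp add: AP_char_def prod_UNIV_option dual_family_def dual_exp_def)

lemma AP_measurable:
  assumes "w \<in> AP P p"
  shows "w j \<in> borel_measurable lebesgue"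
  using assms by (auto simp: AP_def weight_def intro: locally_integrable_measurable)

lemma nu_measurable:
  assumes "w \<in> AP P p"
  shows "nu P p w \<in> borel_measurable lebesgue"
  unfolding nu_def using AP_measurable[OF assms] by measurable

lemma nu_nonneg: "0 \<le> nu P p w x"
  by (auto simp: nu_def intro!: prod_nonneg)

lemma AP_AE_pos:
  assumes "w \<in> AP P p"
  shows "AE x in lebesgue. \<forall>j. 0 < w j x"
  using assms by (auto simp: AP_def AE_all_countable)

lemma AP_AE_nu_pos:
  assumes "w \<in> AP P p"
  shows "AE x in lebesgue. 0 < nu P p w x"
  using AP_AE_pos[OF assms]
proof eventually_elim
  case (elim x)
  then have "0 < w j x powr (p / P j)" for j
    using elim by (simp add: less_imp_neq[symmetric])
  then show ?case
    unfolding nu_def by (intro prod_pos) auto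
qed

lemma nu_update:
  assumes "\<And>i. 0 \<le> w i x" "P j \<noteq> 0"
  shows "nu P p (w(j := \<lambda>x. w j x * exp (P j * g x))) x = nu P p w x * exp (p * g x)"
proof -
  have "(w(j := \<lambda>x. w j x * exp (P j * g x))) i x powr (p / P i)
      = w i x powr (p / P i) * (if i = j then exp (p * g x) else 1)" for i
    using assms by (auto simp: powr_mult exp_powr_real)
  then show ?thesis
    by (simp add: nu_def prod.distrib)
qed

locale exponents =
  fixes P :: "'m::finite \<Rightarrow> real" and p :: real
  assumes P: "1 < P j" and p: "1 < p" and p_sum: "1 / p = (\<Sum>j\<in>UNIV. 1 / P j)"
begin

definition "\<mu> = Max (insert p (range (\<lambda>j. conj_exp (P j))))"

lemma dual_exp_pos: "0 < dual_exp P p k"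
  using P p conj_exp_props(1)[OF P] by (auto simp: dual_exp_def split: option.split intro: less_trans[OF zero_less_one])

lemma dual_exp_less_1: "dual_exp P p k < 1"
  using P p conj_exp_props(2)[OF P] by (auto simp: dual_exp_def less_trans[OF zero_less_one] split: option.split)

text \<open>The relation between p and the p_j is what makes 1/p + \<Sum> (1 - 1/p_j) equal to
  m.\<close>

lemma dual_exp_sum: "(\<Sum>k\<in>UNIV. dual_exp P p k) = real CARD('m)"
  using conj_exp_props(2)[OF P] p_sum by (simp add: sum_UNIV_option dual_exp_def sum_subtractf)

lemma inverse_dual_exp_le: "1 / dual_exp P p k \<le> \<mu>"
  unfolding \<mu>_def by (rule Max.coboundedI) (cases k; auto simp: dual_exp_def)+

text \<open>The product identity holds wherever all w_j are positive: \<nu>^(1/p) is the product of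
  the w_j^(1/p_j), while the dual weights contribute w_j^(-1/p_j).\<close>

lemma dual_weights_AP:
  fixes w :: "'m \<Rightarrow> real ^ 'n \<Rightarrow> real"
  assumes w: "w \<in> AP P p"
  shows "dual_weights (dual_family P p w) (dual_exp P p) (real CARD('m)) (enn2real (AP_char P p w))"
proof
  fix k :: "'m option"
  show "0 < dual_exp P p k"
    by (rule dual_exp_pos)
  have "1 \<le> real CARD('m)"
    by (simp add: Suc_le_eq)
  then show "dual_exp P p k < real CARD('m)"
    using dual_exp_less_1[of k] by linarith
  show "(\<Sum>k\<in>UNIV. dual_exp P p k) = real CARD('m)"
    by (rule dual_exp_sum)
  show "dual_family P p w k \<in> borel_measurable lebesgue"
    using nu_measurable[OF w] AP_measurable[OF w] by (cases k) (auto simp: dual_family_def)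
  show "0 \<le> dual_family P p w k x" for x
    by (cases k) (auto simp: dual_family_def nu_nonneg)
  show "AE x in lebesgue. 0 < dual_family P p w k x"
  proof (cases k)
    case (Some j)
    show ?thesis
      using AP_AE_pos[OF w] by eventually_elim (simp add: dual_family_def Some less_imp_neq[symmetric])
  qed (use AP_AE_nu_pos[OF w] in \<open>simp add: dual_family_def\<close>)
  show "AE x in lebesgue. (\<Prod>k\<in>UNIV. dual_family P p w k x powr dual_exp P p k) = 1"
    using AP_AE_pos[OF w]
  proof eventually_elim
    case (elim x)
    have "nu P p w x powr (1 / p) = (\<Prod>j\<in>UNIV. w j x powr (1 / P j))"
      unfolding nu_def using p by (subst prod_powr_distrib) (auto simp: powr_powr)
    moreover have "(w j x powr (1 - conj_exp (P j))) powr (1 / conj_exp (P j)) = w j x powr (- 1 / P j)" for j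
      unfolding powr_powr conj_exp_props(4)[OF P] ..
    ultimately have "(\<Prod>k\<in>UNIV. dual_family P p w k x powr dual_exp P p k)
        = (\<Prod>j\<in>UNIV. w j x powr (1 / P j) * w j x powr (- 1 / P j))"
      by (simp add: prod_UNIV_option dual_family_def dual_exp_def prod.distrib)
    also have "\<dots> = 1"
      using elim by (intro prod.neutral) (auto simp: powr_add[symmetric] less_imp_neq[symmetric])
    finally show ?case .
  qed
  show "0 \<le> enn2real (AP_char P p w)"
    by simp
  have "AP_char P p w < top"
    using w by (simp add: AP_def)
  then show "(\<Prod>k\<in>UNIV. ennpow (nn_avg Q (dual_family P p w k)) (dual_exp P p k)) \<le> ennreal (enn2real (AP_char P p w))"
    if "Q \<in> cubes" for Q
    using that SUP_upper[of Q cubes "\<lambda>Q. \<Prod>k\<in>UNIV. ennpow (nn_avg Q (dual_family P p w k)) (dual_exp P p k)"]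
    by (simp add: AP_char_eq_dual_family)
qed

lemma one_le_AP_char:
  assumes "w \<in> AP P p"
  shows "1 \<le> enn2real (AP_char P p w)"
  using dual_weights.one_le_A[OF dual_weights_AP[OF assms]] .

text \<open>Multiplying w_j by exp(p_j g) multiplies \<nu> by exp(p g) and the j-th dual weight by
  exp(-p_j' g). In both cases this is exp(\<plusminus> g / \<theta>), the form expected by
  \<open>perturbed_char_le\<close>.\<close>

lemma dual_family_update:
  assumes w: "\<And>i x. 0 \<le> w i x"
  shows "dual_family P p (w(j := \<lambda>x. w j x * exp (P j * g x))) k
    = (\<lambda>x. dual_family P p w k x * exp ((if k = None then 1 else if k = Some j then - 1 else 0) * g x / dual_exp P p k))"
proof (cases k)
  case None
  then show ?thesis
    using w P[of j] by (auto simp: dual_family_def dual_exp_def nu_update mult.commute)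
next
  case (Some i)
  have "P j * ((1 - conj_exp (P j)) * g x) = - conj_exp (P j) * g x" for x
    by (simp only: mult.assoc[symmetric] conj_exp_props(3)[OF P])
  then show ?thesis
    using w Some by (auto simp: dual_family_def dual_exp_def powr_mult exp_powr_real mult_ac)
qed

text \<open>Stated for Lipschitz \<gamma> because two kinds of perturbation are needed: truncations
  of Re (z b) and -\<kappa> |b|. The Lipschitz bound gives |\<gamma>(b) - \<gamma>(b_Q)| \<le>
  \<kappa> |b - b_Q|, and the upper bound G keeps the new weight locally integrable.
  \<open>\<kappa>0\<close> is chosen before the weight and b.\<close>

lemma AP_perturb:
  assumes "1 < c"
  obtains \<kappa>0 where "0 < \<kappa>0"
    "\<And>(w :: 'm \<Rightarrow> real ^ 'n \<Rightarrow> real) j b B \<kappa> \<gamma> G.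
      \<lbrakk>w \<in> AP P p; b \<in> BMO; BMO_norm b < ennreal B; 0 < B; 0 \<le> \<kappa>;
       \<kappa> \<le> \<kappa>0 / (enn2real (AP_char P p w) powr \<mu> * B);
       \<And>y z. \<bar>\<gamma> y - \<gamma> z\<bar> \<le> \<kappa> * norm (y - z); \<And>y. \<gamma> y \<le> G\<rbrakk> \<Longrightarrow>
      w(j := \<lambda>x. w j x * exp (P j * \<gamma> (b x))) \<in> AP P p \<and>
      AP_char P p (w(j := \<lambda>x. w j x * exp (P j * \<gamma> (b x)))) \<le> ennreal (c * enn2real (AP_char P p w))"
proof -
  define m where "m = real CARD('m)"
  have m: "0 < m"
    by (simp add: m_def)
  \<comment> \<open>\<open>perturbed_char_le\<close> loses 2^(\<tau> m), which this choice keeps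
    below c.\<close>
  define \<tau> where "\<tau> = min 1 (log 2 c / m)"
  have \<tau>: "0 < \<tau>" "\<tau> \<le> 1" "2 powr (\<tau> * m) \<le> c"
  proof -
    show "0 < \<tau>" "\<tau> \<le> 1"
      using assms m by (auto simp: \<tau>_def)
    have "\<tau> * m \<le> log 2 c"
      using m by (simp add: \<tau>_def min_def field_simps)
    then have "2 powr (\<tau> * m) \<le> 2 powr (log 2 c)"
      by (intro powr_mono) auto
    then show "2 powr (\<tau> * m) \<le> c"
      using assms by simp
  qed
  \<comment> \<open>\<open>K k\<close> collects \<theta> k times the bound required on \<kappa> /
    \<theta> k, without the powers of A and B.\<close>
  define K where "K k = dual_exp P p k * \<tau> * rh_const TYPE('n) / 2 * 2 powr (- (m - dual_exp P p k) / dual_exp P p k)" for k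
  define \<kappa>0 where "\<kappa>0 = Min (range K)"
  have K_pos: "0 < K k" for k
    using dual_exp_pos \<tau> rh_const_pos[where 'n='n] by (simp add: K_def)
  then have \<kappa>0: "0 < \<kappa>0" "\<kappa>0 \<le> K k" for k
    using K_pos by (auto simp: \<kappa>0_def)
  show thesis
  proof (rule that[OF \<kappa>0(1)])
    fix w :: "'m \<Rightarrow> real ^ 'n \<Rightarrow> real" and j and b :: "real ^ 'n \<Rightarrow> complex" and B \<kappa>
      and \<gamma> :: "complex \<Rightarrow> real" and G
    assume w: "w \<in> AP P p" and b: "b \<in> BMO" "BMO_norm b < ennreal B" "0 < B" and \<kappa>: "0 \<le> \<kappa>"
      "\<kappa> \<le> \<kappa>0 / (enn2real (AP_char P p w) powr \<mu> * B)"
      and \<gamma>: "\<And>y z. \<bar>\<gamma> y - \<gamma> z\<bar> \<le> \<kappa> * norm (y - z)" and G: "\<And>y. \<gamma> y \<le> G"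
    define A where "A = enn2real (AP_char P p w)"
    interpret dual_weights "dual_family P p w" "dual_exp P p" m A
      unfolding A_def m_def by (rule dual_weights_AP[OF w])
    let ?w = "w(j := \<lambda>x. w j x * exp (P j * \<gamma> (b x)))"
    have w0: "0 \<le> w i x" for i x
      using w by (auto simp: AP_def weight_def)
    have bm: "b \<in> borel_measurable lebesgue"
      using b(1) by (auto simp: BMO_def intro: locally_integrable_measurable)
    have "continuous_on UNIV \<gamma>"
    proof -
      have "\<kappa>-lipschitz_on UNIV \<gamma>"
        using \<gamma> \<kappa>(1) by (auto simp: lipschitz_on_def dist_norm)
      then show ?thesis
        by (rule lipschitz_on_continuous_on)
    qed
    then have \<gamma>m: "\<gamma> \<in> borel_measurable borel"
      by (rule borel_measurable_continuous_onI)
    have gm: "(\<lambda>x. \<gamma> (b x)) \<in> borel_measurable lebesgue"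
      using measurable_compose[OF bm \<gamma>m] .
    have \<kappa>_le: "\<kappa> / dual_exp P p k \<le> \<tau> * (rh_const TYPE('n) * \<beta> k) / (2 * B)" for k
    proof -
      \<comment> \<open>As A \<ge> 1, the single power A^\<mu> dominates all the powers
        A^(1/\<theta> k) coming from \<open>\<beta> k\<close>.\<close>
      have "A powr (1 / dual_exp P p k) \<le> A powr \<mu>"
        using one_le_A inverse_dual_exp_le[of k] by (intro powr_mono) auto
      then have "K k / (A powr \<mu> * B) \<le> K k / (A powr (1 / dual_exp P p k) * B)"
        using K_pos[of k] b(3) one_le_A by (intro divide_left_mono mult_right_mono mult_pos_pos) auto
      moreover have "\<kappa> \<le> K k / (A powr \<mu> * B)"
        using \<kappa>(2) \<kappa>0(2)[of k] b(3) unfolding A_def[symmetric]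
        by (meson divide_right_mono mult_nonneg_nonneg order_trans powr_ge_zero less_imp_le)
      ultimately have "\<kappa> \<le> K k / (A powr (1 / dual_exp P p k) * B)"
        by linarith
      also have "\<dots> = dual_exp P p k * (\<tau> * (rh_const TYPE('n) * \<beta> k) / (2 * B))"
        by (simp add: K_def \<beta>_def powr_minus field_simps)
      finally show ?thesis
        using dual_exp_pos[of k] by (simp add: pos_divide_le_eq mult.commute)
    qed
    have char: "AP_char P p ?w \<le> ennreal (c * A)"
      unfolding AP_char_eq_dual_family
    proof (rule SUP_least)
      fix Q :: "(real ^ 'n) set" assume Q: "Q \<in> cubes"
      have "(\<Prod>k\<in>UNIV. ennpow (nn_avg Q (dual_family P p ?w k)) (dual_exp P p k)) \<le> ennreal (2 powr (\<tau> * m) * A)"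
        unfolding dual_family_update[of w j "\<lambda>x. \<gamma> (b x)", OF w0]
        by (rule perturbed_char_le[OF Q bm b(2,3) \<tau>(1,2) \<kappa>(1) \<kappa>_le gm \<gamma>])
          (auto simp: sum_UNIV_option)
      also have "\<dots> \<le> ennreal (c * A)"
        using \<tau> A_nonneg by (intro ennreal_leI mult_right_mono)
      finally show "(\<Prod>k\<in>UNIV. ennpow (nn_avg Q (dual_family P p ?w k)) (dual_exp P p k)) \<le> ennreal (c * A)" .
    qed
    have "weight (?w i)" for i
    proof (cases "i = j")
      case True
      have "set_integrable lebesgue K (\<lambda>x. w j x * exp (P j * \<gamma> (b x)))" if "compact K" for K
      proof (rule set_integrable_bound)
        have "set_integrable lebesgue K (w j)"
          using w that by (auto simp: AP_def weight_def locally_integrable_def)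
        then show "set_integrable lebesgue K (\<lambda>x. exp (P j * G) * w j x)"
          by (rule set_integrable_mult_right)
        have [measurable]: "K \<in> sets lebesgue"
          using that by (simp add: compact_imp_closed)
        show "set_borel_measurable lebesgue K (\<lambda>x. w j x * exp (P j * \<gamma> (b x)))"
          unfolding set_borel_measurable_def using gm AP_measurable[OF w, of j] by measurable
        have "w j x * exp (P j * \<gamma> (b x)) \<le> w j x * exp (P j * G)" for x
          using w0[of j x] P[of j] G by (intro mult_left_mono) auto
        then show "AE x in lebesgue. x \<in> K \<longrightarrow> norm (w j x * exp (P j * \<gamma> (b x))) \<le> norm (exp (P j * G) * w j x)"
          using w0 by (auto simp: abs_mult mult.commute)
      qed
      then show ?thesis
        using w0 by (auto simp: weight_def locally_integrable_def True)
    qed (use w in \<open>auto simp: AP_def\<close>)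
    moreover have "AE x in lebesgue. 0 < ?w i x" for i
      using AP_AE_pos[OF w] by eventually_elim (auto simp: fun_upd_def)
    moreover have "AP_char P p ?w < top"
      using char by (rule le_less_trans) simp
    ultimately show "?w \<in> AP P p \<and> AP_char P p ?w \<le> ennreal (c * enn2real (AP_char P p w))"
      using char by (simp add: AP_def A_def)
  qed
qed

end

section \<open>Circle averages and weighted Lebesgue spaces\<close>

lemma Lp_norm_le_iff:
  assumes "0 < q" "0 \<le> K"
  shows "Lp_norm q w f \<le> ennreal K
    \<longleftrightarrow> (\<integral>\<^sup>+x. ennreal (norm (f x) powr q * w x) \<partial>lebesgue) \<le> ennreal (K powr q)"
proof -
  have "x powr (1 / q) \<le> K \<longleftrightarrow> x \<le> K powr q" if "0 \<le> x" for x
  proof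
    assume "x powr (1 / q) \<le> K"
    then have "(x powr (1 / q)) powr q \<le> K powr q"
      using assms by (intro powr_mono2) auto
    then show "x \<le> K powr q"
      using assms that by (simp add: powr_powr)
  next
    assume "x \<le> K powr q"
    then have "x powr (1 / q) \<le> (K powr q) powr (1 / q)"
      using assms that by (intro powr_mono2) auto
    then show "x powr (1 / q) \<le> K"
      using assms by (simp add: powr_powr)
  qed
  then have "ennpow X (1 / q) \<le> ennreal K \<longleftrightarrow> X \<le> ennreal (K powr q)" for X
    using assms by (cases X) (auto simp: ennpow_ennreal ennpow_def top_unique)
  then show ?thesis
    by (simp add: Lp_norm_def)
qed

lemma Lp_norm_finite:
  assumes "f \<in> Lp q w"
  shows "Lp_norm q w f = ennreal (enn2real (Lp_norm q w f))"
  using assms by (simp add: Lp_def)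

lemma Lp_domination:
  assumes f: "f \<in> Lp q w" and q: "0 < q" and M: "0 \<le> M" and h: "h \<in> borel_measurable lebesgue"
    and w: "w \<in> borel_measurable lebesgue"
    and le: "\<And>x. norm (h x) powr q * w' x \<le> M powr q * (norm (f x) powr q * w x)"
  shows "h \<in> Lp q w'" "Lp_norm q w' h \<le> ennreal (M * enn2real (Lp_norm q w f))"
proof -
  define K where "K = enn2real (Lp_norm q w f)"
  have K: "0 \<le> K" "Lp_norm q w f \<le> ennreal K"
    using Lp_norm_finite[OF f] by (auto simp: K_def)
  have [measurable]: "f \<in> borel_measurable lebesgue" "w \<in> borel_measurable lebesgue"
    using f w by (auto simp: Lp_def)
  have "(\<integral>\<^sup>+x. ennreal (norm (h x) powr q * w' x) \<partial>lebesgue)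
      \<le> (\<integral>\<^sup>+x. ennreal (M powr q) * ennreal (norm (f x) powr q * w x) \<partial>lebesgue)"
    by (intro nn_integral_mono) (use le in \<open>auto simp: ennreal_mult'[symmetric] intro!: ennreal_leI\<close>)
  also have "\<dots> = ennreal (M powr q) * (\<integral>\<^sup>+x. ennreal (norm (f x) powr q * w x) \<partial>lebesgue)"
    by (intro nn_integral_cmult) measurable
  also have "\<dots> \<le> ennreal (M powr q) * ennreal (K powr q)"
    using K q by (intro mult_left_mono) (auto simp: Lp_norm_le_iff)
  also have "\<dots> = ennreal ((M * K) powr q)"
    using M K by (simp add: powr_mult ennreal_mult')
  finally show le': "Lp_norm q w' h \<le> ennreal (M * enn2real (Lp_norm q w f))"
    using M K q unfolding K_def[symmetric] by (simp add: Lp_norm_le_iff)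
  show "h \<in> Lp q w'"
    using h le_less_trans[OF le' ennreal_less_top] by (simp add: Lp_def)
qed

text \<open>The p-th powers of the norms are summable, so the sum of |F_n|^p v has finite integral
  and is finite almost everywhere. Its terms then tend to 0, and v > 0 can be divided out.\<close>

lemma geometric_Lp_decay_AE:
  fixes F :: "nat \<Rightarrow> real ^ 'n \<Rightarrow> complex"
  assumes p: "0 < p" and D: "0 \<le> D" and v: "v \<in> borel_measurable lebesgue" "AE x in lebesgue. 0 < v x"
    and F: "\<And>n. F n \<in> borel_measurable lebesgue" "\<And>n. Lp_norm p v (F n) \<le> ennreal ((1 / 2) ^ n * D)"
  shows "AE x in lebesgue. (\<lambda>n. F n x) \<longlonglongrightarrow> 0"
proof -
  note [measurable] = v(1) F(1)
  define X where "X n x = norm (F n x) powr p * v x" for n x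
  have [measurable]: "X n \<in> borel_measurable lebesgue" for n
    unfolding X_def by measurable
  have r: "0 < (1 / 2 :: real) powr p" "(1 / 2 :: real) powr p < 1"
    using p powr_less_mono2[of p "1 / 2" 1] by auto
  have "(\<integral>\<^sup>+x. ennreal (X n x) \<partial>lebesgue) \<le> ennreal (D powr p * ((1 / 2) powr p) ^ n)" for n
  proof -
    have "(\<integral>\<^sup>+x. ennreal (X n x) \<partial>lebesgue) \<le> ennreal (((1 / 2) ^ n * D) powr p)"
      unfolding X_def using F(2)[of n] p D by (subst (asm) Lp_norm_le_iff) auto
    also have "((1 / 2) ^ n * D) powr p = D powr p * ((1 / 2) powr p) ^ n"
      using D by (simp add: powr_mult powr_realpow[symmetric] powr_powr mult.commute)
    finally show ?thesis .
  qed
  then have "(\<Sum>n. \<integral>\<^sup>+x. ennreal (X n x) \<partial>lebesgue) \<le> (\<Sum>n. ennreal (D powr p * ((1 / 2) powr p) ^ n))"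
    by (intro suminf_le) auto
  also have "\<dots> = ennreal (\<Sum>n. D powr p * ((1 / 2) powr p) ^ n)"
    using r by (intro suminf_ennreal2 summable_mult summable_geometric) auto
  also have "\<dots> < \<infinity>"
    by simp
  finally have "(\<integral>\<^sup>+x. (\<Sum>n. ennreal (X n x)) \<partial>lebesgue) < \<infinity>"
    by (subst nn_integral_suminf) auto
  then have "AE x in lebesgue. (\<Sum>n. ennreal (X n x)) \<noteq> \<infinity>"
    by (intro nn_integral_PInf_AE) auto
  then show ?thesis
    using v(2)
  proof eventually_elim
    case (elim x)
    have X0: "0 \<le> X n x" for n
      using elim by (simp add: X_def)
    have "summable (\<lambda>n. X n x)"
      using elim X0 by (intro summable_suminf_not_top) auto
    then have "(\<lambda>n. X n x) \<longlonglongrightarrow> 0"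
      by (rule summable_LIMSEQ_zero)
    then have "(\<lambda>n. X n x / v x) \<longlonglongrightarrow> 0"
      by (rule tendsto_divide_zero)
    then have "(\<lambda>n. (X n x / v x) powr (1 / p)) \<longlonglongrightarrow> 0"
      using X0 elim p by (intro tendsto_zero_powrI[OF _ tendsto_const]) (auto intro!: always_eventually)
    moreover have "(X n x / v x) powr (1 / p) = norm (F n x)" for n
      using elim p by (simp add: X_def powr_powr)
    ultimately show ?case
      by (simp add: tendsto_norm_zero_iff)
  qed
qed

section \<open>A discrete Cauchy formula\<close>

definition circle_pt :: "real \<Rightarrow> nat \<Rightarrow> nat \<Rightarrow> complex" where
  "circle_pt \<delta> N l = of_real \<delta> * cis (2 * pi * real l / real N)"

lemma norm_circle_pt: "0 \<le> \<delta> \<Longrightarrow> norm (circle_pt \<delta> N l) = \<delta>"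
  by (simp add: circle_pt_def norm_mult)

text \<open>A geometric sum with ratio z \<noteq> 1 and z^N = 1. The frequency is an integer because
  the k-th coefficient is paired with k - 1, which is -1 for k = 0.\<close>

lemma sum_roots_of_unity:
  assumes "0 < N" "\<not> int N dvd k"
  shows "(\<Sum>l<N. cis (2 * pi * real l * real_of_int k / real N)) = 0"
proof -
  define z where "z = cis (2 * pi * real_of_int k / real N)"
  have zl: "cis (2 * pi * real l * real_of_int k / real N) = z ^ l" for l
  proof -
    have "z ^ l = cis (real l * (2 * pi * real_of_int k / real N))"
      unfolding z_def by (rule Complex.DeMoivre)
    then show ?thesis
      by (simp add: mult_ac)
  qed
  have "z \<noteq> 1"
  proof
    assume "z = 1"
    then have "cos (2 * pi * real_of_int k / real N) = 1"
      by (simp add: z_def complex_eq_iff)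
    then obtain i :: int where "2 * pi * real_of_int k / real N = real_of_int i * 2 * pi"
      by (auto simp: cos_one_2pi_int)
    then have "real_of_int k = real_of_int (i * int N)"
      using assms by (simp add: field_simps)
    then have "k = i * int N"
      by (simp only: of_int_eq_iff)
    then show False
      using assms by simp
  qed
  moreover have "z ^ N = 1"
  proof -
    have "z ^ N = cis (2 * pi * real_of_int k)"
      using assms by (simp add: z_def Complex.DeMoivre)
    also have "\<dots> = 1"
      by (simp add: cis_multiple_2pi)
    finally show ?thesis .
  qed
  ultimately show ?thesis
    using sum_gp_strict[of z N] by (simp add: zl)
qed

text \<open>A discrete Cauchy formula: the circle averages pick up the coefficients \<open>d k\<close> with \<open>k \<equiv> 1 (mod N)\<close>.\<close>

lemma circle_average_tendsto:
  fixes d :: "nat \<Rightarrow> complex"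
  assumes \<delta>: "0 < \<delta>" and sm: "summable (\<lambda>k. norm (d k) * \<delta> ^ k)"
    and H: "\<And>z. norm z = \<delta> \<Longrightarrow> (\<lambda>k. d k * z ^ k) sums H z"
  shows "(\<lambda>N. (\<Sum>l<Suc N. H (circle_pt \<delta> (Suc N) l) / circle_pt \<delta> (Suc N) l) / of_nat (Suc N)) \<longlonglongrightarrow> d 1"
proof -
  define e where "e k N = (\<Sum>l<Suc N. cis (2 * pi * real l * real_of_int (int k - 1) / real (Suc N))) / of_nat (Suc N)" for k N
  define a where "a k N = d k * of_real (\<delta> powi (int k - 1)) * e k N" for k N
  have avg: "(\<Sum>l<Suc N. H (circle_pt \<delta> (Suc N) l) / circle_pt \<delta> (Suc N) l) / of_nat (Suc N) = (\<Sum>k. a k N)" for N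
  proof -
    let ?z = "circle_pt \<delta> (Suc N)"
    have nz: "?z l \<noteq> 0" for l
      using \<delta> norm_circle_pt[of \<delta> "Suc N" l] by auto
    have "(\<lambda>k. (\<Sum>l<Suc N. d k * ?z l ^ k / ?z l) / of_nat (Suc N)) sums
        ((\<Sum>l<Suc N. H (?z l) / ?z l) / of_nat (Suc N))"
      using \<delta> by (intro sums_divide sums_sum H) (simp add: norm_circle_pt)
    moreover have "(\<Sum>l<Suc N. d k * ?z l ^ k / ?z l) / of_nat (Suc N) = a k N" for k
    proof -
      have "d k * ?z l ^ k / ?z l = d k * of_real (\<delta> powi (int k - 1)) * cis (2 * pi * real l * real_of_int (int k - 1) / real (Suc N))" for l
      proof -
        have "?z l ^ k / ?z l = ?z l powi (int k - 1)"
          using nz[of l] by (simp add: power_int_diff)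
        also have "\<dots> = of_real (\<delta> powi (int k - 1)) * cis (2 * pi * real l / real (Suc N)) powi (int k - 1)"
          by (simp only: circle_pt_def power_int_mult_distrib of_real_power_int)
        also have "cis (2 * pi * real l / real (Suc N)) powi (int k - 1) = cis (2 * pi * real l * real_of_int (int k - 1) / real (Suc N))"
          unfolding cis_power_int by (simp add: mult_ac)
        finally show ?thesis
          by (simp add: mult.assoc times_divide_eq_right[symmetric] del: times_divide_eq_right)
      qed
      then show ?thesis
        by (simp only: a_def e_def sum_distrib_left[symmetric] times_divide_eq_right)
    qed
    ultimately show ?thesis
      by (simp add: sums_iff)
  qed
  have e_le: "norm (e k N) \<le> 1" for k N
  proof -
    have "norm (\<Sum>l<Suc N. cis (2 * pi * real l * real_of_int (int k - 1) / real (Suc N))) \<le> (\<Sum>l<Suc N. 1)"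
      by (rule order_trans[OF norm_sum]) simp
    then show ?thesis
      by (simp add: e_def norm_divide divide_le_eq del: of_nat_Suc sum.lessThan_Suc)
  qed
  \<comment> \<open>For fixed k \<noteq> 1 aliasing ends once N + 1 exceeds |k - 1|, so the term is
    eventually 0.\<close>
  have lim: "(\<lambda>N. a k N) \<longlonglongrightarrow> (if k = 1 then d 1 else 0)" for k
  proof (rule tendsto_eventually)
    show "\<forall>\<^sub>F N in sequentially. a k N = (if k = 1 then d 1 else 0)"
      using eventually_ge_at_top[of "k + 1"]
    proof eventually_elim
      case (elim N)
      show ?case
      proof (cases "k = 1")
        case True
        then show ?thesis
        proof -
          have "(\<Sum>l<Suc N. cis (2 * pi * real l * real_of_int (int 1 - 1) / real (Suc N))) = of_nat (Suc N)"
            by simp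
          then have "e 1 N = 1"
            unfolding e_def by (simp only: of_nat_neq_0 divide_self not_False_eq_True)
          then show ?thesis
            by (simp add: a_def True)
        qed
      next
        case False
        have "\<not> int (Suc N) dvd int k - 1"
        proof
          assume "int (Suc N) dvd int k - 1"
          then have "int (Suc N) \<le> \<bar>int k - 1\<bar>"
            using False by (intro zdvd_imp_le) (auto simp: dvd_abs_iff)
          then show False
            using elim by linarith
        qed
        then have "e k N = 0"
          unfolding e_def by (subst sum_roots_of_unity) auto
        then show ?thesis
          using False by (simp add: a_def)
      qed
    qed
  qed
  have "norm (a k N) \<le> norm (d k) * \<delta> ^ k / \<delta>" for k N
  proof -
    have "norm (a k N) = norm (d k) * (\<delta> ^ k / \<delta>) * norm (e k N)"
      using \<delta> by (simp add: a_def norm_mult norm_divide norm_power power_int_diff)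
    also have "\<dots> \<le> norm (d k) * (\<delta> ^ k / \<delta>) * 1"
      using e_le \<delta> by (intro mult_left_mono) auto
    finally show ?thesis
      by simp
  qed
  \<comment> \<open>Tannery's theorem, with the majorant |d_k| \<delta>^(k-1), interchanges the
    limit in N with the sum over k.\<close>
  then have "(\<lambda>N. \<Sum>k. a k N) \<longlonglongrightarrow> (\<Sum>k. if k = 1 then d 1 else 0)"
    using tannerys_theorem[of a "\<lambda>k. if k = 1 then d 1 else 0" sequentially "\<lambda>k. norm (d k) * \<delta> ^ k / \<delta>", OF lim]
      summable_divide[OF sm, of \<delta>] by (auto intro: always_eventually)
  moreover have "(\<lambda>k. if k = 1 then d 1 else 0) sums d 1"
    using sums_single[of 1 d] by (simp add: if_distrib cong: if_cong)
  ultimately show ?thesis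
    unfolding avg by (simp add: sums_iff)
qed

text \<open>To be read at a fixed point x: \<beta> is b x, and a k are the coefficients of T(...,
  e^(-zb) f_j, ...) at x. In the Cauchy product with e^(z \<beta>) the coefficient of z is \<beta>
  a_0 + a_1, the commutator. The expansion of \<open>E\<close> is assumed only on \<open>Z\<close>,
  so \<open>H\<close> is defined by the series on the whole circle.\<close>

lemma circle_average_exp_tendsto:
  fixes a :: "nat \<Rightarrow> complex"
  assumes \<delta>: "0 < \<delta>" and sm: "summable (\<lambda>k. norm (a k) * \<delta> ^ k)"
    and E: "\<And>z. norm z = \<delta> \<Longrightarrow> z \<in> Z \<Longrightarrow> (\<lambda>k. a k * z ^ k) sums E z"
    and Z: "\<And>N l. circle_pt \<delta> N l \<in> Z"
  shows "(\<lambda>N. (\<Sum>l<Suc N. exp (circle_pt \<delta> (Suc N) l * \<beta>) * E (circle_pt \<delta> (Suc N) l) / circle_pt \<delta> (Suc N) l)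
      / of_nat (Suc N)) \<longlonglongrightarrow> \<beta> * a 0 + a 1"
proof -
  define d where "d k = (\<Sum>i\<le>k. \<beta> ^ i / fact i * a (k - i))" for k
  define H where "H z = exp (z * \<beta>) * (\<Sum>k. a k * z ^ k)" for z
  have coeff: "(\<Sum>i\<le>k. (\<beta> ^ i / fact i * z ^ i) * (a (k - i) * z ^ (k - i))) = d k * z ^ k" for k z
  proof -
    have "(\<beta> ^ i / fact i * z ^ i) * (a (k - i) * z ^ (k - i)) = \<beta> ^ i / fact i * a (k - i) * z ^ k" if "i \<le> k" for i
    proof -
      have "z ^ k = z ^ i * z ^ (k - i)"
        using that by (simp flip: power_add)
      then show ?thesis
        by simp
    qed
    then show ?thesis
      unfolding d_def sum_distrib_right by (intro sum.cong) auto
  qed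
  have exp_sum: "(\<lambda>i. \<beta> ^ i / fact i * z ^ i) sums exp (z * \<beta>)" for z
    using exp_converges[of "z * \<beta>"] by (simp add: power_mult_distrib scaleR_conv_of_real field_simps)
  have exp_norm: "summable (\<lambda>i. norm (\<beta> ^ i / fact i * z ^ i))" for z
    using summable_norm_exp[of "z * \<beta>"] by (simp add: power_mult_distrib scaleR_conv_of_real field_simps norm_mult norm_divide norm_power)
  have H: "(\<lambda>k. d k * z ^ k) sums H z" if "norm z = \<delta>" for z
  proof -
    have "summable (\<lambda>k. norm (a k * z ^ k))"
      using sm that by (simp add: norm_mult norm_power)
    from Cauchy_product_sums[OF exp_norm[of z] this] show ?thesis
      unfolding coeff H_def sums_unique[OF exp_sum[of z]] .
  qed
  have "summable (\<lambda>k. norm (d k) * \<delta> ^ k)"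
  proof -
    have "summable (\<lambda>k. norm (norm (a k) * \<delta> ^ k))" "summable (\<lambda>i. norm (norm (\<beta> ^ i / fact i * of_real \<delta> ^ i)))"
      using sm exp_norm[of "of_real \<delta>"] \<delta> by simp_all
    from summable_Cauchy_product[OF this(2,1)]
    have s: "summable (\<lambda>k. \<Sum>i\<le>k. norm (\<beta> ^ i / fact i * of_real \<delta> ^ i) * (norm (a (k - i)) * \<delta> ^ (k - i)))" .
    show ?thesis
    proof (rule summable_comparison_test'[OF s, of 0])
      fix k
      have "norm (norm (d k) * \<delta> ^ k) = norm (d k * of_real \<delta> ^ k)"
        using \<delta> by (simp add: norm_mult norm_power)
      also have "\<dots> \<le> (\<Sum>i\<le>k. norm ((\<beta> ^ i / fact i * of_real \<delta> ^ i) * (a (k - i) * of_real \<delta> ^ (k - i))))"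
        unfolding coeff[symmetric] by (rule norm_sum)
      also have "\<dots> = (\<Sum>i\<le>k. norm (\<beta> ^ i / fact i * of_real \<delta> ^ i) * (norm (a (k - i)) * \<delta> ^ (k - i)))"
        using \<delta> by (intro sum.cong refl) (simp add: norm_mult norm_power norm_divide)
      finally show "norm (norm (d k) * \<delta> ^ k) \<le> \<dots>" .
    qed
  qed
  from circle_average_tendsto[OF \<delta> this H]
  have "(\<lambda>N. (\<Sum>l<Suc N. H (circle_pt \<delta> (Suc N) l) / circle_pt \<delta> (Suc N) l) / of_nat (Suc N)) \<longlonglongrightarrow> d 1" .
  moreover have "H (circle_pt \<delta> N l) = exp (circle_pt \<delta> N l * \<beta>) * E (circle_pt \<delta> N l)" for N l
    using E[of "circle_pt \<delta> N l"] Z norm_circle_pt[of \<delta> N l] \<delta> by (simp add: H_def sums_iff)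
  moreover have "d 1 = \<beta> * a 0 + a 1"
    by (simp add: d_def)
  ultimately show ?thesis
    by simp
qed

section \<open>Remainders of the exponential series\<close>

definition exp_tail :: "nat \<Rightarrow> complex \<Rightarrow> complex" where
  "exp_tail n y = exp y - (\<Sum>k<n. y ^ k / fact k)"

lemma exp_tail_0: "exp_tail 0 = exp"
  by (simp add: exp_tail_def fun_eq_iff)

lemma exp_tail_Suc: "exp_tail n y = y ^ n / fact n + exp_tail (Suc n) y"
  by (simp add: exp_tail_def)

text \<open>Geometric decay is bought by doubling the exponent: r^k / k! is 2^(-k) (2r)^k / k!, and
  k \<ge> n in the tail. This is why later conditions read 2 |z| \<le> \<kappa>.\<close>

lemma norm_exp_tail_le: "norm (exp_tail n y) \<le> (1 / 2) ^ n * exp (2 * norm y)"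
proof -
  let ?r = "norm y"
  have sm: "summable (\<lambda>k. inverse (fact (k + n)) * (2 * ?r) ^ (k + n) :: real)"
    using summable_exp[of "2 * ?r"] by (subst summable_iff_shift)
  have "exp_tail n y = (\<Sum>k. inverse (fact (k + n)) *\<^sub>R y ^ (k + n))"
    unfolding exp_tail_def using exp_first_terms[of y n] by (simp add: scaleR_conv_of_real field_simps)
  also have "norm \<dots> \<le> (\<Sum>k. (1 / 2) ^ n * (inverse (fact (k + n)) * (2 * ?r) ^ (k + n)))"
  proof (rule norm_suminf_le)
    fix k
    have "norm (inverse (fact (k + n)) *\<^sub>R y ^ (k + n)) = (1 / 2) ^ (k + n) * (inverse (fact (k + n)) * (2 * ?r) ^ (k + n))"
      by (simp add: norm_power power_mult_distrib power_divide)
    also have "\<dots> \<le> (1 / 2) ^ n * (inverse (fact (k + n)) * (2 * ?r) ^ (k + n))"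
      by (intro mult_right_mono power_decreasing) auto
    finally show "norm (inverse (fact (k + n)) *\<^sub>R y ^ (k + n)) \<le> \<dots>" .
  qed (use sm in \<open>simp add: summable_mult\<close>)
  also have "\<dots> = (1 / 2) ^ n * (\<Sum>k. inverse (fact (k + n)) * (2 * ?r) ^ (k + n))"
    by (rule suminf_mult[OF sm])
  also have "(\<Sum>k. inverse (fact (k + n)) * (2 * ?r) ^ (k + n)) \<le> exp (2 * ?r)"
  proof -
    have "exp (2 * ?r) = (\<Sum>k<n. inverse (fact k) * (2 * ?r) ^ k) + (\<Sum>k. inverse (fact (k + n)) * (2 * ?r) ^ (k + n))"
      using exp_first_terms[of "2 * ?r" n] by simp
    moreover have "0 \<le> (\<Sum>k<n. inverse (fact k) * (2 * ?r) ^ k :: real)"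
      by (intro sum_nonneg) auto
    ultimately show ?thesis
      by linarith
  qed
  finally show ?thesis
    by (simp add: mult_left_mono)
qed

lemma power_le_exp:
  fixes r :: real
  assumes "0 \<le> r" "0 < \<kappa>"
  shows "r ^ k \<le> fact k / \<kappa> ^ k * exp (\<kappa> * r)"
proof -
  have "(\<kappa> * r) ^ k / fact k \<le> (\<Sum>i\<in>{..<Suc k}. (\<kappa> * r) ^ i / fact i)"
    using assms by (intro member_le_sum) auto
  also have "\<dots> \<le> exp (\<kappa> * r)"
  proof -
    have "exp (\<kappa> * r) = (\<Sum>i<Suc k. inverse (fact i) * (\<kappa> * r) ^ i) + (\<Sum>i. inverse (fact (i + Suc k)) * (\<kappa> * r) ^ (i + Suc k))"
      using exp_first_terms[of "\<kappa> * r" "Suc k"] by simp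
    moreover have "0 \<le> (\<Sum>i. inverse (fact (i + Suc k)) * (\<kappa> * r) ^ (i + Suc k))"
    proof (rule suminf_nonneg)
      show "summable (\<lambda>i. inverse (fact (i + Suc k)) * (\<kappa> * r) ^ (i + Suc k))"
        using summable_exp[of "\<kappa> * r"] by (subst summable_iff_shift)
    qed (use assms in auto)
    ultimately show ?thesis
      by (simp add: field_simps)
  qed
  finally show ?thesis
    using assms by (simp add: power_mult_distrib field_simps)
qed

section \<open>Commutators\<close>

text \<open>All constants are absorbed into \<phi>, so that taking a commutator turns one such bound
  into another. Membership in \<open>Lp\<close> also records measurability of the values, which the
  next commutator relies on.\<close>

definition weighted_bound ::
  "('m::finite \<Rightarrow> real) \<Rightarrow> real \<Rightarrow> (('m \<Rightarrow> real ^ 'n \<Rightarrow> complex) \<Rightarrow> real ^ 'n \<Rightarrow> complex) \<Rightarrow> (real \<Rightarrow> real) \<Rightarrow> bool" where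
  "weighted_bound P p T \<phi> \<longleftrightarrow>
     (\<forall>w\<in>AP P p. \<forall>f. (\<forall>j. f j \<in> Lp (P j) (w j)) \<longrightarrow>
       T f \<in> Lp p (nu P p w) \<and>
       Lp_norm p (nu P p w) (T f)
         \<le> ennreal (\<phi> (enn2real (AP_char P p w))) * (\<Prod>j\<in>UNIV. Lp_norm (P j) (w j) (f j)))"

text \<open>Here \<kappa> is a Lipschitz constant admissible for the given w in the sense of
  \<open>perturb\<close>; through \<open>AP_perturb\<close> it will depend on the characteristic of
  w and on the norm of b.\<close>

locale commutator_step = exponents P p
  for P :: "'m::finite \<Rightarrow> real" and p :: real +
  fixes T :: "('m \<Rightarrow> real ^ 'n \<Rightarrow> complex) \<Rightarrow> real ^ 'n \<Rightarrow> complex"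
    and \<phi> :: "real \<Rightarrow> real" and w :: "'m \<Rightarrow> real ^ 'n \<Rightarrow> real" and j :: 'm
    and b :: "real ^ 'n \<Rightarrow> complex" and \<kappa> c :: real
  assumes T_lin: "multilinear_op P p T" and T_bound: "weighted_bound P p T \<phi>"
    and \<phi>_mono: "mono_on {1..} \<phi>" and \<phi>_nonneg: "\<And>t. 1 \<le> t \<Longrightarrow> 0 \<le> \<phi> t"
    and w: "w \<in> AP P p" and b_meas [measurable]: "b \<in> borel_measurable lebesgue" and \<kappa>: "0 < \<kappa>" and c: "1 \<le> c"
    and perturb: "\<And>\<gamma> G. \<lbrakk>\<And>y z. \<bar>\<gamma> y - \<gamma> z\<bar> \<le> \<kappa> * norm (y - z); \<And>y. \<gamma> y \<le> G\<rbrakk> \<Longrightarrow>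
      w(j := \<lambda>x. w j x * exp (P j * \<gamma> (b x))) \<in> AP P p \<and>
      AP_char P p (w(j := \<lambda>x. w j x * exp (P j * \<gamma> (b x)))) \<le> ennreal (c * enn2real (AP_char P p w))"
begin

text \<open>The common smaller weight, small enough that the factors b^k and e^(-zb) with 2 |z|
  \<le> \<kappa> send f_j into its space. Almost everywhere identities proved with it hold in
  Lebesgue measure, hence also for w.\<close>

definition small_w :: "'m \<Rightarrow> real ^ 'n \<Rightarrow> real" where
  "small_w = w(j := \<lambda>x. w j x * exp (P j * (- \<kappa> * norm (b x))))"

definition tup :: "('m \<Rightarrow> real ^ 'n \<Rightarrow> complex) \<Rightarrow> (real ^ 'n \<Rightarrow> complex) \<Rightarrow> 'm \<Rightarrow> real ^ 'n \<Rightarrow> complex" where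
  "tup f h = f(j := \<lambda>x. h x * f j x)"

text \<open>Such multipliers act from \<open>Lp (P j) (w j)\<close> to
  \<open>Lp (P j) (small_w j)\<close> with norm at most M.\<close>

definition mult_bound :: "real \<Rightarrow> (real ^ 'n \<Rightarrow> complex) \<Rightarrow> bool" where
  "mult_bound M h \<longleftrightarrow> 0 \<le> M \<and> h \<in> borel_measurable lebesgue \<and> (\<forall>x. norm (h x) \<le> M * exp (\<kappa> * norm (b x)))"

definition F :: "('m \<Rightarrow> real ^ 'n \<Rightarrow> complex) \<Rightarrow> 'm \<Rightarrow> real" where
  "F f i = enn2real (Lp_norm (P i) (w i) (f i))"

lemma small_w_AP: "small_w \<in> AP P p"
proof -
  have "\<bar>- \<kappa> * norm y - - \<kappa> * norm z\<bar> \<le> \<kappa> * norm (y - z)" for y z :: complex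
  proof -
    have "- \<kappa> * norm y - - \<kappa> * norm z = - (\<kappa> * (norm y - norm z))"
      by (simp add: algebra_simps)
    then show ?thesis
      using \<kappa> norm_triangle_ineq3[of y z] by (simp add: abs_mult mult_left_mono)
  qed
  then show ?thesis
    unfolding small_w_def using perturb[of "\<lambda>y. - \<kappa> * norm y" 0] \<kappa> by simp
qed

lemma w_nonneg: "0 \<le> w i x"
  using w by (auto simp: AP_def weight_def)

lemma P_pos: "0 < P i"
  using P[of i] by simp

lemma mult_Lp:
  assumes h: "mult_bound M h" and f: "f \<in> Lp (P j) (w j)"
  shows "(\<lambda>x. h x * f x) \<in> Lp (P j) (small_w j)"
    "Lp_norm (P j) (small_w j) (\<lambda>x. h x * f x) \<le> ennreal (M * enn2real (Lp_norm (P j) (w j) f))"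
proof -
  have M: "0 \<le> M" and hm: "h \<in> borel_measurable lebesgue" and hb: "norm (h x) \<le> M * exp (\<kappa> * norm (b x))" for x
    using h by (auto simp: mult_bound_def)
  have meas: "(\<lambda>x. h x * f x) \<in> borel_measurable lebesgue"
    using hm f by (auto simp: Lp_def)
  have le: "norm (h x * f x) powr P j * small_w j x \<le> M powr P j * (norm (f x) powr P j * w j x)" for x
  proof -
    have "norm (h x) powr P j \<le> (M * exp (\<kappa> * norm (b x))) powr P j"
      using hb P_pos[of j] by (intro powr_mono2) auto
    also have "\<dots> = M powr P j * exp (P j * (\<kappa> * norm (b x)))"
      using M by (simp add: powr_mult exp_powr_real mult.commute)
    finally have "norm (h x) powr P j * (norm (f x) powr P j * (w j x * exp (P j * (- \<kappa> * norm (b x)))))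
      \<le> M powr P j * exp (P j * (\<kappa> * norm (b x))) * (norm (f x) powr P j * (w j x * exp (P j * (- \<kappa> * norm (b x)))))"
      using w_nonneg by (intro mult_right_mono) auto
    also have "\<dots> = M powr P j * (norm (f x) powr P j * w j x) * (exp (P j * (\<kappa> * norm (b x))) * exp (P j * (- \<kappa> * norm (b x))))"
      by (simp only: mult_ac)
    also have "exp (P j * (\<kappa> * norm (b x))) * exp (P j * (- \<kappa> * norm (b x))) = 1"
      by (simp flip: exp_add)
    finally show ?thesis
      by (simp add: small_w_def norm_mult powr_mult mult.assoc)
  qed
  show "(\<lambda>x. h x * f x) \<in> Lp (P j) (small_w j)"
    "Lp_norm (P j) (small_w j) (\<lambda>x. h x * f x) \<le> ennreal (M * enn2real (Lp_norm (P j) (w j) f))"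
    using Lp_domination[OF f P_pos M meas AP_measurable[OF w] le] by auto
qed

lemma tup_Lp:
  assumes "mult_bound M h" "\<And>i. f i \<in> Lp (P i) (w i)"
  shows "tup f h i \<in> Lp (P i) (small_w i)"
  using mult_Lp(1)[OF assms] assms by (cases "i = j") (auto simp: tup_def small_w_def)

lemma prod_Lp_norm_tup_le:
  assumes f: "\<And>i. f i \<in> Lp (P i) (w i)" and M: "0 \<le> M"
    and le: "Lp_norm (P j) v (\<lambda>x. h x * f j x) \<le> ennreal (M * F f j)"
  shows "(\<Prod>i\<in>UNIV. Lp_norm (P i) ((w(j := v)) i) (tup f h i)) \<le> ennreal (M * (\<Prod>i\<in>UNIV. F f i))"
proof -
  have "(\<Prod>i\<in>UNIV. Lp_norm (P i) ((w(j := v)) i) (tup f h i)) \<le> (\<Prod>i\<in>UNIV. ennreal (if i = j then M * F f i else F f i))"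
    using le Lp_norm_finite[OF f] by (intro prod_mono_ennreal) (auto simp: tup_def F_def)
  also have "\<dots> = ennreal (\<Prod>i\<in>UNIV. if i = j then M * F f i else F f i)"
    using M by (intro prod_ennreal) (auto simp: F_def)
  also have "(\<Prod>i\<in>UNIV. if i = j then M * F f i else F f i) = (\<Prod>i\<in>UNIV. (if i = j then M else 1) * F f i)"
    by (intro prod.cong) auto
  also have "\<dots> = M * (\<Prod>i\<in>UNIV. F f i)"
    by (simp add: prod.distrib)
  finally show ?thesis .
qed

lemma T_tup_bound:
  assumes h: "mult_bound M h" and f: "\<And>i. f i \<in> Lp (P i) (w i)"
  shows "T (tup f h) \<in> Lp p (nu P p small_w)"
    "Lp_norm p (nu P p small_w) (T (tup f h))
      \<le> ennreal (M * (\<phi> (enn2real (AP_char P p small_w)) * (\<Prod>i\<in>UNIV. F f i)))"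
proof -
  have M: "0 \<le> M"
    using h by (simp add: mult_bound_def)
  have 1: "0 \<le> \<phi> (enn2real (AP_char P p small_w))"
    using small_w_AP by (intro \<phi>_nonneg one_le_AP_char)
  have *: "T (tup f h) \<in> Lp p (nu P p small_w) \<and> Lp_norm p (nu P p small_w) (T (tup f h))
         \<le> ennreal (\<phi> (enn2real (AP_char P p small_w))) * (\<Prod>i\<in>UNIV. Lp_norm (P i) (small_w i) (tup f h i))"
    using T_bound small_w_AP tup_Lp[OF h f] unfolding weighted_bound_def by blast
  then show "T (tup f h) \<in> Lp p (nu P p small_w)" ..
  have "(\<Prod>i\<in>UNIV. Lp_norm (P i) (small_w i) (tup f h i)) \<le> ennreal (M * (\<Prod>i\<in>UNIV. F f i))"
    using prod_Lp_norm_tup_le[OF f M, of "small_w j" h] mult_Lp(2)[OF h f]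
    by (simp add: small_w_def F_def)
  then have "ennreal (\<phi> (enn2real (AP_char P p small_w))) * (\<Prod>i\<in>UNIV. Lp_norm (P i) (small_w i) (tup f h i))
      \<le> ennreal (\<phi> (enn2real (AP_char P p small_w))) * ennreal (M * (\<Prod>i\<in>UNIV. F f i))"
    by (rule mult_left_mono) simp
  also have "\<dots> = ennreal (M * (\<phi> (enn2real (AP_char P p small_w)) * (\<Prod>i\<in>UNIV. F f i)))"
    by (subst ennreal_mult'[OF 1, symmetric]) (simp only: mult_ac)
  finally show "Lp_norm p (nu P p small_w) (T (tup f h))
      \<le> ennreal (M * (\<phi> (enn2real (AP_char P p small_w)) * (\<Prod>i\<in>UNIV. F f i)))"
    using * by (blast intro: order_trans)
qed

lemma T_tup_linear:
  assumes "mult_bound M1 h1" "mult_bound M2 h2" and f: "\<And>i. f i \<in> Lp (P i) (w i)"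
  shows "AE x in lebesgue. T (tup f (\<lambda>x. r * h1 x + s * h2 x)) x = r * T (tup f h1) x + s * T (tup f h2) x"
proof -
  have "AE x in lebesgue. T ((tup f h1)(j := \<lambda>y. r * tup f h1 j y + s * (h2 y * f j y))) x
      = r * T (tup f h1) x + s * T ((tup f h1)(j := \<lambda>y. h2 y * f j y)) x"
    using T_lin small_w_AP tup_Lp[OF assms(1) f] mult_Lp(1)[OF assms(2) f]
    unfolding multilinear_op_def by blast
  moreover have "(tup f h1)(j := \<lambda>y. r * tup f h1 j y + s * (h2 y * f j y)) = tup f (\<lambda>x. r * h1 x + s * h2 x)"
    by (auto simp: tup_def fun_eq_iff algebra_simps)
  moreover have "(tup f h1)(j := \<lambda>y. h2 y * f j y) = tup f h2"
    by (auto simp: tup_def fun_eq_iff)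
  ultimately show ?thesis
    by simp
qed

lemma mult_bound_power: "mult_bound (fact k / \<kappa> ^ k) (\<lambda>x. b x ^ k)"
  using \<kappa> power_le_exp[of _ \<kappa> k] by (auto simp: mult_bound_def norm_power)

lemma mult_bound_exp_tail:
  assumes "2 * norm z \<le> \<kappa>"
  shows "mult_bound ((1 / 2) ^ n) (\<lambda>x. exp_tail n (- z * b x))"
proof -
  have "norm (exp_tail n (- z * b x)) \<le> (1 / 2) ^ n * exp (\<kappa> * norm (b x))" for x
  proof -
    have "norm (exp_tail n (- z * b x)) \<le> (1 / 2) ^ n * exp (2 * norm (- z * b x))"
      by (rule norm_exp_tail_le)
    also have "2 * norm (- z * b x) = 2 * norm z * norm (b x)"
      by (simp add: norm_mult)
    also have "\<dots> \<le> \<kappa> * norm (b x)"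
      using assms by (intro mult_right_mono) auto
    finally show ?thesis
      by (simp add: mult_left_mono)
  qed
  then show ?thesis
    unfolding mult_bound_def exp_tail_def by auto
qed

text \<open>A substitute for continuity of \<open>T\<close> in its slot: linearity splits off the
  n-th term of the exponential series, for all n outside one null set. What remains is
  \<open>T\<close> applied to the n-th tail, of norm at most 2^(-n) D, so it tends to 0 almost
  everywhere.\<close>

lemma T_exp_series:
  assumes z: "2 * norm z \<le> \<kappa>" and f: "\<And>i. f i \<in> Lp (P i) (w i)"
  shows "AE x in lebesgue. (\<lambda>k. (- 1) ^ k / fact k * T (tup f (\<lambda>y. b y ^ k)) x * z ^ k) sums
    T (tup f (\<lambda>y. exp (- z * b y))) x"
proof -
  let ?h = "\<lambda>n y. exp_tail n (- z * b y)"
  define D where "D = \<phi> (enn2real (AP_char P p small_w)) * (\<Prod>i\<in>UNIV. F f i)"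
  have D: "0 \<le> D"
    unfolding D_def using small_w_AP
    by (intro mult_nonneg_nonneg \<phi>_nonneg one_le_AP_char prod_nonneg) (auto simp: F_def)
  have "AE x in lebesgue. \<forall>n. T (tup f (?h n)) x = (- z) ^ n / fact n * T (tup f (\<lambda>y. b y ^ n)) x + T (tup f (?h (Suc n))) x"
    unfolding AE_all_countable
  proof
    fix n
    have "(\<lambda>y. (- z) ^ n / fact n * b y ^ n + 1 * ?h (Suc n) y) = ?h n"
      by (subst exp_tail_Suc[of n]) (simp add: power_mult_distrib[symmetric])
    then show "AE x in lebesgue. T (tup f (?h n)) x = (- z) ^ n / fact n * T (tup f (\<lambda>y. b y ^ n)) x + T (tup f (?h (Suc n))) x"
      using T_tup_linear[OF mult_bound_power[of n] mult_bound_exp_tail[OF z, of "Suc n"] f, of "(- z) ^ n / fact n" 1]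
      by simp
  qed
  moreover have "AE x in lebesgue. (\<lambda>n. T (tup f (?h n)) x) \<longlonglongrightarrow> 0"
  proof (rule geometric_Lp_decay_AE[where p = p and v = "nu P p small_w" and D = D])
    show "T (tup f (?h n)) \<in> borel_measurable lebesgue" for n
      using T_tup_bound(1)[OF mult_bound_exp_tail[OF z] f] by (simp add: Lp_def)
    show "Lp_norm p (nu P p small_w) (T (tup f (?h n))) \<le> ennreal ((1 / 2) ^ n * D)" for n
      unfolding D_def by (rule T_tup_bound(2)[OF mult_bound_exp_tail[OF z] f])
  qed (use p D nu_measurable[OF small_w_AP] AP_AE_nu_pos[OF small_w_AP] in auto)
  ultimately show ?thesis
  proof eventually_elim
    case (elim x)
    let ?t = "\<lambda>k. (- 1) ^ k / fact k * T (tup f (\<lambda>y. b y ^ k)) x * z ^ k"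
    have t: "?t k = (- z) ^ k / fact k * T (tup f (\<lambda>y. b y ^ k)) x" for k
      by (simp add: power_minus[of z])
    have "(\<Sum>k<n. ?t k) = T (tup f (?h 0)) x - T (tup f (?h n)) x" for n
    proof (induction n)
      case (Suc n)
      then show ?case
        using elim(1)[rule_format, of n] by (simp add: t power_minus[of z])
    qed simp
    then have "(\<lambda>n. \<Sum>k<n. ?t k) \<longlonglongrightarrow> T (tup f (?h 0)) x - 0"
      using tendsto_diff[OF tendsto_const elim(2)] by simp
    then show ?case
      by (simp add: sums_def exp_tail_0)
  qed
qed

text \<open>
  The conjugated operator obeys the weighted bound for \<open>w\<^sub>j exp (p\<^sub>j Re (z b))\<close>. That function need not
  be locally integrable, so \<open>Re (z b)\<close> is first truncated from above.
\<close>

lemma conjugated_bound: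
  assumes z: "2 * norm z \<le> \<kappa>" and f: "\<And>i. f i \<in> Lp (P i) (w i)"
  shows "Lp_norm p (nu P p w) (\<lambda>x. exp (z * b x) * T (tup f (\<lambda>y. exp (- z * b y))) x)
    \<le> ennreal (\<phi> (c * enn2real (AP_char P p w)) * (\<Prod>i\<in>UNIV. F f i))"
proof -
  define A where "A = enn2real (AP_char P p w)"
  define K where "K = \<phi> (c * A) * (\<Prod>i\<in>UNIV. F f i)"
  define E where "E = T (tup f (\<lambda>y. exp (- z * b y)))"
  have F0: "0 \<le> (\<Prod>i\<in>UNIV. F f i)"
    by (auto simp: F_def intro!: prod_nonneg)
  have A1: "1 \<le> A"
    unfolding A_def by (rule one_le_AP_char[OF w])
  then have cA: "1 \<le> c * A"
    using c mult_mono[of 1 c 1 A] by simp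
  have K: "0 \<le> K"
    unfolding K_def using F0 cA \<phi>_nonneg by simp
  have norm_z: "norm z \<le> \<kappa>"
    using z norm_ge_zero[of z] by linarith
  define \<gamma> where "\<gamma> n y = min (Re (z * y)) (real n)" for n y
  define v where "v n = w(j := \<lambda>x. w j x * exp (P j * \<gamma> n (b x)))" for n
  have lip: "\<bar>\<gamma> n y - \<gamma> n y'\<bar> \<le> \<kappa> * norm (y - y')" for n y y'
  proof -
    have "\<bar>\<gamma> n y - \<gamma> n y'\<bar> \<le> \<bar>Re (z * y) - Re (z * y')\<bar>"
      by (auto simp: \<gamma>_def min_def)
    also have "\<dots> = \<bar>Re (z * (y - y'))\<bar>"
      by (simp add: algebra_simps)
    also have "\<dots> \<le> norm z * norm (y - y')"
      by (metis abs_Re_le_cmod norm_mult)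
    also have "\<dots> \<le> \<kappa> * norm (y - y')"
      using norm_z by (intro mult_right_mono) auto
    finally show ?thesis .
  qed
  have v: "v n \<in> AP P p" "AP_char P p (v n) \<le> ennreal (c * A)" for n
    using perturb[of "\<gamma> n" "real n"] lip unfolding v_def A_def by (auto simp: \<gamma>_def)
  have E_meas [measurable]: "E \<in> borel_measurable lebesgue"
    unfolding E_def using T_tup_bound(1)[OF mult_bound_exp_tail[OF z, of 0] f]
    by (simp add: exp_tail_0 Lp_def)
  note [measurable] = nu_measurable[OF w]
  have E_bound: "(\<integral>\<^sup>+x. ennreal (norm (E x) powr p * (nu P p w x * exp (p * \<gamma> n (b x)))) \<partial>lebesgue) \<le> ennreal (K powr p)" for n
  proof -
    let ?h = "\<lambda>y. exp (- z * b y)"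
    \<comment> \<open>Since \<gamma>_n \<le> Re (z b), the factor |e^(-zb)|^(p_j) outweighs the
      growth of the weight, and the norm of e^(-zb) f_j for \<open>v n\<close> is at most that of
      f_j for w.\<close>
    have le: "norm (?h x * f j x) powr P j * v n j x \<le> 1 powr P j * (norm (f j x) powr P j * w j x)" for x
    proof -
      have "norm (?h x) powr P j * exp (P j * \<gamma> n (b x)) = exp (P j * (\<gamma> n (b x) - Re (z * b x)))"
        by (simp add: exp_powr_real mult.commute right_diff_distrib flip: exp_add)
      also have "\<dots> \<le> 1"
        using P_pos[of j] by (simp add: \<gamma>_def mult_nonneg_nonpos)
      finally have "(norm (?h x) powr P j * exp (P j * \<gamma> n (b x))) * (norm (f j x) powr P j * w j x)
          \<le> 1 * (norm (f j x) powr P j * w j x)"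
        using w_nonneg by (intro mult_right_mono) auto
      then show ?thesis
        unfolding v_def fun_upd_same norm_mult by (simp add: powr_mult mult_ac)
    qed
    have hm: "(\<lambda>x. ?h x * f j x) \<in> borel_measurable lebesgue"
    proof -
      have [measurable]: "f j \<in> borel_measurable lebesgue"
        using f[of j] by (simp add: Lp_def)
      show ?thesis
        by measurable
    qed
    note dom = Lp_domination[OF f P_pos zero_le_one hm AP_measurable[OF w] le]
    have Lp: "tup f ?h i \<in> Lp (P i) (v n i)" for i
      using dom(1) f by (cases "i = j") (auto simp: tup_def v_def)
    have "Lp_norm p (nu P p (v n)) E \<le> ennreal (\<phi> (enn2real (AP_char P p (v n)))) * (\<Prod>i\<in>UNIV. Lp_norm (P i) (v n i) (tup f ?h i))"
      unfolding E_def using T_bound v(1) Lp unfolding weighted_bound_def by blast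
    also have "\<dots> \<le> ennreal (\<phi> (c * A)) * ennreal (1 * (\<Prod>i\<in>UNIV. F f i))"
    proof (rule mult_mono)
      have "enn2real (AP_char P p (v n)) \<le> c * A"
        using v(2)[of n] cA by (intro enn2real_leI) auto
      then show "ennreal (\<phi> (enn2real (AP_char P p (v n)))) \<le> ennreal (\<phi> (c * A))"
        using one_le_AP_char[OF v(1)] cA by (intro ennreal_leI mono_onD[OF \<phi>_mono]) auto
      show "(\<Prod>i\<in>UNIV. Lp_norm (P i) (v n i) (tup f ?h i)) \<le> ennreal (1 * (\<Prod>i\<in>UNIV. F f i))"
        using prod_Lp_norm_tup_le[OF f zero_le_one, of "v n j" ?h] dom(2)
        by (simp add: v_def F_def)
    qed auto
    also have "\<dots> = ennreal K"
      using F0 by (simp add: K_def ennreal_mult'')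
    finally have "(\<integral>\<^sup>+x. ennreal (norm (E x) powr p * nu P p (v n) x) \<partial>lebesgue) \<le> ennreal (K powr p)"
      using K p by (subst (asm) Lp_norm_le_iff) auto
    moreover have "nu P p (v n) x = nu P p w x * exp (p * \<gamma> n (b x))" for x
      unfolding v_def using P_pos[of j] w_nonneg by (intro nu_update) auto
    ultimately show ?thesis
      by simp
  qed
  have "(\<integral>\<^sup>+x. ennreal (norm (exp (z * b x) * E x) powr p * nu P p w x) \<partial>lebesgue) \<le> ennreal (K powr p)"
  proof (rule nn_integral_le_of_tendsto[OF _ _ E_bound])
    show "(\<lambda>x. ennreal (norm (E x) powr p * (nu P p w x * exp (p * \<gamma> n (b x))))) \<in> borel_measurable lebesgue" for n
      unfolding \<gamma>_def by measurable
    show "AE x in lebesgue. (\<lambda>n. ennreal (norm (E x) powr p * (nu P p w x * exp (p * \<gamma> n (b x)))))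
        \<longlonglongrightarrow> ennreal (norm (exp (z * b x) * E x) powr p * nu P p w x)"
    proof (intro AE_I2 tendsto_eventually)
      fix x
      obtain N where N: "Re (z * b x) \<le> real N"
        using real_arch_simple by blast
      show "\<forall>\<^sub>F n in sequentially. ennreal (norm (E x) powr p * (nu P p w x * exp (p * \<gamma> n (b x))))
          = ennreal (norm (exp (z * b x) * E x) powr p * nu P p w x)"
        using eventually_ge_at_top[of N]
      proof eventually_elim
        case (elim n)
        then have "\<gamma> n (b x) = Re (z * b x)"
          using N by (simp add: \<gamma>_def min_def)
        moreover have "norm (exp (z * b x)) powr p = exp (p * Re (z * b x))"
          by (simp add: exp_powr_real mult.commute)
        ultimately show ?case
          by (simp only: norm_mult powr_mult norm_ge_zero mult_ac)
      qed
    qed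
  qed
  then have "Lp_norm p (nu P p w) (\<lambda>x. exp (z * b x) * E x) \<le> ennreal K"
    using K p by (subst Lp_norm_le_iff) auto
  then show ?thesis
    by (simp add: E_def K_def A_def)
qed

text \<open>Each circle average of the conjugated operator, divided by z, has norm at most K /
  \<delta> by \<open>conjugated_bound\<close> and convexity of the p-th power. The averages converge
  to S almost everywhere, and Fatou transfers the bound; 4 / \<kappa> is 1 / \<delta>.\<close>

lemma commutator_Lp:
  assumes f: "\<And>i. f i \<in> Lp (P i) (w i)"
  defines "S \<equiv> \<lambda>x. b x * T f x - T (f(j := \<lambda>y. b y * f j y)) x"
  shows "S \<in> Lp p (nu P p w)"
    "Lp_norm p (nu P p w) S \<le> ennreal (4 / \<kappa> * (\<phi> (c * enn2real (AP_char P p w)) * (\<Prod>i\<in>UNIV. F f i)))"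
proof -
  define K where "K = \<phi> (c * enn2real (AP_char P p w)) * (\<Prod>i\<in>UNIV. F f i)"
  define \<delta> where "\<delta> = \<kappa> / 4"
  have \<delta>: "0 < \<delta>"
    using \<kappa> by (simp add: \<delta>_def)
  have "1 \<le> c * enn2real (AP_char P p w)"
    using c one_le_AP_char[OF w] mult_mono[of 1 c 1 "enn2real (AP_char P p w)"] by simp
  then have K: "0 \<le> K"
    unfolding K_def using \<phi>_nonneg by (auto simp: F_def intro!: mult_nonneg_nonneg prod_nonneg)
  define E where "E z = T (tup f (\<lambda>y. exp (- z * b y)))" for z
  define a where "a x k = (- 1) ^ k / fact k * T (tup f (\<lambda>y. b y ^ k)) x" for x k
  \<comment> \<open>The sample points have modulus \<kappa>/4. The extra point \<kappa>/2, still
    covered by \<open>T_exp_series\<close>, gives absolute convergence on the smaller circle.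
    \<open>Z\<close> is countable, so one null set serves all of it.\<close>
  define Z where "Z = insert (of_real (\<kappa> / 2)) (range (\<lambda>(N, l). circle_pt \<delta> N l))"
  have Z_norm: "2 * norm z \<le> \<kappa>" if "z \<in> Z" for z
  proof -
    have "z = of_real (\<kappa> / 2) \<or> (\<exists>N l. z = circle_pt \<delta> N l)"
      using that by (auto simp: Z_def)
    moreover have "norm (of_real (\<kappa> / 2) :: complex) = \<kappa> / 2"
      using \<kappa> by (simp only: norm_of_real)
    ultimately have "norm z = \<kappa> / 2 \<or> norm z = \<delta>"
      using \<delta> norm_circle_pt[of \<delta>] by (metis less_imp_le)
    then show ?thesis
      using \<kappa> by (auto simp: \<delta>_def)
  qed
  have E_meas: "E z \<in> borel_measurable lebesgue" if "z \<in> Z" for z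
    unfolding E_def using T_tup_bound(1)[OF mult_bound_exp_tail[OF Z_norm[OF that], of 0] f]
    by (simp add: exp_tail_0 Lp_def)
  have circ: "circle_pt \<delta> N l \<in> Z" for N l
    by (auto simp: Z_def intro!: image_eqI[of _ _ "(N, l)"])
  note [measurable] = E_meas[OF circ] nu_measurable[OF w]
  define G where "G N x = (\<Sum>l<Suc N. exp (circle_pt \<delta> (Suc N) l * b x) * E (circle_pt \<delta> (Suc N) l) x / circle_pt \<delta> (Suc N) l)
      / of_nat (Suc N)" for N x
  have countable: "countable Z"
    by (simp add: Z_def)
  have "AE x in lebesgue. \<forall>z\<in>Z. (\<lambda>k. a x k * z ^ k) sums E z x"
    unfolding a_def E_def AE_ball_countable[OF countable] using T_exp_series[OF Z_norm f] by blast
  then have "AE x in lebesgue. (\<lambda>N. G N x) \<longlonglongrightarrow> S x"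
  proof eventually_elim
    case (elim x)
    have "summable (\<lambda>k. a x k * of_real (\<kappa> / 2) ^ k)"
      using elim by (auto simp: Z_def sums_iff)
    then have "summable (\<lambda>k. norm (a x k * of_real \<delta> ^ k))"
      by (rule powser_insidea) (use \<kappa> in \<open>simp add: \<delta>_def\<close>)
    then have "summable (\<lambda>k. norm (a x k) * \<delta> ^ k)"
      using \<delta> by (simp add: norm_mult norm_power)
    then have "(\<lambda>N. G N x) \<longlonglongrightarrow> b x * a x 0 + a x 1"
      unfolding G_def by (rule circle_average_exp_tendsto[OF \<delta>, where E = "\<lambda>z. E z x" and Z = Z])
        (use elim circ in auto)
    moreover have "b x * a x 0 + a x 1 = S x"
      by (simp add: a_def S_def tup_def)
    ultimately show ?case
      by simp
  qed
  then have lim: "AE x in lebesgue. (\<lambda>N. ennreal (norm (G N x) powr p * nu P p w x)) \<longlonglongrightarrow> ennreal (norm (S x) powr p * nu P p w x)"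
    by eventually_elim (use p in \<open>auto intro!: tendsto_ennrealI tendsto_intros\<close>)
  have G_bound: "(\<integral>\<^sup>+x. ennreal (norm (G N x) powr p * nu P p w x) \<partial>lebesgue) \<le> ennreal ((K / \<delta>) powr p)" for N
  proof -
    let ?z = "circle_pt \<delta> (Suc N)"
    let ?f = "\<lambda>l x. exp (?z l * b x) * E (?z l) x"
    define C where "C = 1 / (\<delta> powr p * real (Suc N))"
    have C: "0 \<le> C"
      by (simp add: C_def)
    have "norm (G N x) powr p * nu P p w x \<le> (\<Sum>l<Suc N. C * (norm (?f l x) powr p * nu P p w x))" for x
    proof -
      have "norm (G N x) \<le> (\<Sum>l<Suc N. norm (?f l x) / \<delta>) / card {..<Suc N}"
        unfolding G_def norm_divide norm_of_nat using \<delta>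
        by (auto intro!: divide_right_mono order_trans[OF norm_sum] sum_mono simp: norm_divide norm_circle_pt simp del: sum.lessThan_Suc)
      then have "norm (G N x) powr p \<le> ((\<Sum>l<Suc N. norm (?f l x) / \<delta>) / card {..<Suc N}) powr p"
        using p by (intro powr_mono2) auto
      also have "\<dots> \<le> (\<Sum>l<Suc N. (norm (?f l x) / \<delta>) powr p) / card {..<Suc N}"
        using \<delta> p by (intro powr_mean_le) auto
      also have "\<dots> = (\<Sum>l<Suc N. C * norm (?f l x) powr p)"
        using \<delta> by (simp add: C_def powr_divide sum_divide_distrib del: sum.lessThan_Suc)
      finally have "norm (G N x) powr p * nu P p w x \<le> (\<Sum>l<Suc N. C * norm (?f l x) powr p) * nu P p w x"
        using nu_nonneg by (intro mult_right_mono) auto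
      then show ?thesis
        by (simp only: sum_distrib_right mult.assoc)
    qed
    then have "(\<integral>\<^sup>+x. ennreal (norm (G N x) powr p * nu P p w x) \<partial>lebesgue)
        \<le> (\<integral>\<^sup>+x. ennreal (\<Sum>l<Suc N. C * (norm (?f l x) powr p * nu P p w x)) \<partial>lebesgue)"
      by (intro nn_integral_mono ennreal_leI)
    also have "\<dots> = (\<integral>\<^sup>+x. (\<Sum>l<Suc N. ennreal C * ennreal (norm (?f l x) powr p * nu P p w x)) \<partial>lebesgue)"
    proof (intro nn_integral_cong)
      fix x
      have "ennreal (\<Sum>l<Suc N. C * (norm (?f l x) powr p * nu P p w x)) = (\<Sum>l<Suc N. ennreal (C * (norm (?f l x) powr p * nu P p w x)))"
        using nu_nonneg C by (intro sum_ennreal[symmetric] mult_nonneg_nonneg) auto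
      then show "ennreal (\<Sum>l<Suc N. C * (norm (?f l x) powr p * nu P p w x)) = (\<Sum>l<Suc N. ennreal C * ennreal (norm (?f l x) powr p * nu P p w x))"
        by (simp only: ennreal_mult'[OF C])
    qed
    also have "\<dots> = (\<Sum>l<Suc N. ennreal C * (\<integral>\<^sup>+x. ennreal (norm (?f l x) powr p * nu P p w x) \<partial>lebesgue))"
      by (subst nn_integral_sum) (auto simp: nn_integral_cmult simp del: sum.lessThan_Suc of_nat_Suc)
    also have "\<dots> \<le> (\<Sum>l<Suc N. ennreal C * ennreal (K powr p))"
    proof (intro sum_mono mult_left_mono)
      fix l
      have "Lp_norm p (nu P p w) (?f l) \<le> ennreal K"
        unfolding E_def K_def by (rule conjugated_bound[OF Z_norm[OF circ] f])
      then show "(\<integral>\<^sup>+x. ennreal (norm (?f l x) powr p * nu P p w x) \<partial>lebesgue) \<le> ennreal (K powr p)"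
        using K p by (subst (asm) Lp_norm_le_iff) auto
    qed auto
    also have "\<dots> = (\<Sum>l<Suc N. ennreal (C * K powr p))"
      by (simp only: ennreal_mult'[OF C])
    also have "\<dots> = ennreal (\<Sum>l<Suc N. C * K powr p)"
      using C by (intro sum_ennreal) auto
    also have "(\<Sum>l<Suc N. C * K powr p) = (K / \<delta>) powr p"
      using \<delta> K by (simp add: C_def powr_divide del: sum.lessThan_Suc of_nat_Suc)
    finally show ?thesis .
  qed
  have S_meas: "S \<in> borel_measurable lebesgue"
  proof -
    have "T f \<in> borel_measurable lebesgue"
      using T_bound w f unfolding weighted_bound_def Lp_def by blast
    moreover have "T (f(j := \<lambda>y. b y * f j y)) \<in> borel_measurable lebesgue"
      using T_tup_bound(1)[OF mult_bound_power[of 1] f] by (simp add: Lp_def tup_def)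
    ultimately show ?thesis
      unfolding S_def by measurable
  qed
  have "(\<integral>\<^sup>+x. ennreal (norm (S x) powr p * nu P p w x) \<partial>lebesgue) \<le> ennreal ((K / \<delta>) powr p)"
  proof (rule nn_integral_le_of_tendsto[OF _ lim G_bound])
    show "(\<lambda>x. ennreal (norm (G N x) powr p * nu P p w x)) \<in> borel_measurable lebesgue" for N
      unfolding G_def by measurable
  qed
  then have le: "Lp_norm p (nu P p w) S \<le> ennreal (K / \<delta>)"
    using K \<delta> p by (subst Lp_norm_le_iff) auto
  then show "Lp_norm p (nu P p w) S \<le> ennreal (4 / \<kappa> * (\<phi> (c * enn2real (AP_char P p w)) * (\<Prod>i\<in>UNIV. F f i)))"
    by (simp add: K_def \<delta>_def mult.commute)
  show "S \<in> Lp p (nu P p w)"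
    using S_meas le_less_trans[OF le ennreal_less_top] by (simp add: Lp_def)
qed

text \<open>The two terms of the commutator use linearity of \<open>T\<close> for different weights:
  w for the first, and \<open>small_w\<close> for the second, whose j-th entry contains the factor
  b.\<close>

lemma commutator_linear:
  assumes f: "\<And>i. f i \<in> Lp (P i) (w i)" and g: "g \<in> Lp (P i) (w i)" and bb: "bb j = b"
  shows "AE x in lebesgue. comm1 bb j T (f(i := \<lambda>y. r * f i y + s * g y)) x
    = r * comm1 bb j T f x + s * comm1 bb j T (f(i := g)) x"
proof -
  have pw: "mult_bound (fact 1 / \<kappa> ^ 1) (\<lambda>x. b x ^ 1)"
    by (rule mult_bound_power)
  define f' where "f' = tup f (\<lambda>x. b x ^ 1)"
  define g' where "g' = (if i = j then (\<lambda>x. b x ^ 1 * g x) else g)"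
  have f': "f' k \<in> Lp (P k) (small_w k)" for k
    unfolding f'_def by (rule tup_Lp[OF pw f])
  have g': "g' \<in> Lp (P i) (small_w i)"
    using mult_Lp(1)[OF pw] g by (auto simp: g'_def small_w_def)
  have "AE x in lebesgue. T (f(i := \<lambda>y. r * f i y + s * g y)) x = r * T f x + s * T (f(i := g)) x"
    using T_lin w f g unfolding multilinear_op_def by blast
  moreover have "AE x in lebesgue. T (f'(i := \<lambda>y. r * f' i y + s * g' y)) x = r * T f' x + s * T (f'(i := g')) x"
    using T_lin small_w_AP f' g' unfolding multilinear_op_def by blast
  ultimately show ?thesis
  proof eventually_elim
    case (elim x)
    have 1: "(f(i := \<lambda>y. r * f i y + s * g y))(j := \<lambda>y. b y * (f(i := \<lambda>y. r * f i y + s * g y)) j y)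
        = f'(i := \<lambda>y. r * f' i y + s * g' y)"
      by (auto simp: f'_def g'_def tup_def fun_eq_iff algebra_simps)
    have 2: "f(j := \<lambda>y. b y * f j y) = f'"
      by (simp add: f'_def tup_def)
    have 3: "(f(i := g))(j := \<lambda>y. b y * (f(i := g)) j y) = f'(i := g')"
      by (auto simp: f'_def g'_def tup_def fun_eq_iff)
    show ?case
      unfolding comm1_def bb 1 2 3 elim by (simp add: algebra_simps)
  qed
qed

end

section \<open>Iteration over a list of slots\<close>

lemma weighted_bound_mono:
  assumes "weighted_bound P p T \<phi>" "exponents P p" "\<And>t. 1 \<le> t \<Longrightarrow> \<phi> t \<le> \<psi> t"
  shows "weighted_bound P p T \<psi>"
  unfolding weighted_bound_def
proof (intro ballI allI impI)
  fix w :: "'a \<Rightarrow> real ^ 'b \<Rightarrow> real" and f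
  assume w: "w \<in> AP P p" and f: "\<forall>j. f j \<in> Lp (P j) (w j)"
  interpret exponents P p by fact
  have "ennreal (\<phi> (enn2real (AP_char P p w))) \<le> ennreal (\<psi> (enn2real (AP_char P p w)))"
    using assms(3) one_le_AP_char[OF w] by (intro ennreal_leI) auto
  then have "ennreal (\<phi> (enn2real (AP_char P p w))) * (\<Prod>j\<in>UNIV. Lp_norm (P j) (w j) (f j))
      \<le> ennreal (\<psi> (enn2real (AP_char P p w))) * (\<Prod>j\<in>UNIV. Lp_norm (P j) (w j) (f j))"
    by (rule mult_right_mono) simp
  moreover have "T f \<in> Lp p (nu P p w) \<and> Lp_norm p (nu P p w) (T f)
      \<le> ennreal (\<phi> (enn2real (AP_char P p w))) * (\<Prod>j\<in>UNIV. Lp_norm (P j) (w j) (f j))"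
    using assms(1) w f unfolding weighted_bound_def by blast
  ultimately show "T f \<in> Lp p (nu P p w) \<and> Lp_norm p (nu P p w) (T f)
      \<le> ennreal (\<psi> (enn2real (AP_char P p w))) * (\<Prod>j\<in>UNIV. Lp_norm (P j) (w j) (f j))"
    by (blast intro: order_trans)
qed

lemma prod_Lp_norm:
  fixes f :: "'m::finite \<Rightarrow> real ^ 'n \<Rightarrow> complex"
  assumes "\<And>j. f j \<in> Lp (P j) (w j)"
  shows "(\<Prod>j\<in>UNIV. Lp_norm (P j) (w j) (f j)) = ennreal (\<Prod>j\<in>UNIV. enn2real (Lp_norm (P j) (w j) (f j)))"
proof -
  have "(\<Prod>j\<in>UNIV. Lp_norm (P j) (w j) (f j)) = (\<Prod>j\<in>UNIV. ennreal (enn2real (Lp_norm (P j) (w j) (f j))))"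
    by (rule prod.cong[OF refl Lp_norm_finite[OF assms]])
  also have "\<dots> = ennreal (\<Prod>j\<in>UNIV. enn2real (Lp_norm (P j) (w j) (f j)))"
    by (rule prod_ennreal) simp
  finally show ?thesis .
qed

context exponents
begin

lemma \<mu>_pos: "0 < \<mu>"
  using inverse_dual_exp_le[of None] p by (simp add: dual_exp_def)

text \<open>With \<kappa> = \<kappa>0 / (A^\<mu> B), the factor 4 / \<kappa> becomes (4 / \<kappa>0)
  A^\<mu> B: one commutator costs one power A^\<mu> and one factor c inside \<phi>. \<open>C\<close>
  is fixed before \<open>T\<close>, \<open>\<phi>\<close>, \<open>b\<close> and \<open>B\<close>, as
  the iteration requires.\<close>

lemma comm1_bound:
  assumes c: "1 < c"
  obtains C where "0 \<le> C"
    "\<And>(T :: ('m \<Rightarrow> real ^ 'n \<Rightarrow> complex) \<Rightarrow> real ^ 'n \<Rightarrow> complex) \<phi> b j B.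
      \<lbrakk>multilinear_op P p T; weighted_bound P p T \<phi>; mono_on {1..} \<phi>; \<And>t. 1 \<le> t \<Longrightarrow> 0 \<le> \<phi> t;
       b j \<in> BMO; BMO_norm (b j) < ennreal B; 0 < B\<rbrakk> \<Longrightarrow>
      multilinear_op P p (comm1 b j T) \<and>
      weighted_bound P p (comm1 b j T) (\<lambda>t. C * \<phi> (c * t) * t powr \<mu> * B)"
proof -
  obtain \<kappa>0 where \<kappa>0: "0 < \<kappa>0"
    "\<And>(w :: 'm \<Rightarrow> real ^ 'n \<Rightarrow> real) j b B \<kappa> \<gamma> G.
      \<lbrakk>w \<in> AP P p; b \<in> BMO; BMO_norm b < ennreal B; 0 < B; 0 \<le> \<kappa>;
       \<kappa> \<le> \<kappa>0 / (enn2real (AP_char P p w) powr \<mu> * B);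
       \<And>y z. \<bar>\<gamma> y - \<gamma> z\<bar> \<le> \<kappa> * norm (y - z); \<And>y. \<gamma> y \<le> G\<rbrakk> \<Longrightarrow>
      w(j := \<lambda>x. w j x * exp (P j * \<gamma> (b x))) \<in> AP P p \<and>
      AP_char P p (w(j := \<lambda>x. w j x * exp (P j * \<gamma> (b x)))) \<le> ennreal (c * enn2real (AP_char P p w))"
    using AP_perturb[OF c, where 'n='n] by blast
  show thesis
  proof (rule that[of "4 / \<kappa>0"])
    fix T :: "('m \<Rightarrow> real ^ 'n \<Rightarrow> complex) \<Rightarrow> real ^ 'n \<Rightarrow> complex" and \<phi> and b :: "'m \<Rightarrow> real ^ 'n \<Rightarrow> complex" and j and B :: real
    assume T: "multilinear_op P p T" "weighted_bound P p T \<phi>" "mono_on {1..} \<phi>" "\<And>t. 1 \<le> t \<Longrightarrow> 0 \<le> \<phi> t"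
      and b: "b j \<in> BMO" "BMO_norm (b j) < ennreal B" "0 < B"
    define \<kappa> where "\<kappa> w = \<kappa>0 / (enn2real (AP_char P p w) powr \<mu> * B)" for w :: "'m \<Rightarrow> real ^ 'n \<Rightarrow> real"
    have step: "commutator_step P p T \<phi> w j (b j) (\<kappa> w) c" if w: "w \<in> AP P p" for w
    proof
      show "b j \<in> borel_measurable lebesgue"
        using b(1) by (auto simp: BMO_def intro: locally_integrable_measurable)
      show "0 < \<kappa> w"
        using \<kappa>0(1) b(3) one_le_AP_char[OF w] by (simp add: \<kappa>_def)
      then show "w(j := \<lambda>x. w j x * exp (P j * \<gamma> (b j x))) \<in> AP P p \<and>
          AP_char P p (w(j := \<lambda>x. w j x * exp (P j * \<gamma> (b j x)))) \<le> ennreal (c * enn2real (AP_char P p w))"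
        if "\<And>y z. \<bar>\<gamma> y - \<gamma> z\<bar> \<le> \<kappa> w * norm (y - z)" "\<And>y. \<gamma> y \<le> G" for \<gamma> :: "complex \<Rightarrow> real" and G
        using that by (intro \<kappa>0(2)[OF w b, where \<kappa> = "\<kappa> w"]) (auto simp: \<kappa>_def)
    qed (use T w c in auto)
    have "multilinear_op P p (comm1 b j T)"
      unfolding multilinear_op_def
    proof (intro ballI allI impI)
      fix w :: "'m \<Rightarrow> real ^ 'n \<Rightarrow> real" and f i g r s
      assume w: "w \<in> AP P p" and "\<forall>i. f i \<in> Lp (P i) (w i)" "g \<in> Lp (P i) (w i)"
      then show "AE x in lebesgue. comm1 b j T (f(i := \<lambda>y. r * f i y + s * g y)) x
          = r * comm1 b j T f x + s * comm1 b j T (f(i := g)) x"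
        by (intro commutator_step.commutator_linear[OF step[OF w]]) auto
    qed
    moreover have "weighted_bound P p (comm1 b j T) (\<lambda>t. 4 / \<kappa>0 * \<phi> (c * t) * t powr \<mu> * B)"
      unfolding weighted_bound_def
    proof (intro ballI allI impI)
      fix w :: "'m \<Rightarrow> real ^ 'n \<Rightarrow> real" and f
      assume w: "w \<in> AP P p" and f: "\<forall>i. f i \<in> Lp (P i) (w i)"
      interpret commutator_step P p T \<phi> w j "b j" "\<kappa> w" c
        by (rule step[OF w])
      define A where "A = enn2real (AP_char P p w)"
      have A: "1 \<le> A"
        unfolding A_def by (rule one_le_AP_char[OF w])
      have "0 \<le> 4 / \<kappa>0 * \<phi> (c * A) * A powr \<mu> * B"
        using \<kappa>0(1) b(3) A c mult_mono[of 1 c 1 A] T(4)[of "c * A"] by simp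
      moreover have "4 / \<kappa> w * (\<phi> (c * A) * (\<Prod>i\<in>UNIV. F f i)) = (4 / \<kappa>0 * \<phi> (c * A) * A powr \<mu> * B) * (\<Prod>i\<in>UNIV. F f i)"
        by (simp add: \<kappa>_def A_def)
      moreover have "(\<Prod>i\<in>UNIV. Lp_norm (P i) (w i) (f i)) = ennreal (\<Prod>i\<in>UNIV. F f i)"
        unfolding F_def using f by (intro prod_Lp_norm) simp
      ultimately have "ennreal (4 / \<kappa> w * (\<phi> (c * A) * (\<Prod>i\<in>UNIV. F f i)))
          = ennreal (4 / \<kappa>0 * \<phi> (c * A) * A powr \<mu> * B) * (\<Prod>i\<in>UNIV. Lp_norm (P i) (w i) (f i))"
        by (simp only: ennreal_mult')
      then show "comm1 b j T f \<in> Lp p (nu P p w) \<and> Lp_norm p (nu P p w) (comm1 b j T f)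
          \<le> ennreal (4 / \<kappa>0 * \<phi> (c * enn2real (AP_char P p w)) * enn2real (AP_char P p w) powr \<mu> * B) *
            (\<Prod>i\<in>UNIV. Lp_norm (P i) (w i) (f i))"
        using commutator_Lp[of f] f unfolding comm1_def A_def by simp
    qed
    ultimately show "multilinear_op P p (comm1 b j T) \<and>
        weighted_bound P p (comm1 b j T) (\<lambda>t. 4 / \<kappa>0 * \<phi> (c * t) * t powr \<mu> * B)"
      by simp
  qed (use \<kappa>0(1) in simp)
qed

text \<open>\<open>fold\<close> applies the head of the list first, so the induction hypothesis is
  used for another operator and another function \<psi>(t) = C \<phi>(c t) t^\<mu> B_j, again
  nonnegative and increasing. Hence the quantifiers over \<open>T\<close> and \<open>\<phi>\<close>
  inside the induction.\<close>

lemma fold_comm1_bound: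
  assumes c: "1 < c"
  shows "\<exists>D\<ge>0. \<forall>(T :: ('m \<Rightarrow> real ^ 'n \<Rightarrow> complex) \<Rightarrow> real ^ 'n \<Rightarrow> complex) \<phi> b B.
      multilinear_op P p T \<longrightarrow> weighted_bound P p T \<phi> \<longrightarrow> mono_on {1..} \<phi> \<longrightarrow> (\<forall>t\<ge>1. 0 \<le> \<phi> t) \<longrightarrow>
      (\<forall>j. b j \<in> BMO \<and> BMO_norm (b j) < ennreal (B j) \<and> 0 < B j) \<longrightarrow>
      weighted_bound P p (fold (comm1 b) js T)
        (\<lambda>t. D * \<phi> (c ^ length js * t) * t powr (real (length js) * \<mu>) * (\<Prod>j\<leftarrow>js. B j))"
proof (induction js)
  case Nil
  show ?case
  proof (intro exI[of _ 1] conjI allI impI)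
    fix T :: "('m \<Rightarrow> real ^ 'n \<Rightarrow> complex) \<Rightarrow> real ^ 'n \<Rightarrow> complex" and \<phi> and b :: "'m \<Rightarrow> real ^ 'n \<Rightarrow> complex" and B :: "'m \<Rightarrow> real"
    assume "weighted_bound P p T \<phi>"
    then show "weighted_bound P p (fold (comm1 b) [] T)
        (\<lambda>t. 1 * \<phi> (c ^ length [] * t) * t powr (real (length []) * \<mu>) * (\<Prod>j\<leftarrow>[]. B j))"
      using exponents_axioms by (auto intro: weighted_bound_mono)
  qed simp
next
  case (Cons j js)
  obtain C where C: "0 \<le> C"
    "\<And>(T :: ('m \<Rightarrow> real ^ 'n \<Rightarrow> complex) \<Rightarrow> real ^ 'n \<Rightarrow> complex) \<phi> b j B.
      \<lbrakk>multilinear_op P p T; weighted_bound P p T \<phi>; mono_on {1..} \<phi>; \<And>t. 1 \<le> t \<Longrightarrow> 0 \<le> \<phi> t;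
       b j \<in> BMO; BMO_norm (b j) < ennreal B; 0 < B\<rbrakk> \<Longrightarrow>
      multilinear_op P p (comm1 b j T) \<and>
      weighted_bound P p (comm1 b j T) (\<lambda>t. C * \<phi> (c * t) * t powr \<mu> * B)"
    using comm1_bound[OF c, where 'n='n] by blast
  obtain D where D: "0 \<le> D"
    "\<And>(T :: ('m \<Rightarrow> real ^ 'n \<Rightarrow> complex) \<Rightarrow> real ^ 'n \<Rightarrow> complex) \<phi> b B.
      \<lbrakk>multilinear_op P p T; weighted_bound P p T \<phi>; mono_on {1..} \<phi>; \<forall>t\<ge>1. 0 \<le> \<phi> t;
       \<forall>j. b j \<in> BMO \<and> BMO_norm (b j) < ennreal (B j) \<and> 0 < B j\<rbrakk> \<Longrightarrow>
      weighted_bound P p (fold (comm1 b) js T)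
        (\<lambda>t. D * \<phi> (c ^ length js * t) * t powr (real (length js) * \<mu>) * (\<Prod>j\<leftarrow>js. B j))"
    using Cons.IH by blast
  define n where "n = length js"
  show ?case
  \<comment> \<open>The rest of the list evaluates \<psi> at c^n t, and its factor (c^n t)^\<mu>
    leaves this power of c^n behind.\<close>
  proof (intro exI[of _ "D * C * (c ^ n) powr \<mu>"] conjI allI impI)
    fix T :: "('m \<Rightarrow> real ^ 'n \<Rightarrow> complex) \<Rightarrow> real ^ 'n \<Rightarrow> complex" and \<phi> and b :: "'m \<Rightarrow> real ^ 'n \<Rightarrow> complex" and B :: "'m \<Rightarrow> real"
    assume T: "multilinear_op P p T" "weighted_bound P p T \<phi>" and \<phi>: "mono_on {1..} \<phi>" "\<forall>t\<ge>1. 0 \<le> \<phi> t"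
      and b: "\<forall>j. b j \<in> BMO \<and> BMO_norm (b j) < ennreal (B j) \<and> 0 < B j"
    define \<psi> where "\<psi> t = C * \<phi> (c * t) * t powr \<mu> * B j" for t
    have ct: "1 \<le> c * t" if "1 \<le> t" for t
      using c that mult_mono[of 1 c 1 t] by simp
    have T': "multilinear_op P p (comm1 b j T)" "weighted_bound P p (comm1 b j T) \<psi>"
      using C(2)[OF T \<phi>(1), of b j "B j"] \<phi>(2) b unfolding \<psi>_def by auto
    have \<psi>_nonneg: "\<forall>t\<ge>1. 0 \<le> \<psi> t"
      using C(1) \<phi>(2) ct b by (auto simp: \<psi>_def less_imp_le intro!: mult_nonneg_nonneg)
    have \<psi>_mono: "mono_on {1..} \<psi>"
    proof (rule mono_onI)
      fix s t :: real assume st: "s \<in> {1..}" "t \<in> {1..}" "s \<le> t"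
      have "\<phi> (c * s) \<le> \<phi> (c * t)"
        using st ct c by (intro mono_onD[OF \<phi>(1)]) auto
      moreover have "s powr \<mu> \<le> t powr \<mu>"
        using st \<mu>_pos by (intro powr_mono2) auto
      ultimately show "\<psi> s \<le> \<psi> t"
        unfolding \<psi>_def using C(1) \<phi>(2) ct st b
        by (intro mult_right_mono mult_mono mult_left_mono) (auto simp: less_imp_le intro!: mult_nonneg_nonneg)
    qed
    have "weighted_bound P p (fold (comm1 b) js (comm1 b j T))
        (\<lambda>t. D * \<psi> (c ^ n * t) * t powr (real n * \<mu>) * (\<Prod>j\<leftarrow>js. B j))"
      unfolding n_def by (rule D(2)[OF T' \<psi>_mono \<psi>_nonneg b])
    moreover have "D * \<psi> (c ^ n * t) * t powr (real n * \<mu>) * (\<Prod>j\<leftarrow>js. B j)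
        \<le> D * C * (c ^ n) powr \<mu> * \<phi> (c ^ length (j # js) * t) * t powr (real (length (j # js)) * \<mu>) * (\<Prod>j\<leftarrow>j # js. B j)"
      if t: "1 \<le> t" for t
    proof -
      have "(c ^ n * t) powr \<mu> = (c ^ n) powr \<mu> * t powr \<mu>"
        by (rule powr_mult)
      moreover have "t powr (real (length (j # js)) * \<mu>) = t powr \<mu> * t powr (real n * \<mu>)"
        by (simp add: n_def powr_add[symmetric] algebra_simps)
      ultimately show ?thesis
        by (simp add: \<psi>_def n_def mult_ac)
    qed
    ultimately show "weighted_bound P p (fold (comm1 b) (j # js) T)
        (\<lambda>t. D * C * (c ^ n) powr \<mu> * \<phi> (c ^ length (j # js) * t) * t powr (real (length (j # js)) * \<mu>) * (\<Prod>j\<leftarrow>j # js. B j))"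
      unfolding fold_simps by (rule weighted_bound_mono[OF _ exponents_axioms])
  qed (use C(1) D(1) in simp)
qed

end

lemma fold_funpow_eq: "fold (\<lambda>j. g j ^^ a j) xs = fold g (concat (map (\<lambda>j. replicate (a j) j) xs))"
proof (induction xs)
  case (Cons x xs)
  have "fold g (replicate n x) = g x ^^ n" for n
    by (induction n) (auto simp: funpow_swap1 fun_eq_iff)
  then show ?case
    using Cons by simp
qed simp

lemma four_le_c_const:
  assumes "\<And>j. 1 < P j"
  shows "4 \<le> c_const P"
proof -
  have "0 \<le> min (1 / P j) (1 / conj_exp (P j))" for j
    using assms[of j] conj_exp_props(1)[OF assms, of j] by simp
  then have "4 powr 1 \<le> c_const P"
    unfolding c_const_def by (intro powr_mono) (auto intro!: sum_nonneg)
  then show ?thesis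
    by simp
qed

theorem theorem4p13:
  fixes P :: "'m::{finite, linorder} \<Rightarrow> real" and p :: real
    and \<alpha> :: "'m \<Rightarrow> nat" and C0 :: real
  assumes "\<And>j. 1 < P j" and "1 < p" and "1 / p = (\<Sum>j\<in>UNIV. 1 / P j)" and "0 \<le> C0"
  shows "\<exists>C\<ge>0. \<forall>(T :: ('m \<Rightarrow> real ^ 'n \<Rightarrow> complex) \<Rightarrow> real ^ 'n \<Rightarrow> complex) (\<phi> :: real \<Rightarrow> real).
    multilinear_op P p T \<longrightarrow>
    mono_on {1..} \<phi> \<longrightarrow> (\<forall>t\<ge>1. 0 \<le> \<phi> t) \<longrightarrow>
    (\<forall>w\<in>AP P p. \<forall>f. (\<forall>j. f j \<in> Lp (P j) (w j)) \<longrightarrow>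
       T f \<in> Lp p (nu P p w) \<and>
       Lp_norm p (nu P p w) (T f)
         \<le> ennreal (C0 * \<phi> (enn2real (AP_char P p w))) * (\<Prod>j\<in>UNIV. Lp_norm (P j) (w j) (f j))) \<longrightarrow>
    (\<forall>b. (\<forall>j. b j \<in> BMO) \<longrightarrow>
      (\<forall>w\<in>AP P p. \<forall>f. (\<forall>j. f j \<in> Lp (P j) (w j)) \<longrightarrow>
         comm b \<alpha> T f \<in> Lp p (nu P p w) \<and>
         Lp_norm p (nu P p w) (comm b \<alpha> T f)
           \<le> ennreal (C * (\<Prod>j\<in>UNIV. fact (\<alpha> j)) * \<phi> (c_const P * enn2real (AP_char P p w)) *
                enn2real (AP_char P p w)
                  powr (real (\<Sum>j\<in>UNIV. \<alpha> j) * Max (insert p (range (\<lambda>j. conj_exp (P j)))))) *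
             (\<Prod>j\<in>UNIV. BMO_norm (b j) ^ \<alpha> j * Lp_norm (P j) (w j) (f j))))"
proof -
  interpret exponents P p
    using assms by unfold_locales
  define js where "js = concat (map (\<lambda>j. replicate (\<alpha> j) j) (sorted_list_of_set (UNIV :: 'm set)))"
  define n where "n = (\<Sum>j\<in>UNIV. \<alpha> j)"
  have len: "length js = n"
    by (simp add: js_def n_def length_concat comp_def sum.distinct_set_conv_list[symmetric] flip: sum_list_distinct_conv_sum_set)
  have prod_js: "(\<Prod>j\<leftarrow>js. B j) = (\<Prod>j\<in>UNIV. B j ^ \<alpha> j)" for B :: "'m \<Rightarrow> real"
  proof -
    have "(\<Prod>j\<leftarrow>concat (map (\<lambda>j. replicate (\<alpha> j) j) xs). B j) = (\<Prod>j\<leftarrow>xs. B j ^ \<alpha> j)" for xs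
      by (induction xs) auto
    then show ?thesis
      by (simp add: js_def prod.distinct_set_conv_list[symmetric])
  qed
  have comm_eq: "comm b \<alpha> T = fold (comm1 b) js T" for b and T :: "('m \<Rightarrow> real ^ 'n \<Rightarrow> complex) \<Rightarrow> real ^ 'n \<Rightarrow> complex"
    unfolding comm_def js_def fold_funpow_eq ..
  \<comment> \<open>Then c^n = 4^(n/(n+1)) \<le> 4 \<le> \<open>c_const P\<close>. The n + 1 in
    place of n keeps the definition meaningful for \<alpha> = 0.\<close>
  define c where "c = 4 powr (1 / real (Suc n))"
  have c: "1 < c"
    unfolding c_def by (intro gr_one_powr) auto
  have cn: "c ^ n \<le> c_const P"
  proof -
    have "c ^ n = 4 powr (real n / real (Suc n))"
      by (simp add: c_def powr_realpow[symmetric] powr_powr del: of_nat_Suc)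
    also have "\<dots> \<le> 4 powr 1"
      by (intro powr_mono) auto
    finally show ?thesis
      using four_le_c_const[of P, OF assms(1)] by simp
  qed
  obtain D where D: "0 \<le> D"
    "\<And>(T :: ('m \<Rightarrow> real ^ 'n \<Rightarrow> complex) \<Rightarrow> real ^ 'n \<Rightarrow> complex) \<phi> b B.
      \<lbrakk>multilinear_op P p T; weighted_bound P p T \<phi>; mono_on {1..} \<phi>; \<forall>t\<ge>1. 0 \<le> \<phi> t;
       \<forall>j. b j \<in> BMO \<and> BMO_norm (b j) < ennreal (B j) \<and> 0 < B j\<rbrakk> \<Longrightarrow>
      weighted_bound P p (fold (comm1 b) js T)
        (\<lambda>t. D * \<phi> (c ^ length js * t) * t powr (real (length js) * \<mu>) * (\<Prod>j\<leftarrow>js. B j))"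
    using fold_comm1_bound[OF c, of js, where 'n='n] by blast
  show ?thesis
  proof (intro exI[of _ "D * C0"] conjI allI impI ballI)
    fix T :: "('m \<Rightarrow> real ^ 'n \<Rightarrow> complex) \<Rightarrow> real ^ 'n \<Rightarrow> complex" and \<phi> :: "real \<Rightarrow> real"
      and b :: "'m \<Rightarrow> real ^ 'n \<Rightarrow> complex" and w and f :: "'m \<Rightarrow> real ^ 'n \<Rightarrow> complex"
    assume T: "multilinear_op P p T" and \<phi>: "mono_on {1..} \<phi>" "\<forall>t\<ge>1. 0 \<le> \<phi> t"
      and bound: "\<forall>w\<in>AP P p. \<forall>f. (\<forall>j. f j \<in> Lp (P j) (w j)) \<longrightarrow>
       T f \<in> Lp p (nu P p w) \<and>
       Lp_norm p (nu P p w) (T f)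
         \<le> ennreal (C0 * \<phi> (enn2real (AP_char P p w))) * (\<Prod>j\<in>UNIV. Lp_norm (P j) (w j) (f j))"
      and b: "\<forall>j. b j \<in> BMO" and w: "w \<in> AP P p" and f: "\<forall>j. f j \<in> Lp (P j) (w j)"
    have T_bound: "weighted_bound P p T (\<lambda>t. C0 * \<phi> t)"
      using bound by (simp add: weighted_bound_def)
    define A where "A = enn2real (AP_char P p w)"
    have A: "1 \<le> A"
      unfolding A_def by (rule one_le_AP_char[OF w])
    have cA: "1 \<le> c ^ n * A" "c ^ n * A \<le> c_const P * A"
      using A c cn mult_mono[of 1 "c ^ n" 1 A] by (auto simp: one_le_power)
    define R where "R = D * (C0 * \<phi> (c_const P * A)) * A powr (real n * \<mu>)"
    have \<phi>_nonneg: "0 \<le> \<phi> (c_const P * A)"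
      using cA \<phi>(2) by (meson order_trans)
    then have R: "0 \<le> R"
      unfolding R_def using D(1) assms(4) by simp
    define \<beta> where "\<beta> j = enn2real (BMO_norm (b j))" for j
    have \<beta>: "BMO_norm (b j) = ennreal (\<beta> j)" for j
      using b by (auto simp: \<beta>_def BMO_def)
    have \<beta>0: "0 \<le> \<beta> j" for j
      by (simp add: \<beta>_def)
    define y where "y = (\<Prod>j\<in>UNIV. enn2real (Lp_norm (P j) (w j) (f j)))"
    have y: "(\<Prod>j\<in>UNIV. Lp_norm (P j) (w j) (f j)) = ennreal y" "0 \<le> y"
    proof -
      show "(\<Prod>j\<in>UNIV. Lp_norm (P j) (w j) (f j)) = ennreal y"
        unfolding y_def using f by (intro prod_Lp_norm) simp
      show "0 \<le> y"
        by (auto simp: y_def intro!: prod_nonneg)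
    qed
    \<comment> \<open>The iteration needs positive numbers strictly above the BMO norms, which may
      be 0; \<eta> provides them and is sent to 0 below.\<close>
    have main: "comm b \<alpha> T f \<in> Lp p (nu P p w) \<and>
        Lp_norm p (nu P p w) (comm b \<alpha> T f) \<le> ennreal (R * (\<Prod>j\<in>UNIV. (\<beta> j + \<eta>) ^ \<alpha> j) * y)" if \<eta>: "0 < \<eta>" for \<eta>
    proof -
      have 1: "\<forall>j. b j \<in> BMO \<and> BMO_norm (b j) < ennreal (\<beta> j + \<eta>) \<and> 0 < \<beta> j + \<eta>"
        using b \<eta> by (auto simp: \<beta> ennreal_less_iff \<beta>0 add_nonneg_pos)
      have "mono_on {1..} (\<lambda>t. C0 * \<phi> t)"
        using \<phi>(1) assms(4) by (auto simp: mono_on_def intro: mult_left_mono)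
      then have "weighted_bound P p (comm b \<alpha> T)
          (\<lambda>t. D * (C0 * \<phi> (c ^ n * t)) * t powr (real n * \<mu>) * (\<Prod>j\<in>UNIV. (\<beta> j + \<eta>) ^ \<alpha> j))"
        using D(2)[OF T T_bound _ _ 1] \<phi>(2) assms(4) unfolding comm_eq len prod_js by simp
      then have 2: "comm b \<alpha> T f \<in> Lp p (nu P p w) \<and> Lp_norm p (nu P p w) (comm b \<alpha> T f)
          \<le> ennreal (D * (C0 * \<phi> (c ^ n * A)) * A powr (real n * \<mu>) * (\<Prod>j\<in>UNIV. (\<beta> j + \<eta>) ^ \<alpha> j)) * ennreal y"
        using w f unfolding weighted_bound_def A_def y(1)[symmetric] by blast
      have B0: "0 \<le> (\<Prod>j\<in>UNIV. (\<beta> j + \<eta>) ^ \<alpha> j)"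
        using \<eta> by (auto simp: \<beta>0 intro!: prod_nonneg)
      have "\<phi> (c ^ n * A) \<le> \<phi> (c_const P * A)"
        using cA by (intro mono_onD[OF \<phi>(1)]) auto
      then have "D * (C0 * \<phi> (c ^ n * A)) * A powr (real n * \<mu>) * (\<Prod>j\<in>UNIV. (\<beta> j + \<eta>) ^ \<alpha> j) \<le> R * (\<Prod>j\<in>UNIV. (\<beta> j + \<eta>) ^ \<alpha> j)"
        unfolding R_def using D(1) assms(4) B0 by (intro mult_right_mono mult_left_mono) auto
      then have "ennreal (D * (C0 * \<phi> (c ^ n * A)) * A powr (real n * \<mu>) * (\<Prod>j\<in>UNIV. (\<beta> j + \<eta>) ^ \<alpha> j)) * ennreal y
          \<le> ennreal (R * (\<Prod>j\<in>UNIV. (\<beta> j + \<eta>) ^ \<alpha> j)) * ennreal y"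
        by (rule mult_right_mono[OF ennreal_leI]) simp
      also have "\<dots> = ennreal (R * (\<Prod>j\<in>UNIV. (\<beta> j + \<eta>) ^ \<alpha> j) * y)"
        using R B0 by (simp add: ennreal_mult'[symmetric])
      finally show ?thesis
        using 2 by (blast intro: order_trans)
    qed
    from main[of 1] show Lp: "comm b \<alpha> T f \<in> Lp p (nu P p w)"
      by simp
    define x where "x = enn2real (Lp_norm p (nu P p w) (comm b \<alpha> T f))"
    have x: "Lp_norm p (nu P p w) (comm b \<alpha> T f) = ennreal x"
      unfolding x_def by (rule Lp_norm_finite[OF Lp])
    have "x \<le> R * (\<Prod>j\<in>UNIV. \<beta> j ^ \<alpha> j) * y"
    proof (rule tendsto_lowerbound)
      have "((\<lambda>\<eta>. R * (\<Prod>j\<in>UNIV. (\<beta> j + \<eta>) ^ \<alpha> j) * y) \<longlongrightarrow> R * (\<Prod>j\<in>UNIV. (\<beta> j + 0) ^ \<alpha> j) * y) (at_right 0)"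
        by (intro tendsto_intros)
      then show "((\<lambda>\<eta>. R * (\<Prod>j\<in>UNIV. (\<beta> j + \<eta>) ^ \<alpha> j) * y) \<longlongrightarrow> R * (\<Prod>j\<in>UNIV. \<beta> j ^ \<alpha> j) * y) (at_right 0)"
        by simp
      show "\<forall>\<^sub>F \<eta> in at_right 0. x \<le> R * (\<Prod>j\<in>UNIV. (\<beta> j + \<eta>) ^ \<alpha> j) * y"
        using eventually_at_right_less
      proof eventually_elim
        case (elim \<eta>)
        have "0 \<le> R * (\<Prod>j\<in>UNIV. (\<beta> j + \<eta>) ^ \<alpha> j) * y"
          using R y(2) elim by (auto simp: \<beta>0 intro!: mult_nonneg_nonneg prod_nonneg)
        then show ?case
          using main[OF elim] unfolding x by (auto simp: x_def)
      qed
    qed simp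
    \<comment> \<open>The product of the factorials is at least 1, so it can be inserted on the
      right.\<close>
    also have "R * (\<Prod>j\<in>UNIV. \<beta> j ^ \<alpha> j) * y \<le> (\<Prod>j\<in>UNIV. fact (\<alpha> j)) * (R * (\<Prod>j\<in>UNIV. \<beta> j ^ \<alpha> j) * y)"
    proof -
      have "0 \<le> R * (\<Prod>j\<in>UNIV. \<beta> j ^ \<alpha> j) * y"
        using R y(2) by (auto simp: \<beta>0 intro!: mult_nonneg_nonneg prod_nonneg)
      moreover have "1 \<le> (\<Prod>j\<in>UNIV. fact (\<alpha> j) :: real)"
        by (intro prod_ge_1) auto
      ultimately show ?thesis
        using mult_right_mono[of 1 "\<Prod>j\<in>UNIV. fact (\<alpha> j)"] by simp
    qed
    finally have "ennreal x \<le> ennreal (((\<Prod>j\<in>UNIV. fact (\<alpha> j)) * R) * ((\<Prod>j\<in>UNIV. \<beta> j ^ \<alpha> j) * y))"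
      by (simp add: mult_ac ennreal_leI)
    also have "\<dots> = ennreal ((\<Prod>j\<in>UNIV. fact (\<alpha> j)) * R) * (ennreal (\<Prod>j\<in>UNIV. \<beta> j ^ \<alpha> j) * ennreal y)"
    proof -
      have "0 \<le> (\<Prod>j\<in>UNIV. fact (\<alpha> j)) * R" "0 \<le> (\<Prod>j\<in>UNIV. \<beta> j ^ \<alpha> j)"
        using R \<beta>0 by (auto intro!: mult_nonneg_nonneg prod_nonneg)
      then show ?thesis
        by (simp only: ennreal_mult')
    qed
    also have "ennreal (\<Prod>j\<in>UNIV. \<beta> j ^ \<alpha> j) * ennreal y = (\<Prod>j\<in>UNIV. BMO_norm (b j) ^ \<alpha> j * Lp_norm (P j) (w j) (f j))"
      unfolding prod.distrib y(1) \<beta> by (simp add: prod_ennreal[symmetric] \<beta>0 ennreal_power)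
    also have "(\<Prod>j\<in>UNIV. fact (\<alpha> j)) * R = D * C0 * (\<Prod>j\<in>UNIV. fact (\<alpha> j)) * \<phi> (c_const P * A) * A powr (real n * \<mu>)"
      by (simp add: R_def mult_ac)
    finally show "Lp_norm p (nu P p w) (comm b \<alpha> T f)
           \<le> ennreal (D * C0 * (\<Prod>j\<in>UNIV. fact (\<alpha> j)) * \<phi> (c_const P * enn2real (AP_char P p w)) *
                enn2real (AP_char P p w)
                  powr (real (\<Sum>j\<in>UNIV. \<alpha> j) * Max (insert p (range (\<lambda>j. conj_exp (P j)))))) *
             (\<Prod>j\<in>UNIV. BMO_norm (b j) ^ \<alpha> j * Lp_norm (P j) (w j) (f j))"
      unfolding x A_def n_def \<mu>_def .
  qed (use D(1) assms(4) in simp)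
qed

end
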